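(* Let $\varphi:\mathbb{R}_+\to\mathbb{R}$ be a non-decreasing $\mathcal{C}^1$ function such that $\varphi(0)>0$, $\limsup_{t\to\infty}\frac{\varphi(t)}{\sqrt{2t\log\log t}}<1$, and $2\varphi'(t)\sqrt{1+t}\le 1$ for all $t\ge 0$. Let $\tau_\varphi=\inf\{t>0: B_t=\varphi(t)\}$ be the first-passage time of a standard one-dimensional Brownian motion $B$ to $\varphi$, and for $\epsilon>0$ let $(\tau_\varphi^\epsilon,\mathcal{N}_\epsilon)$ be the output of Algorithm 1 (described in the context). 1. The random variable $\tau_\varphi^\epsilon$ converges in distribution to $\tau_\varphi$ as $\epsilon\to 0$. More precisely, if $F$ and $F_\epsilon$ denote the cumulative distribution functions of $\tau_\varphi$ and $\tau_\varphi^\epsilon$ respectively, then $$F_\epsilon(t-\epsilon)-\frac{3\sqrt{\epsilon}}{\sqrt{2\pi}}\le F(t)\le F_\epsilon(t)\quad\text{for any } t\ge\epsilon.$$ 2. There exist constants $C>0$ and $\epsilon_0\in(0,1)$ such that for all $\epsilon\in(0,\epsilon_0)$ the random number of iterations satisfies $$\mathbb{E}[\mathcal{N}_\epsilon]\le C\sqrt{|\log\epsilon|}.$$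
   Context: Algorithm 1. Let $\epsilon>0$ and let $(G_n)_{n\ge 0}$ be independent standard Gaussian random variables. Initialization: $T_0=0$, $T_1=(\varphi(0)/G_0)^2$, $\mathcal{N}_\epsilon=1$. While $\varphi(T_1)-\varphi(T_0)>\epsilon$, do simultaneously $(T_0,T_1)\leftarrow\big(T_1,\;T_1+(\varphi(T_1)-\varphi(T_0))^2/G_{\mathcal{N}_\epsilon}^2\big)$ and then $\mathcal{N}_\epsilon\leftarrow\mathcal{N}_\epsilon+1$. Outcome: $\tau_\varphi^\epsilon:=T_1$ and $\mathcal{N}_\epsilon$. Equivalently: set $t_0=0$, $t_1=(\varphi(0)/G_0)^2$ and $t_{n+1}=t_n+(\varphi(t_n)-\varphi(t_{n-1}))^2/G_n^2$ for $n\ge 1$; then $\mathcal{N}_\epsilon=\inf\{n\ge 1:\varphi(t_n)-\varphi(t_{n-1})\le\epsilon\}$ and $\tau_\varphi^\epsilon=t_{\mathcal{N}_\epsilon}$. *)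

theory Defs
  imports "HOL-Probability.Probability"
begin

locale standard_brownian_motion = prob_space M
  for M :: "'a measure" and B :: "real \<Rightarrow> 'a \<Rightarrow> real" +
  assumes measurable: "t \<ge> 0 \<Longrightarrow> B t \<in> borel_measurable M"
    and start: "\<omega> \<in> space M \<Longrightarrow> B 0 \<omega> = 0"
    and continuous_paths: "\<omega> \<in> space M \<Longrightarrow> continuous_on {0..} (\<lambda>t. B t \<omega>)"
    and independent_increments:
      "\<And>t. 0 \<le> t 0 \<Longrightarrow> incseq t \<Longrightarrow>
        indep_vars (\<lambda>_. borel) (\<lambda>i \<omega>. B (t (Suc i)) \<omega> - B (t i) \<omega>) (UNIV :: nat set)"
    and gaussian_increments:
      "0 \<le> s \<Longrightarrow> s < t \<Longrightarrow>
        distributed M lborel (\<lambda>\<omega>. B t \<omega> - B s \<omega>) (normal_density 0 (sqrt (t - s)))"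

text \<open>The infimum is taken in the extended reals, so it is \<open>\<infinity>\<close> on paths that never meet \<open>\<phi>\<close>.\<close>

definition first_passage_time :: "(real \<Rightarrow> real) \<Rightarrow> (real \<Rightarrow> 'a \<Rightarrow> real) \<Rightarrow> 'a \<Rightarrow> ereal" where
  "first_passage_time \<phi> B \<omega> = Inf (ereal ` {t. t > 0 \<and> B t \<omega> = \<phi> t})"

text \<open>The algorithm is a deterministic function of the realisation \<open>g\<close> of the Gaussian sequence:
  \<open>alg_time\<close> gives the successive values of \<open>T\<^sub>1\<close>, preceded by 0. If some \<open>g n\<close> vanishes (an event
  of probability 0), the quotient is 0 by the convention for division.\<close>

fun alg_time :: "(real \<Rightarrow> real) \<Rightarrow> (nat \<Rightarrow> real) \<Rightarrow> nat \<Rightarrow> real" where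
  "alg_time \<phi> g 0 = 0"
| "alg_time \<phi> g (Suc 0) = (\<phi> 0 / g 0)\<^sup>2"
| "alg_time \<phi> g (Suc (Suc n)) = alg_time \<phi> g (Suc n)
     + (\<phi> (alg_time \<phi> g (Suc n)) - \<phi> (alg_time \<phi> g n))\<^sup>2 / (g (Suc n))\<^sup>2"

text \<open>Both outputs are \<open>\<infinity>\<close> if the algorithm does not terminate.\<close>

definition alg_iterations :: "(real \<Rightarrow> real) \<Rightarrow> real \<Rightarrow> (nat \<Rightarrow> real) \<Rightarrow> enat" where
  "alg_iterations \<phi> \<epsilon> g =
     Inf (enat ` {n. n \<ge> 1 \<and> \<phi> (alg_time \<phi> g n) - \<phi> (alg_time \<phi> g (n - 1)) \<le> \<epsilon>})"

definition alg_output :: "(real \<Rightarrow> real) \<Rightarrow> real \<Rightarrow> (nat \<Rightarrow> real) \<Rightarrow> ereal" where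
  "alg_output \<phi> \<epsilon> g =
     (case alg_iterations \<phi> \<epsilon> g of enat n \<Rightarrow> ereal (alg_time \<phi> g n) | \<infinity> \<Rightarrow> \<infinity>)"

text \<open>The distribution on the real line of an almost surely finite extended random variable; the
  value that \<open>real_of_ereal\<close> assigns to \<open>\<infinity>\<close> is irrelevant only under this finiteness.\<close>

definition law :: "'a measure \<Rightarrow> ('a \<Rightarrow> ereal) \<Rightarrow> real measure" where
  "law M X = distr M borel (\<lambda>\<omega>. real_of_ereal (X \<omega>))"

end

theory Submission
  imports Defs
begin

text \<open>Let \<open>d n = \<phi> (t n) - \<phi> (t (n - 1))\<close>. If \<open>t n\<close> is the first time at which \<open>B\<close> reaches the
  level \<open>\<phi> (t (n - 1))\<close>, then by the strong Markov property and the reflection principle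
  \<open>t (n + 1) - t n\<close> is distributed as \<open>(d n / G n)\<^sup>2\<close>, so the algorithm samples successive
  passage times below \<open>\<tau>\<close>, and at its stopping time the path is within \<open>\<epsilon>\<close> of a curve of slope
  at most \<open>1/2\<close>, which it crosses within time \<open>\<epsilon>\<close> unless a Gaussian variable is smaller than
  \<open>3 sqrt \<epsilon> / 2\<close>. Only one step of this is needed: the probability \<open>Q\<close> of crossing before \<open>t\<close>,
  as a function of the starting point, equals its mean after one step of the algorithm. One
  inequality is proved for strict crossing on an open time interval, which is lower
  semicontinuous in the starting point, the other for weak crossing on a closed interval, which is
  upper semicontinuous; both follow from the restart of a random walk on dyadic grids.

  For the number of iterations, put \<open>s n = sqrt (1 + t n)\<close>. The condition on \<open>\<phi>'\<close> gives
  \<open>d (n + 1) \<le> s (n + 1) - s n\<close>, hence \<open>(d n)\<^sup>2 / s n\<close> is multiplied by at most \<open>5 / (29 (G n)\<^sup>2)\<close>,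
  which has a moment of order \<open>1/16\<close> less than 1: this moment decays geometrically. Moreover
  \<open>d (n + 1) \<le> (d n / G n)\<^sup>2\<close>, so halving the exponent at each further step bounds
  the moment of order \<open>1 / (16 * 2 ^ k)\<close> after \<open>k\<close> more steps, and
  \<open>\<epsilon> powr (- 1 / (16 * 2 ^ k))\<close> is bounded as soon as \<open>\<bar>ln \<epsilon>\<bar> \<le> 2 ^ k\<close>.\<close>

section \<open>Negative moments of the Gaussian law\<close>

text \<open>Neither estimate on the gaps is enough alone. Contraction with Markov's inequality needs
  about \<open>\<bar>ln \<epsilon>\<bar>\<close> steps to come below \<epsilon>; squaring is fast
  but useless while \<open>d n\<close> exceeds \<open>(G n)\<^sup>2\<close>. Working with moments
  avoids deciding at which random step the second regime begins: the contracting steps come first, a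
  deterministic number \<open>k\<close> of squaring steps last. In the comparison the obstacle is
  the overshoot: a walk on a grid is strictly above a level when it first passes it, so the equation
  for \<open>Q\<close> is only reached in the limit. The overshoot helps in one direction and hurts
  in the other, and each kind of crossing is the one that is stable under the limit of its
  direction. Along the algorithm the strict crossing probability is then a supermartingale and the
  weak one a submartingale; runs are cut after \<open>n\<close> steps, so that a plain induction
  replaces optional stopping. That \<tau> is finite almost surely comes out of the comparison,
  because the algorithm terminates.\<close>

abbreviation std_gauss :: "real measure" where
  "std_gauss \<equiv> density lborel (\<lambda>x. ennreal (std_normal_density x))"

abbreviation gauss_seq :: "(nat \<Rightarrow> real) measure" where
  "gauss_seq \<equiv> \<Pi>\<^sub>M i\<in>UNIV. std_gauss"

interpretation std_gauss: prob_space std_gauss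
  by (rule prob_space_normal_density) simp

interpretation gauss_seq: sequence_space std_gauss
  by unfold_locales

text \<open>The moment bounds and the comparison are proved by induction from the front: one
  Gaussian step, then the hypothesis at the state reached. This integrates out that first
  Gaussian.\<close>

lemma (in sequence_space) nn_integral_iter:
  assumes [measurable]: "f \<in> borel_measurable S"
  shows "(\<integral>\<^sup>+\<omega>. f \<omega> \<partial>S) = (\<integral>\<^sup>+x. \<integral>\<^sup>+\<omega>. f (case_nat x \<omega>) \<partial>S \<partial>M)"
proof -
  have m: "(\<lambda>(s, \<omega>). case_nat s \<omega>) \<in> measurable (M \<Otimes>\<^sub>M S) S"
    by measurable
  have "(\<integral>\<^sup>+\<omega>. f \<omega> \<partial>S) = (\<integral>\<^sup>+\<omega>. f \<omega> \<partial>distr (M \<Otimes>\<^sub>M S) S (\<lambda>(s, \<omega>). case_nat s \<omega>))"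
    by (simp only: PiM_iter)
  also have "\<dots> = (\<integral>\<^sup>+z. f (case z of (s, \<omega>) \<Rightarrow> case_nat s \<omega>) \<partial>(M \<Otimes>\<^sub>M S))"
    by (rule nn_integral_distr[OF m]) measurable
  also have "\<dots> = (\<integral>\<^sup>+x. \<integral>\<^sup>+\<omega>. f (case (x, \<omega>) of (s, \<omega>) \<Rightarrow> case_nat s \<omega>) \<partial>S \<partial>M)"
    by (rule P.nn_integral_fst[symmetric]) (use m in measurable)
  finally show ?thesis by simp
qed

text \<open>Among densities bounded by \<open>1 / sqrt (2 * pi)\<close>, the uniform one on
  \<open>{-c..c}\<close> concentrates most mass near 0 and so maximises the mean of a decreasing
  function of \<open>\<bar>x\<bar>\<close>. The choice \<open>c = sqrt (pi/2)\<close> gives it mass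
  1, and its mean is \<open>c powr (-q) / (1 - q)\<close>.\<close>

lemma gauss_inverse_moment:
  assumes q: "0 < q" "q < 1"
  shows "(\<integral>\<^sup>+x. ennreal (\<bar>x\<bar> powr (-q)) \<partial>std_gauss) \<le> ennreal ((pi/2) powr (-q/2) / (1 - q))"
proof -
  define c where "c = sqrt (pi/2)"
  have c: "c > 0" by (simp add: c_def)
  \<comment> \<open>On \<open>{-c..c}\<close> the \<open>max\<close> acts at 0 only, where
    \<open>powr\<close> returns 0 instead of infinity; this null set does not change the
    integral.\<close>
  define k where "k x = (if x \<in> {-c..c} then max 0 (\<bar>x\<bar> powr (-q) - c powr (-q)) else 0)" for x :: real
  define I where "I = c powr (1 - q) * (q / (1 - q))"
  have I0: "I \<ge> 0" using q c by (simp add: I_def)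
  have right: "((\<lambda>x. \<bar>x\<bar> powr (-q) - c powr (-q)) has_integral I) {0..c}"
  proof -
    have "((\<lambda>x. x powr (-q) - c powr (-q)) has_integral
        (c powr (-q+1) / (-q+1) - c powr (-q) * (c - 0))) {0..c}"
      using q c has_integral_const_real[of "c powr (-q)" 0 c]
      by (intro has_integral_diff has_integral_powr_from_0) (auto simp: mult.commute)
    moreover have "c powr (-q+1) / (-q+1) - c powr (-q) * (c - 0) = I"
    proof -
      have *: "c powr (-q) * c = c powr (1 - q)"
        using c by (simp add: powr_diff powr_minus field_simps)
      show ?thesis unfolding I_def using q * by (simp add: field_simps)
    qed
    ultimately have "((\<lambda>x. x powr (-q) - c powr (-q)) has_integral I) {0..c}" by simp
    then show ?thesis by (rule has_integral_eq[rotated]) auto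
  qed
  have left: "((\<lambda>x. \<bar>x\<bar> powr (-q) - c powr (-q)) has_integral I) {-c..0}"
    using right has_integral_reflect_real[of "\<lambda>x. \<bar>x\<bar> powr (-q) - c powr (-q)" I c 0] by simp
  have "((\<lambda>x. \<bar>x\<bar> powr (-q) - c powr (-q)) has_integral (I + I)) {-c..c}"
    by (rule has_integral_combine[OF _ _ left right]) (use c in auto)
  then have "((\<lambda>x. max 0 (\<bar>x\<bar> powr (-q) - c powr (-q))) has_integral (I + I)) {-c..c}"
  proof (rule has_integral_spike[of "{0}", rotated 2])
    fix x assume x: "x \<in> {-c..c} - {0}"
    then have "c powr (-q) \<le> \<bar>x\<bar> powr (-q)"
      using q by (intro powr_mono2') auto
    then show "max 0 (\<bar>x\<bar> powr (-q) - c powr (-q)) = \<bar>x\<bar> powr (-q) - c powr (-q)" by simp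
  qed simp
  then have kint: "(k has_integral (I + I)) UNIV"
    unfolding k_def by (subst has_integral_restrict_UNIV) 
  have [measurable]: "k \<in> borel_measurable borel" unfolding k_def by measurable
  have kn: "(\<integral>\<^sup>+x. ennreal (k x) \<partial>lborel) = ennreal (I + I)"
    by (rule nn_integral_has_integral_lborel[OF _ _ kint]) (auto simp: k_def)
  \<comment> \<open>The density is at most \<open>1 / sqrt (2 * pi)\<close>, and this bound is used on \<open>{-c..c}\<close> only.\<close>
  have pt: "std_normal_density x * \<bar>x\<bar> powr (-q) \<le> c powr (-q) * std_normal_density x + k x / sqrt (2*pi)" for x
  proof -
    have d: "0 \<le> std_normal_density x" "std_normal_density x \<le> 1 / sqrt (2*pi)"
      by (auto simp: std_normal_density_def divide_simps)
    show ?thesis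
    proof (cases "\<bar>x\<bar> powr (-q) \<le> c powr (-q)")
      case True
      then have "std_normal_density x * \<bar>x\<bar> powr (-q) \<le> c powr (-q) * std_normal_density x"
        using d by (subst mult.commute) (intro mult_right_mono)
      moreover have "0 \<le> k x / sqrt (2*pi)" by (auto simp: k_def)
      ultimately show ?thesis by linarith
    next
      case False
      have "\<bar>x\<bar> \<le> c"
      proof (rule ccontr)
        assume "\<not> \<bar>x\<bar> \<le> c"
        then have "\<bar>x\<bar> powr (-q) \<le> c powr (-q)" using q c by (intro powr_mono2') auto
        with False show False by simp
      qed
      then have k: "k x = \<bar>x\<bar> powr (-q) - c powr (-q)" using False by (auto simp: k_def)
      have "std_normal_density x * (\<bar>x\<bar> powr (-q) - c powr (-q)) \<le> 1 / sqrt (2*pi) * (\<bar>x\<bar> powr (-q) - c powr (-q))"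
        using d False by (intro mult_right_mono) auto
      then show ?thesis unfolding k by (simp add: algebra_simps diff_divide_distrib)
    qed
  qed
  have "(\<integral>\<^sup>+x. ennreal (\<bar>x\<bar> powr (-q)) \<partial>std_gauss) = (\<integral>\<^sup>+x. ennreal (std_normal_density x * \<bar>x\<bar> powr (-q)) \<partial>lborel)"
    by (subst nn_integral_density) (auto simp: ennreal_mult')
  also have "\<dots> \<le> (\<integral>\<^sup>+x. ennreal (c powr (-q)) * ennreal (std_normal_density x) + ennreal (1 / sqrt (2*pi)) * ennreal (k x) \<partial>lborel)"
    using pt by (intro nn_integral_mono) (auto simp: k_def simp flip: ennreal_mult' ennreal_plus intro!: ennreal_leI)
  also have "\<dots> = ennreal (c powr (-q)) * (\<integral>\<^sup>+x. ennreal (std_normal_density x) \<partial>lborel) + ennreal (1 / sqrt (2*pi)) * ennreal (I + I)"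
    by (subst nn_integral_add) (auto simp: nn_integral_cmult kn)
  also have "(\<integral>\<^sup>+x. ennreal (std_normal_density x) \<partial>lborel) = 1"
    using std_gauss.emeasure_space_1 by (simp add: emeasure_density)
  also have "ennreal (c powr (-q)) * 1 + ennreal (1 / sqrt (2*pi)) * ennreal (I + I) = ennreal (c powr (-q) + (I + I) / sqrt (2*pi))"
    using I0 by (simp flip: ennreal_mult' ennreal_plus)
  also have "c powr (-q) + (I + I) / sqrt (2*pi) = (pi/2) powr (-q/2) / (1 - q)"
  proof -
    have "2 * c / sqrt (2*pi) = 1"
      unfolding c_def by (simp add: real_sqrt_divide real_sqrt_mult field_simps)
    moreover have "c powr (1 - q) = c powr (-q) * c"
      using c by (simp add: powr_diff powr_minus field_simps)
    ultimately have "(I + I) / sqrt (2*pi) = (2 * c / sqrt (2*pi)) * (c powr (-q) * (q / (1 - q)))"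
      unfolding I_def by simp
    then have "(I + I) / sqrt (2*pi) = c powr (-q) * (q / (1 - q))"
      unfolding \<open>2 * c / sqrt (2*pi) = 1\<close> by simp
    moreover have "c powr (-q) = (pi/2) powr (-q/2)"
      unfolding c_def by (simp add: powr_half_sqrt[symmetric] powr_powr)
    moreover have "m + m * (q / (1 - q)) = m / (1 - q)" for m
      using q by (simp add: field_simps)
    ultimately show ?thesis by simp
  qed
  finally show ?thesis .
qed

text \<open>With an exponent linear in \<open>q\<close>, the factors for \<open>q\<close>,
  \<open>q/2\<close>, \<open>q/4\<close> and so on multiply to at most \<open>exp (4*q)\<close>,
  however many there are.\<close>

lemma gauss_inverse_moment_le_exp:
  assumes q: "0 < q" "q \<le> 1/2"
  shows "(\<integral>\<^sup>+x. ennreal (\<bar>x\<bar> powr (-q)) \<partial>std_gauss) \<le> ennreal (exp (2*q))"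
proof -
  have "(pi/2) powr (-q/2) \<le> 1"
    using q pi_ge_two powr_mono[of "-q/2" 0 "pi/2"] by auto
  then have "(pi/2) powr (-q/2) / (1 - q) \<le> 1 / (1 - q)"
    using q by (intro divide_right_mono) auto
  also have "1 / (1 - q) \<le> 1 + 2*q"
  proof -
    have "q * q \<le> q * (1/2)" using q by (intro mult_left_mono) auto
    then show ?thesis using q by (simp add: field_simps)
  qed
  also have "1 + 2*q \<le> exp (2*q)" by (rule exp_ge_add_one_self)
  finally show ?thesis
    using gauss_inverse_moment[of q] q by (auto intro: order_trans ennreal_leI)
qed

text \<open>With \<open>1/16\<close> replaced by \<open>p\<close> and \<open>1/8\<close> by
  \<open>2*p\<close>, the logarithm of the left side is
  \<open>p * (ln (5/29) - ln (pi/2) + 2)\<close>, about \<open>-0.21 * p\<close>, up to order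
  \<open>p\<^sup>2\<close>. Hence a small \<open>p\<close> is needed; \<open>1/16\<close> is small
  enough, and the 16th power clears the roots and leaves about 0.93.\<close>

lemma contraction_rate_less_1:
  "(5/29) powr (1/16) * ((pi/2) powr (-(1/8)/2) / (1 - 1/8)) < (1::real)"
proof -
  define r where "r = (5/29) powr (1/16) * ((pi/2) powr (-(1/8)/2) / (1 - 1/8) :: real)"
  have r0: "r > 0" unfolding r_def by simp
  have "r powr 16 = (5/29) powr 1 * ((pi/2) powr (-1) * (8/7) powr 16)"
    unfolding r_def by (simp add: powr_mult powr_divide powr_powr powr_minus)
  also have "\<dots> = (5/29) * (8/7)^16 * (2 / pi)"
    using powr_realpow[of "8/7::real" 16] by (simp add: powr_minus field_simps)
  also have "\<dots> \<le> (5/29) * (8/7)^16 * (2 / 3.14)"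
    using pi_approx by (intro mult_left_mono divide_left_mono) auto
  also have "\<dots> < 1" by (simp add: power_divide)
  finally have "r powr 16 < 1" .
  then have "r < 1"
    using r0 ge_one_powr_ge_zero[of r 16] by (smt (verit))
  then show ?thesis unfolding r_def .
qed

section \<open>Moments of the gaps of the algorithm\<close>

text \<open>A state is a pair of the current gap \<open>\<phi> (t n) - \<phi> (t (n - 1))\<close> and the current time \<open>t n\<close>.
  The start \<open>(\<phi> 0, 0)\<close> makes the first step of the algorithm a step like the others.\<close>

primrec alg_step :: "(real \<Rightarrow> real) \<Rightarrow> real \<times> real \<Rightarrow> real \<Rightarrow> real \<times> real" where
  "alg_step \<phi> (d, t) x = (\<phi> (t + d\<^sup>2 / x\<^sup>2) - \<phi> t, t + d\<^sup>2 / x\<^sup>2)"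

primrec alg_state :: "(real \<Rightarrow> real) \<Rightarrow> real \<times> real \<Rightarrow> (nat \<Rightarrow> real) \<Rightarrow> nat \<Rightarrow> real \<times> real" where
  "alg_state \<phi> s g 0 = s"
| "alg_state \<phi> s g (Suc n) = alg_step \<phi> (alg_state \<phi> s g n) (g n)"

text \<open>The recursion adds a step at the end, whereas integrating out the first Gaussian removes
  one at the front.\<close>

lemma alg_state_case_nat:
  "alg_state \<phi> s (case_nat x g) (Suc n) = alg_state \<phi> (alg_step \<phi> s x) g n"
  by (induction n) auto

lemma snd_alg_step: "snd (alg_step \<phi> s x) = snd s + (fst s)\<^sup>2 / x\<^sup>2"
  by (cases s) auto

lemma fst_alg_step: "fst (alg_step \<phi> s x) = \<phi> (snd s + (fst s)\<^sup>2 / x\<^sup>2) - \<phi> (snd s)"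
  by (cases s) auto

lemma alg_state_eq_alg_time:
  "alg_state \<phi> (\<phi> 0, 0) g n =
     ((if n = 0 then \<phi> 0 else \<phi> (alg_time \<phi> g n) - \<phi> (alg_time \<phi> g (n - 1))), alg_time \<phi> g n)"
proof (induction n)
  case (Suc n)
  show ?case
    by (cases n) (use Suc in \<open>auto simp: power_divide\<close>)
qed simp

lemma power2_powr_half: "0 \<le> y \<Longrightarrow> (y\<^sup>2) powr (q/2) = (y::real) powr q"
  by (cases "y = 0") (simp_all add: powr_powr flip: powr_numeral)

text \<open>\<open>growth\<close> is the derivative condition after integration, since
  \<open>sqrt (1 + t)\<close> has derivative \<open>1 / (2 * sqrt (1 + t))\<close>. In this form the
  derivative does not enter the probabilistic part.\<close>

locale slow_curve =
  fixes \<phi> :: "real \<Rightarrow> real"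
  assumes mono: "mono \<phi>"
    and cont: "continuous_on UNIV \<phi>"
    and pos: "\<phi> 0 > 0"
    and growth: "0 \<le> s \<Longrightarrow> s \<le> t \<Longrightarrow> \<phi> t - \<phi> s \<le> sqrt (1 + t) - sqrt (1 + s)"
begin

lemma measurable_curve[measurable]: "\<phi> \<in> borel_measurable borel"
  by (rule borel_measurable_continuous_onI[OF cont])

lemma measurable_alg_step[measurable]:
  "(\<lambda>(s, x). alg_step \<phi> s x) \<in> (borel \<Otimes>\<^sub>M borel) \<Otimes>\<^sub>M borel \<rightarrow>\<^sub>M borel \<Otimes>\<^sub>M borel"
proof -
  have "(\<lambda>(s, x). alg_step \<phi> s x) =
      (\<lambda>(s, x). (\<phi> (snd s + (fst s)\<^sup>2 / x\<^sup>2) - \<phi> (snd s), snd s + (fst s)\<^sup>2 / x\<^sup>2))"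
    by (auto simp: fun_eq_iff)
  then show ?thesis by simp
qed

lemma measurable_alg_state[measurable]:
  "(\<lambda>g. alg_state \<phi> s g n) \<in> gauss_seq \<rightarrow>\<^sub>M borel \<Otimes>\<^sub>M borel"
proof (induction n)
  case 0
  show ?case by (cases s) simp
next
  case (Suc n)
  note Suc[measurable]
  have [measurable]: "(\<lambda>g. g n) \<in> gauss_seq \<rightarrow>\<^sub>M borel"
    using measurable_component_singleton[of n UNIV "\<lambda>_. std_gauss"] by simp
  have "(\<lambda>g. (\<lambda>(s, x). alg_step \<phi> s x) (alg_state \<phi> s g n, g n)) \<in> gauss_seq \<rightarrow>\<^sub>M borel \<Otimes>\<^sub>M borel"
    by (rule measurable_compose[OF _ measurable_alg_step]) measurable
  then show ?case by simp
qed

lemma measurable_alg_step_right[measurable]: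
  "(\<lambda>x. alg_step \<phi> s x) \<in> std_gauss \<rightarrow>\<^sub>M borel \<Otimes>\<^sub>M borel"
proof -
  have "(\<lambda>x. (\<lambda>(s, x). alg_step \<phi> s x) (s, x)) \<in> borel \<rightarrow>\<^sub>M borel \<Otimes>\<^sub>M borel"
    by (rule measurable_compose[OF measurable_Pair1' measurable_alg_step]) (simp add: space_pair_measure)
  then show ?thesis by simp
qed

lemma alg_step_nonneg:
  assumes "0 \<le> snd s"
  shows "0 \<le> fst (alg_step \<phi> s x)" "snd s \<le> snd (alg_step \<phi> s x)"
  using assms mono by (auto simp: snd_alg_step fst_alg_step intro!: monoD[OF mono])

text \<open>For the values \<open>u\<close>, \<open>v\<close> of \<open>sqrt (1 + t)\<close> before
  and after the step, the elapsed time is \<open>k = (v - u) * (v + u)\<close> and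
  \<open>d' \<le> v - u\<close>. The first bound uses \<open>v + u \<ge> 2 * u\<close>. In the
  second, the ratio of \<open>(v - u)\<^sup>2 / v\<close> to \<open>k / u\<close> depends on
  \<open>v / u\<close> only and is largest at \<open>1 + sqrt 2\<close>. The case
  \<open>x = 0\<close> fits in: the state then stays where it is and the new gap is 0.\<close>

lemma alg_step_gap:
  assumes s: "0 \<le> d" "0 \<le> t" and step: "alg_step \<phi> (d, t) x = (d', t')"
  shows alg_step_gap_quadratic: "d' \<le> (d\<^sup>2 / sqrt (1 + t)) / (2 * x\<^sup>2)"
    and alg_step_gap_contract: "d'\<^sup>2 / sqrt (1 + t') \<le> 5/29 * (d\<^sup>2 / sqrt (1 + t)) / x\<^sup>2"
proof -
  define u v where "u = sqrt (1 + t)" and "v = sqrt (1 + t')"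
  have t': "t' = t + d\<^sup>2 / x\<^sup>2" and d': "d' = \<phi> t' - \<phi> t"
    using step by auto
  have tt': "t \<le> t'" using t' by simp
  have u1: "1 \<le> u" and uv: "u \<le> v" using s tt' by (auto simp: u_def v_def)
  have d0: "0 \<le> d'" using mono tt' d' by (auto simp: monoD)
  have dv: "d' \<le> v - u" using growth[of t t'] s tt' d' by (auto simp: u_def v_def)
  define k where "k = d\<^sup>2 / x\<^sup>2"
  have k: "k = v\<^sup>2 - u\<^sup>2" using s tt' t' by (simp add: k_def u_def v_def)
  have uvk: "(v - u) * (v + u) = k" unfolding k by algebra
  have k0: "k \<ge> 0" by (simp add: k_def)
  have "(v - u) * (2 * u) \<le> (v - u) * (v + u)"
    using uv u1 by (intro mult_left_mono) auto
  then have "v - u \<le> k / (2 * u)" using u1 uvk by (simp add: field_simps)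
  then show "d' \<le> (d\<^sup>2 / sqrt (1 + t)) / (2 * x\<^sup>2)"
    using dv unfolding k_def u_def by (simp add: field_simps)
  have "d'\<^sup>2 \<le> (v - u)\<^sup>2" using d0 dv by (intro power_mono) auto
  moreover have "29 * ((v - u)\<^sup>2 * u) \<le> 5 * (k * v)"
  proof -
    \<comment> \<open>\<open>5/29\<close> is a rational just above \<open>3 - 2 sqrt 2\<close>, the maximum of \<open>(r - 1) / (r (r + 1))\<close> for \<open>r = v / u\<close>.\<close>
    have "0 \<le> (u * 2.4 - v)\<^sup>2 + 0.04 * u\<^sup>2" by simp
    then have "29 * ((v - u) * u) \<le> 5 * ((v + u) * v)"
      by (simp add: power2_eq_square algebra_simps)
    then have "(v - u) * (29 * ((v - u) * u)) \<le> (v - u) * (5 * ((v + u) * v))"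
      using uv by (intro mult_left_mono) auto
    then show ?thesis unfolding uvk[symmetric] by (simp add: power2_eq_square algebra_simps)
  qed
  ultimately have "29 * (d'\<^sup>2 * u) \<le> 5 * (k * v)"
    using u1 by (meson mult_left_mono mult_right_mono order_trans zero_le_numeral order.trans zero_le_one)
  then have "d'\<^sup>2 / v \<le> 5/29 * k / u"
    using u1 uv by (simp add: field_simps)
  then show "d'\<^sup>2 / sqrt (1 + t') \<le> 5/29 * (d\<^sup>2 / sqrt (1 + t)) / x\<^sup>2"
    unfolding k_def u_def v_def by (simp add: field_simps)
qed

lemma alg_state_nonneg:
  assumes "0 \<le> fst s" "0 \<le> snd s"
  shows "0 \<le> fst (alg_state \<phi> s g n)" "0 \<le> snd (alg_state \<phi> s g n)"
proof -
  have "0 \<le> fst (alg_state \<phi> s g n) \<and> 0 \<le> snd (alg_state \<phi> s g n)"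
    using assms by (induction n) (auto simp: alg_step_nonneg intro: order_trans[OF _ alg_step_nonneg(2)])
  then show "0 \<le> fst (alg_state \<phi> s g n)" "0 \<le> snd (alg_state \<phi> s g n)" by auto
qed

text \<open>The gap after the first step is at most \<open>(d / \<bar>x\<bar>)\<^sup>2\<close>, so
  its power \<open>q/2\<close> is at most \<open>d powr q * \<bar>x\<bar> powr (-q)\<close>. The
  hypothesis with \<open>q/2\<close> costs \<open>exp (2*q)\<close> and the Gaussian moment costs
  \<open>exp (2*q)\<close> again, which reproduces \<open>exp (4*q)\<close>.\<close>

lemma gap_moment_doubling:
  assumes "0 < q" "q \<le> 1/2" "0 \<le> d" "0 \<le> t"
  shows "(\<integral>\<^sup>+g. ennreal (fst (alg_state \<phi> (d, t) g k) powr (q / 2^k)) \<partial>gauss_seq)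
    \<le> ennreal (exp (4*q) * d powr q)"
  using assms
proof (induction k arbitrary: q d t)
  case 0
  have "d powr q * 1 \<le> d powr q * exp (4*q)"
    using 0 by (intro mult_left_mono) auto
  then have "ennreal (d powr q) \<le> ennreal (exp (4*q) * d powr q)" by (intro ennreal_leI) (simp add: mult.commute)
  then show ?case using gauss_seq.P.emeasure_space_1 by simp
next
  case (Suc k)
  have step: "(\<integral>\<^sup>+g. ennreal (fst (alg_state \<phi> (alg_step \<phi> (d, t) x) g k) powr (q / 2 ^ Suc k)) \<partial>gauss_seq)
      \<le> ennreal (exp (2*q)) * (ennreal (d powr q) * ennreal (\<bar>x\<bar> powr (-q)))" for x
  proof -
    obtain d' t' where st: "alg_step \<phi> (d, t) x = (d', t')" by (cases "alg_step \<phi> (d, t) x")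
    have nn: "0 \<le> d'" "0 \<le> t'"
      using alg_step_nonneg[of "(d, t)" x] Suc.prems st by auto
    have "(\<integral>\<^sup>+g. ennreal (fst (alg_state \<phi> (d', t') g k) powr (q / 2 / 2 ^ k)) \<partial>gauss_seq)
      \<le> ennreal (exp (4*(q/2)) * d' powr (q/2))"
      using Suc.prems nn by (intro Suc.IH) auto
    also have "d' powr (q/2) \<le> d powr q * \<bar>x\<bar> powr (-q)"
    proof (cases "x = 0")
      case False
      have "d' \<le> (d\<^sup>2 / sqrt (1 + t)) / (2 * x\<^sup>2)"
        using alg_step_gap_quadratic[OF _ _ st] Suc.prems by auto
      also have "\<dots> \<le> (d\<^sup>2 / 1) / (1 * x\<^sup>2)"
        using False Suc.prems by (intro frac_le) auto
      also have "\<dots> = (d / \<bar>x\<bar>)\<^sup>2" by (simp add: power_divide)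
      finally have "d' powr (q/2) \<le> ((d / \<bar>x\<bar>)\<^sup>2) powr (q/2)"
        using nn Suc.prems by (intro powr_mono2) auto
      also have "\<dots> = (d / \<bar>x\<bar>) powr q"
        using Suc.prems by (intro power2_powr_half) auto
      also have "\<dots> = d powr q * \<bar>x\<bar> powr (-q)"
        using Suc.prems by (simp add: powr_divide powr_minus field_simps)
      finally show ?thesis .
    next
      case True
      then show ?thesis using st by auto
    qed
    finally have "(\<integral>\<^sup>+g. ennreal (fst (alg_state \<phi> (d', t') g k) powr (q / 2 / 2 ^ k)) \<partial>gauss_seq)
      \<le> ennreal (exp (2*q) * (d powr q * \<bar>x\<bar> powr (-q)))" by (simp add: ennreal_leI)
    then show ?thesis unfolding st by (simp add: ennreal_mult')
  qed
  have "(\<integral>\<^sup>+g. ennreal (fst (alg_state \<phi> (d, t) g (Suc k)) powr (q / 2 ^ Suc k)) \<partial>gauss_seq)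
      = (\<integral>\<^sup>+x. \<integral>\<^sup>+g. ennreal (fst (alg_state \<phi> (alg_step \<phi> (d, t) x) g k) powr (q / 2 ^ Suc k)) \<partial>gauss_seq \<partial>std_gauss)"
    by (subst gauss_seq.nn_integral_iter) (simp_all only: alg_state_case_nat, measurable)
  also have "\<dots> \<le> (\<integral>\<^sup>+x. ennreal (exp (2*q)) * (ennreal (d powr q) * ennreal (\<bar>x\<bar> powr (-q))) \<partial>std_gauss)"
    by (intro nn_integral_mono step)
  also have "\<dots> = ennreal (exp (2*q)) * (ennreal (d powr q) * (\<integral>\<^sup>+x. ennreal (\<bar>x\<bar> powr (-q)) \<partial>std_gauss))"
    by (simp add: nn_integral_cmult)
  also have "\<dots> \<le> ennreal (exp (2*q)) * (ennreal (d powr q) * ennreal (exp (2*q)))"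
    using Suc.prems by (intro mult_left_mono gauss_inverse_moment_le_exp) auto
  also have "\<dots> = ennreal (exp (2*q) * (d powr q * exp (2*q)))"
    by (simp add: ennreal_mult')
  also have "exp (2*q) * (d powr q * exp (2*q)) = exp (4*q) * d powr q"
  proof -
    have "exp (2*q) * exp (2*q) = exp (4*q)" by (simp flip: exp_add)
    then show ?thesis by (metis mult.commute mult.assoc)
  qed
  finally show ?case .
qed

text \<open>The \<open>Suc n + k\<close> steps are \<open>n\<close> contractions of
  \<open>d\<^sup>2 / sqrt (1 + t)\<close>, one step that turns a bound on this quantity into a bound
  on the gap itself, and \<open>k\<close> squarings. The middle step costs the lone factor
  \<open>m\<close>; the squarings cost \<open>exp (4 * (1/16))\<close>.\<close>

lemma gap_moment:
  assumes "0 \<le> d" "0 \<le> t"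
  defines "m \<equiv> (pi/2) powr (-(1/8)/2) / (1 - 1/8)"
  shows "(\<integral>\<^sup>+g. ennreal (fst (alg_state \<phi> (d, t) g (Suc n + k)) powr (1/16 / 2^k)) \<partial>gauss_seq)
    \<le> ennreal (exp (1/4) * m * ((5/29) powr (1/16) * m) ^ n * (d\<^sup>2 / sqrt (1 + t)) powr (1/16))"
  using assms(1,2)
proof (induction n arbitrary: d t)
  have m0: "m > 0" by (simp add: m_def)
  have moment: "(\<integral>\<^sup>+x. ennreal (\<bar>x\<bar> powr (-(1/8))) \<partial>std_gauss) \<le> ennreal m"
    unfolding m_def by (rule gauss_inverse_moment) auto
  have front: "(\<integral>\<^sup>+g. ennreal (fst (alg_state \<phi> (d, t) g (Suc l)) powr p) \<partial>gauss_seq)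
      \<le> ennreal (a * m * b powr (1/16))"
    if bd: "\<And>x. (\<integral>\<^sup>+g. ennreal (fst (alg_state \<phi> (alg_step \<phi> (d, t) x) g l) powr p) \<partial>gauss_seq)
      \<le> ennreal (a * (b / x\<^sup>2) powr (1/16))" and nn: "0 \<le> a" "0 \<le> b"
    for d t l p a b
  proof -
    have "(\<integral>\<^sup>+g. ennreal (fst (alg_state \<phi> (d, t) g (Suc l)) powr p) \<partial>gauss_seq)
      = (\<integral>\<^sup>+x. \<integral>\<^sup>+g. ennreal (fst (alg_state \<phi> (alg_step \<phi> (d, t) x) g l) powr p) \<partial>gauss_seq \<partial>std_gauss)"
      by (subst gauss_seq.nn_integral_iter) (simp_all only: alg_state_case_nat, measurable)
    also have "\<dots> \<le> (\<integral>\<^sup>+x. ennreal (a * b powr (1/16)) * ennreal (\<bar>x\<bar> powr (-(1/8))) \<partial>std_gauss)"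
    proof (intro nn_integral_mono order_trans[OF bd])
      fix x :: real
      have "(x\<^sup>2) powr (1/16) = \<bar>x\<bar> powr (1/8)"
        using power2_powr_half[of "\<bar>x\<bar>" "1/8"] by simp
      then have "(b / x\<^sup>2) powr (1/16) = b powr (1/16) * \<bar>x\<bar> powr (-(1/8))"
        using nn by (simp add: powr_divide powr_minus field_simps)
      then show "ennreal (a * (b / x\<^sup>2) powr (1/16)) \<le> ennreal (a * b powr (1/16)) * ennreal (\<bar>x\<bar> powr (-(1/8)))"
        using nn by (simp flip: ennreal_mult')
    qed
    also have "\<dots> = ennreal (a * b powr (1/16)) * (\<integral>\<^sup>+x. ennreal (\<bar>x\<bar> powr (-(1/8))) \<partial>std_gauss)"
      by (simp add: nn_integral_cmult)
    also have "\<dots> \<le> ennreal (a * b powr (1/16)) * ennreal m"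
      by (intro mult_left_mono moment) auto
    also have "\<dots> = ennreal (a * m * b powr (1/16))"
      using nn m0 by (simp add: ac_simps flip: ennreal_mult)
    finally show ?thesis .
  qed
  {
    case 0
    have "(\<integral>\<^sup>+g. ennreal (fst (alg_state \<phi> (alg_step \<phi> (d, t) x) g k) powr (1/16 / 2^k)) \<partial>gauss_seq)
        \<le> ennreal (exp (1/4) * ((d\<^sup>2 / sqrt (1 + t)) / x\<^sup>2) powr (1/16))" for x
    proof -
      obtain d' t' where st: "alg_step \<phi> (d, t) x = (d', t')" by (cases "alg_step \<phi> (d, t) x")
      have nn: "0 \<le> d'" "0 \<le> t'"
        using alg_step_nonneg[of "(d, t)" x] 0 st by auto
      have "d' \<le> (d\<^sup>2 / sqrt (1 + t)) / (2 * x\<^sup>2)"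
        using alg_step_gap_quadratic[OF _ _ st] 0 by auto
      also have "\<dots> = (d\<^sup>2 / sqrt (1 + t)) / x\<^sup>2 / 2" by simp
      also have "\<dots> \<le> (d\<^sup>2 / sqrt (1 + t)) / x\<^sup>2"
      proof -
        have half: "y / 2 \<le> y" if "0 \<le> y" for y :: real using that by simp
        show ?thesis by (rule half) (use 0 in simp)
      qed
      finally have "exp (1/4) * d' powr (1/16) \<le> exp (1/4) * ((d\<^sup>2 / sqrt (1 + t)) / x\<^sup>2) powr (1/16)"
        using nn by (intro mult_left_mono powr_mono2) auto
      then show ?thesis
        unfolding st using gap_moment_doubling[of "1/16" d' t' k] nn
        by (auto intro: order_trans ennreal_leI)
    qed
    then have "(\<integral>\<^sup>+g. ennreal (fst (alg_state \<phi> (d, t) g (Suc k)) powr (1/16 / 2^k)) \<partial>gauss_seq)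
      \<le> ennreal (exp (1/4) * m * (d\<^sup>2 / sqrt (1 + t)) powr (1/16))"
      by (rule front) (use 0 in auto)
    then show ?case by simp
  next
    case (Suc n)
    define a where "a = exp (1/4) * m * ((5/29) powr (1/16) * m) ^ n"
    have a0: "0 \<le> a" using m0 by (simp add: a_def)
    have "(\<integral>\<^sup>+g. ennreal (fst (alg_state \<phi> (alg_step \<phi> (d, t) x) g (Suc n + k)) powr (1/16 / 2^k)) \<partial>gauss_seq)
        \<le> ennreal (a * (5/29 * (d\<^sup>2 / sqrt (1 + t)) / x\<^sup>2) powr (1/16))" for x
    proof -
      obtain d' t' where st: "alg_step \<phi> (d, t) x = (d', t')" by (cases "alg_step \<phi> (d, t) x")
      have nn: "0 \<le> d'" "0 \<le> t'"
        using alg_step_nonneg[of "(d, t)" x] Suc.prems st by auto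
      have "d'\<^sup>2 / sqrt (1 + t') \<le> 5/29 * (d\<^sup>2 / sqrt (1 + t)) / x\<^sup>2"
        using alg_step_gap_contract[OF _ _ st] Suc.prems by auto
      then have "a * (d'\<^sup>2 / sqrt (1 + t')) powr (1/16) \<le> a * (5/29 * (d\<^sup>2 / sqrt (1 + t)) / x\<^sup>2) powr (1/16)"
        using nn a0 by (intro mult_left_mono powr_mono2) auto
      then show ?thesis
        unfolding st using Suc.IH[OF nn, folded a_def]
        by (auto intro: order_trans ennreal_leI)
    qed
    then have "(\<integral>\<^sup>+g. ennreal (fst (alg_state \<phi> (d, t) g (Suc (Suc n + k))) powr (1/16 / 2^k)) \<partial>gauss_seq)
      \<le> ennreal (a * m * (5/29 * (d\<^sup>2 / sqrt (1 + t))) powr (1/16))"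
      by (rule front) (use Suc.prems a0 in auto)
    also have "a * m * (5/29 * (d\<^sup>2 / sqrt (1 + t))) powr (1/16)
      = exp (1/4) * m * ((5/29) powr (1/16) * m) ^ Suc n * (d\<^sup>2 / sqrt (1 + t)) powr (1/16)"
      using Suc.prems unfolding a_def by (subst powr_mult) auto
    finally show ?case by (simp only: add_Suc)
  }
qed

text \<open>Markov's inequality for the moment of order \<open>1/16 / 2^k\<close>. The power of
  \<epsilon> that it introduces is at most \<open>exp 1\<close> under the condition on
  \<open>k\<close>, so the constants depend on neither \<epsilon> nor \<open>k\<close>.\<close>

lemma gap_tail:
  obtains C \<rho> where "0 < C" "0 < \<rho>" "\<rho> < 1"
    "\<And>\<epsilon> n k. 0 < \<epsilon> \<Longrightarrow> \<epsilon> < 1 \<Longrightarrow> \<bar>ln \<epsilon>\<bar> \<le> 2^k \<Longrightarrow>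
       measure gauss_seq {g \<in> space gauss_seq. \<epsilon> < fst (alg_state \<phi> (\<phi> 0, 0) g (Suc n + k))} \<le> C * \<rho> ^ n"
proof -
  define m where "m = (pi/2) powr (-(1/8)/2) / (1 - 1/8 :: real)"
  define C where "C = exp 1 * (exp (1/4) * m * ((\<phi> 0)\<^sup>2) powr (1/16))"
  define \<rho> where "\<rho> = (5/29) powr (1/16) * m"
  have m0: "m > 0" by (simp add: m_def)
  have "measure gauss_seq {g \<in> space gauss_seq. \<epsilon> < fst (alg_state \<phi> (\<phi> 0, 0) g (Suc n + k))} \<le> C * \<rho> ^ n"
    if e: "0 < \<epsilon>" "\<epsilon> < 1" "\<bar>ln \<epsilon>\<bar> \<le> 2^k" for \<epsilon> :: real and n k
  proof -
    define q :: real where "q = 1/16 / 2^k"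
    have q: "q > 0" by (simp add: q_def)
    let ?D = "\<lambda>g. fst (alg_state \<phi> (\<phi> 0, 0) g (Suc n + k))"
    define I where "I = (\<integral>\<^sup>+g. ennreal (?D g powr q) \<partial>gauss_seq)"
    have I: "I \<le> ennreal (exp (1/4) * m * \<rho> ^ n * ((\<phi> 0)\<^sup>2) powr (1/16))"
      unfolding I_def q_def \<rho>_def m_def using gap_moment[of "\<phi> 0" 0 n k] pos by simp
    have ee: "\<epsilon> powr (-q) \<le> exp 1"
    proof -
      have "-q * ln \<epsilon> = q * \<bar>ln \<epsilon>\<bar>" using e by simp
      also have "\<dots> \<le> q * 2^k" using e q by (intro mult_left_mono) auto
      also have "\<dots> \<le> 1" by (simp add: q_def)
      finally show ?thesis using e by (simp add: powr_def)
    qed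
    have "emeasure gauss_seq {g \<in> space gauss_seq. \<epsilon> < ?D g}
        \<le> emeasure gauss_seq {g \<in> space gauss_seq. 1 \<le> ennreal (\<epsilon> powr (-q)) * ennreal (?D g powr q)}"
    proof (rule emeasure_mono)
      show "{g \<in> space gauss_seq. \<epsilon> < ?D g}
        \<subseteq> {g \<in> space gauss_seq. 1 \<le> ennreal (\<epsilon> powr (-q)) * ennreal (?D g powr q)}"
      proof safe
        fix g assume "\<epsilon> < ?D g"
        then have "\<epsilon> powr q \<le> ?D g powr q" using e q by (intro powr_mono2) auto
        then have "1 \<le> \<epsilon> powr (-q) * ?D g powr q"
          using e by (simp add: powr_minus field_simps)
        then show "1 \<le> ennreal (\<epsilon> powr (-q)) * ennreal (?D g powr q)"
          by (simp flip: ennreal_mult')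
      qed
    qed measurable
    also have "\<dots> \<le> ennreal (\<epsilon> powr (-q)) * (\<integral>\<^sup>+g. ennreal (?D g powr q) * indicator (space gauss_seq) g \<partial>gauss_seq)"
      using nn_integral_Markov_inequality[of "\<lambda>g. ennreal (?D g powr q)" "space gauss_seq" gauss_seq "ennreal (\<epsilon> powr (-q))"]
      by simp
    also have "(\<integral>\<^sup>+g. ennreal (?D g powr q) * indicator (space gauss_seq) g \<partial>gauss_seq) = I"
      unfolding I_def by (intro nn_integral_cong) auto
    also have "ennreal (\<epsilon> powr (-q)) * I \<le> ennreal (exp 1) * ennreal (exp (1/4) * m * \<rho> ^ n * ((\<phi> 0)\<^sup>2) powr (1/16))"
      using I ee by (intro mult_mono ennreal_leI) auto
    also have "\<dots> = ennreal (C * \<rho> ^ n)"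
      unfolding C_def by (simp add: ac_simps flip: ennreal_mult')
    finally show ?thesis
      using m0 by (subst (asm) gauss_seq.P.emeasure_eq_measure) (auto simp: C_def \<rho>_def)
  qed
  moreover have "0 < C" using m0 pos by (simp add: C_def)
  moreover have "0 < \<rho>" using m0 by (simp add: \<rho>_def)
  moreover have "\<rho> < 1" unfolding \<rho>_def m_def by (rule contraction_rate_less_1)
  ultimately show ?thesis using that by blast
qed

end

section \<open>Number of iterations\<close>

lemma less_alg_iterations_iff:
  "enat m < alg_iterations \<phi> \<epsilon> g \<longleftrightarrow>
    (\<forall>n\<in>{1..m}. \<epsilon> < \<phi> (alg_time \<phi> g n) - \<phi> (alg_time \<phi> g (n - 1)))"
proof -
  let ?A = "{n. n \<ge> 1 \<and> \<phi> (alg_time \<phi> g n) - \<phi> (alg_time \<phi> g (n - 1)) \<le> \<epsilon>}"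
  have "\<not> enat m < Inf (enat ` ?A) \<longleftrightarrow> (\<exists>n\<in>?A. n \<le> m)"
  proof
    assume "\<exists>n\<in>?A. n \<le> m"
    then obtain n where "n \<in> ?A" "n \<le> m" by auto
    then have "Inf (enat ` ?A) \<le> enat m"
      by (intro Inf_lower2[of "enat n"]) auto
    then show "\<not> enat m < Inf (enat ` ?A)" by simp
  next
    assume less: "\<not> enat m < Inf (enat ` ?A)"
    then have "Inf (enat ` ?A) < enat (Suc m)"
      by (metis enat_ord_simps(2) le_less_trans lessI not_le)
    then obtain n where "n \<in> ?A" "enat n < enat (Suc m)"
      unfolding Inf_less_iff by auto
    then show "\<exists>n\<in>?A. n \<le> m" by auto
  qed
  moreover have "(\<exists>n\<in>?A. n \<le> m) \<longleftrightarrow>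
      \<not> (\<forall>n\<in>{1..m}. \<epsilon> < \<phi> (alg_time \<phi> g n) - \<phi> (alg_time \<phi> g (n - 1)))"
    by (auto simp: not_less)
  ultimately show ?thesis unfolding alg_iterations_def by blast
qed

lemma less_alg_iterations_iff_state:
  "enat m < alg_iterations \<phi> \<epsilon> g \<longleftrightarrow> (\<forall>n\<in>{1..m}. \<epsilon> < fst (alg_state \<phi> (\<phi> 0, 0) g n))"
  unfolding less_alg_iterations_iff alg_state_eq_alg_time by auto

context slow_curve
begin

lemma measurable_alg_iterations[measurable]:
  "alg_iterations \<phi> \<epsilon> \<in> gauss_seq \<rightarrow>\<^sub>M count_space UNIV"
proof -
  have less: "{g \<in> space gauss_seq. enat m < alg_iterations \<phi> \<epsilon> g} \<in> sets gauss_seq" for m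
    unfolding less_alg_iterations_iff_state by measurable
  have eq: "{g \<in> space gauss_seq. alg_iterations \<phi> \<epsilon> g = i} \<in> sets gauss_seq" for i
  proof (cases i)
    case (enat n)
    have "{g \<in> space gauss_seq. alg_iterations \<phi> \<epsilon> g = i} =
        (if n = 0 then space gauss_seq else {g \<in> space gauss_seq. enat (n - 1) < alg_iterations \<phi> \<epsilon> g})
          - {g \<in> space gauss_seq. enat n < alg_iterations \<phi> \<epsilon> g}"
    proof -
      have "y = enat n \<longleftrightarrow> (n = 0 \<or> enat (n - 1) < y) \<and> \<not> enat n < y" for y
        by (cases y; cases n) auto
      then show ?thesis unfolding enat by auto
    qed
    then show ?thesis using less by auto
  next
    case infinity
    have "{g \<in> space gauss_seq. alg_iterations \<phi> \<epsilon> g = i} =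
        (\<Inter>m. {g \<in> space gauss_seq. enat m < alg_iterations \<phi> \<epsilon> g})"
    proof -
      have "y = \<infinity> \<longleftrightarrow> (\<forall>m. enat m < y)" for y
        by (cases y) auto
      then show ?thesis unfolding infinity by auto
    qed
    then show ?thesis using less by auto
  qed
  have "{g \<in> space gauss_seq. alg_iterations \<phi> \<epsilon> g = i} = alg_iterations \<phi> \<epsilon> -` {i} \<inter> space gauss_seq" for i
    by auto
  then show ?thesis
    using eq by (subst measurable_count_space_eq2_countable) auto
qed

text \<open>The mean is the sum of the tails: the squaring steps contribute at most their number,
  the contracting steps a geometric series.\<close>

lemma expected_iterations:
  obtains C where "C > 0"
    "\<And>\<epsilon>. 0 < \<epsilon> \<Longrightarrow> \<epsilon> < exp (-1) \<Longrightarrow>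
      (\<integral>\<^sup>+g. ennreal_of_enat (alg_iterations \<phi> \<epsilon> g) \<partial>gauss_seq) \<le> ennreal (C * sqrt \<bar>ln \<epsilon>\<bar>)"
proof -
  obtain C \<rho> where C: "0 < C" and \<rho>: "0 < \<rho>" "\<rho> < 1" and tail:
    "\<And>\<epsilon> n k. 0 < \<epsilon> \<Longrightarrow> \<epsilon> < 1 \<Longrightarrow> \<bar>ln \<epsilon>\<bar> \<le> 2^k \<Longrightarrow>
       measure gauss_seq {g \<in> space gauss_seq. \<epsilon> < fst (alg_state \<phi> (\<phi> 0, 0) g (Suc n + k))} \<le> C * \<rho> ^ n"
    by (rule gap_tail) blast
  have "(\<integral>\<^sup>+g. ennreal_of_enat (alg_iterations \<phi> \<epsilon> g) \<partial>gauss_seq) \<le> ennreal ((5 + C / (1 - \<rho>)) * sqrt \<bar>ln \<epsilon>\<bar>)"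
    if e: "0 < \<epsilon>" "\<epsilon> < exp (-1)" for \<epsilon> :: real
  proof -
    define L where "L = \<bar>ln \<epsilon>\<bar>"
    have e1: "\<epsilon> < 1" using e by (simp add: order.strict_trans)
    have "ln \<epsilon> < -1" using e by (metis ln_exp ln_less_cancel_iff exp_gt_zero)
    then have L: "L \<ge> 1" by (simp add: L_def)
    \<comment> \<open>Any \<open>k\<close> with \<open>L \<le> 2 ^ k\<close> would do, and
      \<open>k\<close> of order \<open>sqrt L\<close> is what the bound allows:
      \<open>L \<le> j\<^sup>2 \<le> (2 ^ j)\<^sup>2 = 2 ^ k\<close>.\<close>
    define j where "j = nat \<lceil>sqrt L\<rceil>"
    have j: "sqrt L \<le> real j" "real j \<le> sqrt L + 1"
      using L unfolding j_def by (auto simp: real_nat_ceiling_ge) 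
    define k where "k = 2 * j"
    have "L = (sqrt L)\<^sup>2" using L by simp
    also have "\<dots> \<le> (real j)\<^sup>2" using j L by (intro power_mono) auto
    also have "\<dots> \<le> (2 ^ j)\<^sup>2"
      using of_nat_less_two_power[of j, where 'a = real] by (intro power_mono) auto
    also have "\<dots> = 2 ^ k" by (simp add: k_def power_mult mult.commute)
    finally have Lk: "\<bar>ln \<epsilon>\<bar> \<le> 2 ^ k" by (simp add: L_def)
    \<comment> \<open>\<open>gap_tail\<close> speaks of index \<open>Suc n + k\<close>, so the first
      \<open>k + 1\<close> tails get the trivial bound.\<close>
    define b where "b t = (if t < Suc k then 1 else C * \<rho> ^ (t - Suc k))" for t
    have b0: "0 \<le> b t" for t using C \<rho> by (simp add: b_def)
    have "(\<lambda>i. b (i + Suc k)) sums (C * (1 / (1 - \<rho>)))"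
      unfolding b_def using \<rho> sums_mult[OF geometric_sums[of \<rho>], of C] by simp
    then have "b sums (C * (1 / (1 - \<rho>)) + sum b {..<Suc k})"
      by (subst (asm) sums_iff_shift)
    moreover have "sum b {..<Suc k} = real (Suc k)"
      by (simp add: b_def)
    ultimately have bs: "b sums (C / (1 - \<rho>) + real (Suc k))" by simp
    have "emeasure gauss_seq {g \<in> space gauss_seq. enat t < alg_iterations \<phi> \<epsilon> g} \<le> ennreal (b t)" for t
    proof (cases "t < Suc k")
      case True
      then show ?thesis by (simp add: b_def gauss_seq.P.emeasure_le_1)
    next
      case False
      define n where "n = t - Suc k"
      have t: "t = Suc n + k" using False by (simp add: n_def)
      have "measure gauss_seq {g \<in> space gauss_seq. enat t < alg_iterations \<phi> \<epsilon> g}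
         \<le> measure gauss_seq {g \<in> space gauss_seq. \<epsilon> < fst (alg_state \<phi> (\<phi> 0, 0) g (Suc n + k))}"
        unfolding less_alg_iterations_iff_state t
        by (intro gauss_seq.P.finite_measure_mono)
          (auto simp del: alg_state.simps dest!: bspec[of _ _ "Suc n + k"], measurable)
      also have "\<dots> \<le> C * \<rho> ^ n" by (rule tail[OF e(1) e1 Lk])
      finally show ?thesis
        using False by (simp add: b_def n_def gauss_seq.P.emeasure_eq_measure ennreal_leI)
    qed
    then have "(\<integral>\<^sup>+g. ennreal_of_enat (alg_iterations \<phi> \<epsilon> g) \<partial>gauss_seq) \<le> (\<Sum>t. ennreal (b t))"
      by (subst nn_integral_enat_function[OF measurable_alg_iterations]) (auto intro!: suminf_le)
    also have "\<dots> = ennreal (C / (1 - \<rho>) + real (Suc k))"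
      by (rule suminf_ennreal_eq[OF b0 bs])
    also have "\<dots> \<le> ennreal ((5 + C / (1 - \<rho>)) * sqrt L)"
    proof (rule ennreal_leI)
      \<comment> \<open>This is why \<epsilon> stays below \<open>exp (-1)\<close>: additive
        constants are absorbed into multiples of \<open>sqrt L\<close>, as in
        \<open>1 + 2 * j \<le> 3 + 2 * sqrt L \<le> 5 * sqrt L\<close>.\<close>
      have sL: "1 \<le> sqrt L" using L by simp
      have "real (Suc k) = 1 + 2 * real j" by (simp add: k_def)
      then have "real (Suc k) \<le> 5 * sqrt L" using j sL by linarith
      moreover have "C / (1 - \<rho>) * 1 \<le> C / (1 - \<rho>) * sqrt L"
        using sL C \<rho> by (intro mult_left_mono) auto
      ultimately show "C / (1 - \<rho>) + real (Suc k) \<le> (5 + C / (1 - \<rho>)) * sqrt L"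
        by (simp add: algebra_simps)
    qed
    finally show ?thesis unfolding L_def .
  qed
  moreover have "5 + C / (1 - \<rho>) > 0" using C \<rho> by (simp add: add_pos_pos)
  ultimately show ?thesis using that by blast
qed

text \<open>A finite mean gives this for small tolerances, and a larger tolerance only makes the
  algorithm stop earlier.\<close>

lemma alg_iterations_finite:
  assumes "0 < \<epsilon>"
  shows "AE g in gauss_seq. alg_iterations \<phi> \<epsilon> g < \<infinity>"
proof -
  obtain C where bd: "\<And>\<epsilon>. 0 < \<epsilon> \<Longrightarrow> \<epsilon> < exp (-1) \<Longrightarrow>
      (\<integral>\<^sup>+g. ennreal_of_enat (alg_iterations \<phi> \<epsilon> g) \<partial>gauss_seq) \<le> ennreal (C * sqrt \<bar>ln \<epsilon>\<bar>)"
    using expected_iterations by metis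
  define \<delta> where "\<delta> = min \<epsilon> (exp (-1) / 2)"
  have \<delta>: "0 < \<delta>" "\<delta> < exp (-1)" "\<delta> \<le> \<epsilon>"
    using assms by (auto simp: \<delta>_def min_less_iff_disj)
  have "(\<integral>\<^sup>+g. ennreal_of_enat (alg_iterations \<phi> \<delta> g) \<partial>gauss_seq) \<noteq> \<infinity>"
    using bd[OF \<delta>(1,2)] by (metis ennreal_less_top infinity_ennreal_def leD)
  moreover have "(\<lambda>g. ennreal_of_enat (alg_iterations \<phi> \<delta> g)) \<in> borel_measurable gauss_seq"
    by measurable
  ultimately have "AE g in gauss_seq. ennreal_of_enat (alg_iterations \<phi> \<delta> g) \<noteq> \<infinity>"
    by (intro nn_integral_noteq_infinite)
  then show ?thesis
  proof (eventually_elim)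
    case (elim g)
    then obtain n where "alg_iterations \<phi> \<delta> g = enat n"
      by (cases "alg_iterations \<phi> \<delta> g") auto
    then have "\<not> enat n < alg_iterations \<phi> \<delta> g" by simp
    then have "\<not> enat n < alg_iterations \<phi> \<epsilon> g"
      unfolding less_alg_iterations_iff_state using \<delta>(3) by (auto intro: order.strict_trans1)
    then show ?case by (cases "alg_iterations \<phi> \<epsilon> g") auto
  qed
qed

end

section \<open>Brownian motion on a grid\<close>

text \<open>Fatou's lemma for sets: \<open>A\<close> is contained in the lower limit of the
  \<open>B i\<close>. It carries bounds on grids over to continuous time, where the mesh that
  suffices depends on the path.\<close>

lemma emeasure_le_if_eventually:
  assumes [measurable]: "\<And>i::nat. B i \<in> sets M"
    and A: "\<And>\<omega>. \<omega> \<in> A \<Longrightarrow> \<forall>\<^sub>F i in sequentially. \<omega> \<in> B i"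
    and c: "\<And>i. emeasure M (B i) \<le> c"
  shows "emeasure M A \<le> c"
proof -
  define C where "C n = (\<Inter>i\<in>{n..}. B i)" for n
  have C[measurable]: "C n \<in> sets M" for n unfolding C_def by (intro sets.countable_INT') auto
  have inc: "incseq C" unfolding C_def incseq_def by fastforce
  have "A \<subseteq> (\<Union>n. C n)"
    using A unfolding C_def eventually_sequentially by fastforce
  then have "emeasure M A \<le> emeasure M (\<Union>n. C n)" by (intro emeasure_mono) auto
  also have "\<dots> = (SUP n. emeasure M (C n))"
    using inc by (intro SUP_emeasure_incseq[symmetric]) auto
  also have "\<dots> \<le> c"
  proof (rule SUP_least)
    fix n
    have "C n \<subseteq> B n" unfolding C_def by auto
    then show "emeasure M (C n) \<le> c" using c[of n] emeasure_mono[of "C n" "B n" M] by (auto intro: order_trans)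
  qed
  finally show ?thesis .
qed

lemma emeasure_std_gauss_uminus:
  "emeasure std_gauss {x. x < - a} = emeasure std_gauss {x. a < x}"
proof -
  have "emeasure std_gauss {x. a < x} = (\<integral>\<^sup>+x. ennreal (std_normal_density x) * indicator {x. a < x} x \<partial>lborel)"
    by (subst emeasure_density) auto
  also have "\<dots> = (\<integral>\<^sup>+x. ennreal (std_normal_density (- x)) * indicator {x. a < x} (- x) \<partial>lborel)"
    by (subst nn_integral_real_affine[of _ "-1" 0]) auto
  also have "\<dots> = (\<integral>\<^sup>+x. ennreal (std_normal_density x) * indicator {x. x < - a} x \<partial>lborel)"
    by (intro nn_integral_cong) (auto simp: std_normal_density_def split: split_indicator)
  also have "\<dots> = emeasure std_gauss {x. x < - a}"
    by (subst emeasure_density) auto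
  finally show ?thesis by simp
qed

lemma emeasure_std_gauss_singleton: "emeasure std_gauss {x} = 0"
proof -
  have "AE y in lborel. y \<noteq> x" by (rule AE_lborel_singleton)
  then have "AE y in lborel. ennreal (std_normal_density y) * indicator {x} y = 0"
    by eventually_elim auto
  then have "(\<integral>\<^sup>+y. ennreal (std_normal_density y) * indicator {x} y \<partial>lborel) = 0"
    by (subst nn_integral_0_iff_AE) auto
  then show ?thesis by (subst emeasure_density) auto
qed

lemma emeasure_std_gauss_pos: "emeasure std_gauss {x. 0 < x} = 1/2"
proof -
  have "1 = emeasure std_gauss ({x. x < 0} \<union> {x. 0 < x} \<union> {0})"
  proof -
    have "{x. x < 0} \<union> {x. 0 < x} \<union> {0} = (UNIV :: real set)" by auto
    then show ?thesis using std_gauss.emeasure_space_1 by simp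
  qed
  also have "\<dots> = emeasure std_gauss {x. x < 0} + emeasure std_gauss {x. 0 < x}"
  proof -
    have "emeasure std_gauss ({x. x < 0} \<union> {x. 0 < x} \<union> {0})
      = emeasure std_gauss ({x. x < 0} \<union> {x. 0 < x}) + emeasure std_gauss {0}"
      by (rule plus_emeasure[symmetric]) auto
    also have "emeasure std_gauss ({x. x < 0} \<union> {x. 0 < x}) = emeasure std_gauss {x. x < 0} + emeasure std_gauss {x. 0 < x}"
      by (rule plus_emeasure[symmetric]) auto
    finally show ?thesis by (simp add: emeasure_std_gauss_singleton)
  qed
  also have "\<dots> = 2 * emeasure std_gauss {x. 0 < x}"
    using emeasure_std_gauss_uminus[of 0] by (simp add: mult_2)
  finally have "ennreal 1 = ennreal (2 * measure std_gauss {x. 0 < x})"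
    unfolding std_gauss.emeasure_eq_measure by (simp add: ennreal_mult')
  then have "measure std_gauss {x. 0 < x} = 1/2"
    by (subst (asm) ennreal_inj) auto
  then have "emeasure std_gauss {x. 0 < x} = ennreal (1/2)"
    by (simp only: std_gauss.emeasure_eq_measure)
  then show ?thesis
    by (metis divide_ennreal ennreal_1 ennreal_numeral zero_le_one zero_less_numeral zero_le_numeral)
qed

text \<open>Symmetry doubles one tail. By the division convention \<open>x = 0\<close> lies in the
  left set too, which adds a null set.\<close>

lemma emeasure_std_gauss_scaled_inverse_square:
  assumes "0 < a" "0 < r"
  shows "emeasure std_gauss {x. a\<^sup>2 / x\<^sup>2 < r} = 2 * emeasure std_gauss {x. a / sqrt r < x}"
proof -
  have iff: "a\<^sup>2 / x\<^sup>2 < r \<longleftrightarrow> x = 0 \<or> a / sqrt r < \<bar>x\<bar>" for x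
  proof (cases "x = 0")
    case False
    have "a\<^sup>2 / x\<^sup>2 < r \<longleftrightarrow> a\<^sup>2 / r < x\<^sup>2" using False assms by (simp add: field_simps)
    also have "a\<^sup>2 / r = (a / sqrt r)\<^sup>2" using assms by (simp add: power_divide)
    also have "(a / sqrt r)\<^sup>2 < x\<^sup>2 \<longleftrightarrow> a / sqrt r < \<bar>x\<bar>"
      using assms abs_le_square_iff[of x "a / sqrt r"] by (simp add: not_le[symmetric])
    finally show ?thesis using False by simp
  qed (use assms in auto)
  define c where "c = a / sqrt r"
  have p: "c > 0" using assms by (simp add: c_def)
  have "{x. a\<^sup>2 / x\<^sup>2 < r} = {x. x < - c} \<union> {x. c < x} \<union> {0}"
    using iff unfolding c_def by (auto simp: abs_if)
  also have "emeasure std_gauss \<dots> = emeasure std_gauss ({x. x < - c} \<union> {x. c < x}) + emeasure std_gauss {0}"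
    using p by (intro plus_emeasure[symmetric]) auto
  also have "emeasure std_gauss ({x. x < - c} \<union> {x. c < x})
     = emeasure std_gauss {x. x < - c} + emeasure std_gauss {x. c < x}"
    using p by (intro plus_emeasure[symmetric]) auto
  finally show ?thesis
    unfolding emeasure_std_gauss_singleton emeasure_std_gauss_uminus c_def[symmetric] mult_2 by simp
qed

context standard_brownian_motion
begin

lemma measurable_coordinate[measurable]: "t \<ge> 0 \<Longrightarrow> B t \<in> borel_measurable M"
  by (rule measurable)

lemma path_tendsto:
  assumes "\<omega> \<in> space M" "\<And>n. 0 \<le> u n" "u \<longlonglongrightarrow> v" "0 \<le> v"
  shows "(\<lambda>n. B (u n) \<omega>) \<longlonglongrightarrow> B v \<omega>"
  using continuous_on_tendsto_compose[OF continuous_paths[OF assms(1)] assms(3)] assms by auto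

lemma emeasure_B_greater:
  assumes "0 < t"
  shows "emeasure M {\<omega> \<in> space M. B t \<omega> > a} = emeasure std_gauss {x. a / sqrt t < x}"
proof -
  have "distributed M lborel (\<lambda>\<omega>. B t \<omega> - B 0 \<omega>) (normal_density 0 (sqrt t))"
    using gaussian_increments[of 0 t] assms by simp
  then have D: "distributed M lborel (\<lambda>\<omega>. (B t \<omega> - B 0 \<omega> - 0) / sqrt t) std_normal_density"
    using assms by (subst (asm) normal_standard_normal_convert) auto
  have [measurable]: "B t \<in> borel_measurable M" "B 0 \<in> borel_measurable M" using assms by auto
  have "emeasure std_gauss {x. a / sqrt t < x} = emeasure M ((\<lambda>\<omega>. (B t \<omega> - B 0 \<omega> - 0) / sqrt t) -` {x. a / sqrt t < x} \<inter> space M)"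
    unfolding distributed_distr_eq_density[OF D, symmetric] by (subst emeasure_distr) auto
  also have "(\<lambda>\<omega>. (B t \<omega> - B 0 \<omega> - 0) / sqrt t) -` {x. a / sqrt t < x} \<inter> space M = {\<omega> \<in> space M. B t \<omega> > a}"
    using assms by (auto simp: start divide_less_cancel)
  finally show ?thesis by simp
qed

section \<open>Random walk on a grid and its restart\<close>

abbreviation normal_seq :: "real \<Rightarrow> (nat \<Rightarrow> real) measure" where
  "normal_seq h \<equiv> \<Pi>\<^sub>M i\<in>UNIV. density lborel (\<lambda>x. ennreal (normal_density 0 (sqrt h) x))"

lemma distr_grid_increments:
  assumes h: "0 < h"
  shows "(\<lambda>\<omega> j. B (real (Suc j) * h) \<omega> - B (real j * h) \<omega>) \<in> M \<rightarrow>\<^sub>M normal_seq h"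
    and "distr M (normal_seq h) (\<lambda>\<omega> j. B (real (Suc j) * h) \<omega> - B (real j * h) \<omega>) = normal_seq h"
proof -
  let ?N = "density lborel (\<lambda>x. ennreal (normal_density 0 (sqrt h) x))"
  let ?X = "\<lambda>j \<omega>. B (real (Suc j) * h) \<omega> - B (real j * h) \<omega>"
  have [measurable]: "B (real j * h) \<in> borel_measurable M" for j using h by simp
  have X[measurable]: "?X j \<in> borel_measurable M" for j 
    using h by (intro borel_measurable_diff measurable) auto
  have sets: "sets (normal_seq h) = sets (\<Pi>\<^sub>M i\<in>(UNIV::nat set). (borel :: real measure))"
    by (intro sets_PiM_cong) auto
  have "(\<lambda>\<omega> j. ?X j \<omega>) \<in> M \<rightarrow>\<^sub>M (\<Pi>\<^sub>M i\<in>UNIV. borel)"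
    by (rule measurable_PiM_single') (use X in auto)
  then show meas: "(\<lambda>\<omega> j. ?X j \<omega>) \<in> M \<rightarrow>\<^sub>M normal_seq h"
    by (subst measurable_cong_sets[OF refl sets])
  have "indep_vars (\<lambda>_. borel) ?X UNIV"
    using h by (intro independent_increments) (auto simp: incseq_def intro!: mult_right_mono)
  then have "distr M (\<Pi>\<^sub>M i\<in>UNIV. borel) (\<lambda>\<omega>. \<lambda>i\<in>UNIV. ?X i \<omega>) = (\<Pi>\<^sub>M i\<in>UNIV. distr M borel (?X i))"
    by (subst (asm) indep_vars_iff_distr_eq_PiM) (use X in auto)
  moreover have "distr M borel (?X i) = ?N" for i
  proof -
    have "distributed M lborel (?X i) (normal_density 0 (sqrt (real (Suc i) * h - real i * h)))"
      using h by (intro gaussian_increments) (auto intro!: mult_strict_right_mono)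
    then have "distr M lborel (?X i) = ?N"
      by (subst distributed_distr_eq_density) (auto simp: algebra_simps)
    moreover have "distr M borel (?X i) = distr M lborel (?X i)"
      by (rule distr_cong) auto
    ultimately show ?thesis by (simp only:)
  qed
  moreover have "distr M (normal_seq h) (\<lambda>\<omega> j. ?X j \<omega>) = distr M (\<Pi>\<^sub>M i\<in>UNIV. borel) (\<lambda>\<omega>. \<lambda>i\<in>UNIV. ?X i \<omega>)"
    by (rule distr_cong[OF refl sets]) (simp add: restrict_def)
  ultimately show "distr M (normal_seq h) (\<lambda>\<omega> j. ?X j \<omega>) = normal_seq h"
    by (simp only:)
qed

text \<open>The Markov property at a fixed index, read off the increments: joining the first
  \<open>n\<close> coordinates of one i.i.d. sequence to an independent copy gives the same law. The
  event \<open>a\<close> sees only the first part, since the walk up to \<open>n\<close> is a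
  function of \<open>n\<close> increments, and \<open>e\<close> sees only the second.\<close>

lemma grid_restart:
  assumes h: "0 < h"
    and a[measurable]: "Measurable.pred (\<Pi>\<^sub>M i\<in>UNIV. borel) a"
    and e[measurable]: "Measurable.pred (\<Pi>\<^sub>M i\<in>UNIV. borel) e"
    and past: "\<And>v w. (\<And>i. i \<le> n \<Longrightarrow> v i = w i) \<Longrightarrow> a v \<longleftrightarrow> a w"
  shows "emeasure M {\<omega>\<in>space M. a (\<lambda>k. B (real k * h) \<omega>) \<and> e (\<lambda>k. B (real (n + k) * h) \<omega> - B (real n * h) \<omega>)}
    = emeasure M {\<omega>\<in>space M. a (\<lambda>k. B (real k * h) \<omega>)} * emeasure M {\<omega>\<in>space M. e (\<lambda>k. B (real k * h) \<omega>)}"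
proof -
  let ?N = "density lborel (\<lambda>x. ennreal (normal_density 0 (sqrt h) x))"
  interpret N: prob_space ?N by (rule prob_space_normal_density) (use h in simp)
  interpret S: sequence_space ?N by unfold_locales
  let ?S = "normal_seq h"
  let ?X = "\<lambda>\<omega> j. B (real (Suc j) * h) \<omega> - B (real j * h) \<omega>"
  define ps where "ps x = (\<lambda>k. \<Sum>i<k. x i)" for x :: "nat \<Rightarrow> real"
  have [measurable]: "(\<lambda>x. x i) \<in> ?S \<rightarrow>\<^sub>M borel" for i :: nat
    using measurable_component_singleton[of i UNIV "\<lambda>_. ?N"] by simp
  have [measurable]: "ps \<in> ?S \<rightarrow>\<^sub>M (\<Pi>\<^sub>M i\<in>UNIV. borel)"
    unfolding ps_def by (rule measurable_PiM_single') auto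
  have ps_X: "ps (?X \<omega>) = (\<lambda>k. B (real k * h) \<omega>)" if "\<omega> \<in> space M" for \<omega>
  proof
    fix k show "ps (?X \<omega>) k = B (real k * h) \<omega>"
      by (induction k) (simp_all add: ps_def start[OF that])
  qed
  have transfer: "emeasure M {\<omega>\<in>space M. p (?X \<omega>)} = emeasure ?S {x\<in>space ?S. p x}"
    if [measurable]: "Measurable.pred ?S p" for p
  proof -
    have "emeasure ?S {x\<in>space ?S. p x} = emeasure (distr M ?S ?X) {x\<in>space ?S. p x}"
      using distr_grid_increments(2)[OF h] by simp
    also have "\<dots> = emeasure M (?X -` {x\<in>space ?S. p x} \<inter> space M)"
      by (rule emeasure_distr[OF distr_grid_increments(1)[OF h]]) measurable
    also have "?X -` {x\<in>space ?S. p x} \<inter> space M = {\<omega>\<in>space M. p (?X \<omega>)}"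
      by (auto simp: space_PiM)
    finally show ?thesis by simp
  qed
  have [measurable]: "(\<lambda>x k. x (n + k)) \<in> ?S \<rightarrow>\<^sub>M ?S"
    by (rule measurable_PiM_single') (auto simp: space_PiM)
  have shift: "ps (\<lambda>k. ?X \<omega> (n + k)) = (\<lambda>k. B (real (n + k) * h) \<omega> - B (real n * h) \<omega>)" for \<omega>
  proof
    fix k show "ps (\<lambda>k. ?X \<omega> (n + k)) k = B (real (n + k) * h) \<omega> - B (real n * h) \<omega>"
      by (induction k) (simp_all add: ps_def)
  qed
  have "emeasure M {\<omega>\<in>space M. a (\<lambda>k. B (real k * h) \<omega>) \<and> e (\<lambda>k. B (real (n + k) * h) \<omega> - B (real n * h) \<omega>)}
     = emeasure M {\<omega>\<in>space M. a (ps (?X \<omega>)) \<and> e (ps (\<lambda>k. ?X \<omega> (n + k)))}"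
    unfolding shift by (intro arg_cong[where f = "emeasure M"] Collect_cong conj_cong refl) (simp add: ps_X del: of_nat_Suc)
  also have "\<dots> = emeasure ?S {x\<in>space ?S. a (ps x) \<and> e (ps (\<lambda>k. x (n + k)))}"
    by (rule transfer) measurable
  also have "\<dots> = emeasure (distr (?S \<Otimes>\<^sub>M ?S) ?S (\<lambda>(v, w). comb_seq n v w)) {x\<in>space ?S. a (ps x) \<and> e (ps (\<lambda>k. x (n + k)))}"
    by (simp only: S.PiM_comb_seq)
  also have "\<dots> = emeasure (?S \<Otimes>\<^sub>M ?S) ({x\<in>space ?S. a (ps x)} \<times> {x\<in>space ?S. e (ps x)})"
  proof (subst emeasure_distr[OF measurable_comb_seq])
    have "a (ps (comb_seq n v w)) = a (ps v)" for v w
      by (rule past) (auto simp: ps_def comb_seq_less intro!: sum.cong)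
    moreover have "(\<lambda>k. comb_seq n v w (n + k)) = w" for v w :: "nat \<Rightarrow> real"
      using comb_seq_add[of n v w] by (simp add: add.commute)
    ultimately show "emeasure (?S \<Otimes>\<^sub>M ?S) ((\<lambda>(v, w). comb_seq n v w) -` {x\<in>space ?S. a (ps x) \<and> e (ps (\<lambda>k. x (n + k)))} \<inter> space (?S \<Otimes>\<^sub>M ?S))
       = emeasure (?S \<Otimes>\<^sub>M ?S) ({x\<in>space ?S. a (ps x)} \<times> {x\<in>space ?S. e (ps x)})"
      by (intro arg_cong[where f = "emeasure (?S \<Otimes>\<^sub>M ?S)"]) (auto simp: space_pair_measure space_PiM)
  qed measurable
  also have "\<dots> = emeasure ?S {x\<in>space ?S. a (ps x)} * emeasure ?S {x\<in>space ?S. e (ps x)}"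
    by (rule S.P.emeasure_pair_measure_Times) measurable
  also have "emeasure ?S {x\<in>space ?S. a (ps x)} = emeasure M {\<omega>\<in>space M. a (ps (?X \<omega>))}"
    by (rule transfer[symmetric]) measurable
  also have "emeasure ?S {x\<in>space ?S. e (ps x)} = emeasure M {\<omega>\<in>space M. e (ps (?X \<omega>))}"
    by (rule transfer[symmetric]) measurable
  also have "{\<omega>\<in>space M. a (ps (?X \<omega>))} = {\<omega>\<in>space M. a (\<lambda>k. B (real k * h) \<omega>)}"
    by (intro Collect_cong conj_cong refl) (simp add: ps_X del: of_nat_Suc)
  also have "{\<omega>\<in>space M. e (ps (?X \<omega>))} = {\<omega>\<in>space M. e (\<lambda>k. B (real k * h) \<omega>)}"
    by (intro Collect_cong conj_cong refl) (simp add: ps_X del: of_nat_Suc)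
  finally show ?thesis .
qed

text \<open>The event that the passage index equals \<open>n\<close> is used rather than the index
  itself: it depends on the walk up to \<open>n\<close>, as \<open>grid_restart\<close> requires,
  and no value for walks that never pass has to be chosen.\<close>

definition first_passage :: "real \<Rightarrow> nat \<Rightarrow> (nat \<Rightarrow> real) \<Rightarrow> bool" where
  "first_passage L n w \<longleftrightarrow> L < w n \<and> (\<forall>i<n. w i \<le> L)"

lemma measurable_first_passage[measurable]:
  "Measurable.pred (\<Pi>\<^sub>M i\<in>UNIV. borel) (first_passage L n)"
  unfolding first_passage_def by measurable

lemma first_passage_unique: "first_passage L n w \<Longrightarrow> first_passage L m w \<Longrightarrow> n = m"
  unfolding first_passage_def by (metis linorder_neqE_nat not_le)

lemma first_passage_exists:
  assumes "L < w k"
  obtains n where "n \<le> k" "first_passage L n w"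
proof -
  define n where "n = (LEAST k. L < w k)"
  have "L < w n" unfolding n_def by (rule LeastI[of "\<lambda>k. L < w k"]) (rule assms)
  moreover have "w i \<le> L" if "i < n" for i
    using not_less_Least that unfolding n_def by (metis not_le)
  moreover have "n \<le> k" unfolding n_def using assms by (rule Least_le)
  ultimately show ?thesis using that by (auto simp: first_passage_def)
qed

lemma measurable_grid[measurable]:
  "0 \<le> h \<Longrightarrow> (\<lambda>\<omega> k. B (real k * h) \<omega>) \<in> M \<rightarrow>\<^sub>M (\<Pi>\<^sub>M i\<in>UNIV. borel)"
  "0 \<le> h \<Longrightarrow> (\<lambda>\<omega> k. B (real (n + k) * h) \<omega> - B (real n * h) \<omega>) \<in> M \<rightarrow>\<^sub>M (\<Pi>\<^sub>M i\<in>UNIV. borel)"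
  by (rule measurable_PiM_single'; auto intro!: borel_measurable_diff measurable)+

text \<open>The strong Markov property on a grid: \<open>grid_restart\<close> for each value of the
  passage index, summed over disjoint events. The event after the restart may depend on the index,
  which lets it refer to the time that remains.\<close>

lemma sum_first_passage:
  assumes h: "0 < h"
    and e[measurable]: "\<And>n. Measurable.pred (\<Pi>\<^sub>M i\<in>UNIV. borel) (e n)"
  shows "(\<Sum>n<K. emeasure M {\<omega>\<in>space M. first_passage L n (\<lambda>k. B (real k * h) \<omega>)}
        * emeasure M {\<omega>\<in>space M. e n (\<lambda>k. B (real k * h) \<omega>)})
    = emeasure M {\<omega>\<in>space M. \<exists>n<K. first_passage L n (\<lambda>k. B (real k * h) \<omega>)
        \<and> e n (\<lambda>k. B (real (n + k) * h) \<omega> - B (real n * h) \<omega>)}"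
proof -
  have h': "0 \<le> h" using h by simp
  note [measurable] = measurable_grid(1)[OF h'] measurable_grid(2)[OF h']
  let ?E = "\<lambda>n. {\<omega>\<in>space M. first_passage L n (\<lambda>k. B (real k * h) \<omega>)
        \<and> e n (\<lambda>k. B (real (n + k) * h) \<omega> - B (real n * h) \<omega>)}"
  have "?E n \<in> sets M" for n by measurable
  then have sets: "range ?E \<subseteq> sets M" by auto
  have "(\<Sum>n<K. emeasure M {\<omega>\<in>space M. first_passage L n (\<lambda>k. B (real k * h) \<omega>)}
        * emeasure M {\<omega>\<in>space M. e n (\<lambda>k. B (real k * h) \<omega>)}) = (\<Sum>n<K. emeasure M (?E n))"
    by (intro sum.cong refl grid_restart[OF h, symmetric]) (auto simp: first_passage_def)
  also have "\<dots> = emeasure M (\<Union>n<K. ?E n)"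
    using sets by (intro sum_emeasure) (auto simp: disjoint_family_on_def dest: first_passage_unique)
  also have "(\<Union>n<K. ?E n) = {\<omega>\<in>space M. \<exists>n<K. first_passage L n (\<lambda>k. B (real k * h) \<omega>)
        \<and> e n (\<lambda>k. B (real (n + k) * h) \<omega> - B (real n * h) \<omega>)}" by auto
  finally show ?thesis .
qed

end

section \<open>Reflection principle\<close>

text \<open>The parameter \<open>c\<close> can make a chosen time a point of every mesh: the
  reflection principle takes its horizon, the restart takes 1. Rounding down keeps upper bounds on
  times.\<close>

definition grid_below :: "real \<Rightarrow> nat \<Rightarrow> real \<Rightarrow> nat" where
  "grid_below c m u = nat \<lfloor>u * 2 ^ m / c\<rfloor>"

lemma grid_below:
  assumes "0 < c" "0 \<le> u"
  shows "real (grid_below c m u) * (c / 2 ^ m) \<le> u" "u - c / 2 ^ m < real (grid_below c m u) * (c / 2 ^ m)"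
proof -
  have nn: "0 \<le> \<lfloor>u * 2 ^ m / c\<rfloor>" using assms by simp
  have "real (grid_below c m u) = of_int \<lfloor>u * 2 ^ m / c\<rfloor>"
    unfolding grid_below_def using nn by simp
  then have *: "real (grid_below c m u) \<le> u * 2 ^ m / c" "u * 2 ^ m / c - 1 < real (grid_below c m u)"
    by linarith+
  show "real (grid_below c m u) * (c / 2 ^ m) \<le> u"
    using *(1) assms by (simp add: field_simps)
  show "u - c / 2 ^ m < real (grid_below c m u) * (c / 2 ^ m)"
  proof -
    have "u - c / 2 ^ m = (u * 2 ^ m / c - 1) * (c / 2 ^ m)"
      using assms by (simp add: left_diff_distrib diff_divide_distrib)
    also have "\<dots> < real (grid_below c m u) * (c / 2 ^ m)"
      using *(2) assms by (intro mult_strict_right_mono) auto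
    finally show ?thesis .
  qed
qed

lemma mesh_tendsto_0: "(\<lambda>m. c / 2 ^ m) \<longlonglongrightarrow> (0::real)"
proof -
  have "(\<lambda>m. c * (1/2) ^ m) \<longlonglongrightarrow> c * 0"
    by (intro tendsto_mult tendsto_const LIMSEQ_power_zero) simp
  then show ?thesis by (simp add: power_divide)
qed

lemma grid_below_tendsto:
  assumes "0 < c" "0 \<le> u"
  shows "(\<lambda>m. real (grid_below c m u) * (c / 2 ^ m)) \<longlonglongrightarrow> u"
proof (rule tendsto_sandwich)
  show "\<forall>\<^sub>F m in sequentially. u - c / 2 ^ m \<le> real (grid_below c m u) * (c / 2 ^ m)"
    using grid_below(2)[OF assms] by (intro always_eventually allI less_imp_le)
  show "\<forall>\<^sub>F m in sequentially. real (grid_below c m u) * (c / 2 ^ m) \<le> u"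
    using grid_below(1)[OF assms] by (intro always_eventually allI)
  show "(\<lambda>m. u - c / 2 ^ m) \<longlonglongrightarrow> u"
    using tendsto_diff[OF tendsto_const mesh_tendsto_0, of u c] by simp
qed simp

lemma two_times_half_ennreal: "2 * (1/2) = (1::ennreal)"
proof -
  have "2 * (1/2) = ennreal 2 * ennreal (1/2)"
    by (metis divide_ennreal ennreal_1 ennreal_numeral zero_le_one zero_less_numeral zero_le_numeral)
  also have "\<dots> = ennreal (2 * (1/2))" by (rule ennreal_mult[symmetric]) auto
  finally show ?thesis by simp
qed

text \<open>Crossing probabilities decrease with the restart time, because the curve rises and the
  remaining time shrinks. Their measurability follows from this alone, without joint measurability
  in time and path.\<close>

lemma borel_measurable_antimono_ennreal:
  fixes f :: "real \<Rightarrow> ennreal"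
  assumes f: "antimono f" "\<And>r. f r < \<infinity>"
  shows "f \<in> borel_measurable borel"
proof -
  have "mono (\<lambda>r. - enn2real (f r))"
    using f by (auto simp: mono_def antimono_def intro!: enn2real_mono)
  then have "(\<lambda>r. - enn2real (f r)) \<in> borel_measurable borel" by (rule borel_measurable_mono)
  then have "(\<lambda>r. ennreal (- (- enn2real (f r)))) \<in> borel_measurable borel" by measurable
  also have "(\<lambda>r. ennreal (- (- enn2real (f r)))) = f"
    using f(2) by (auto simp: fun_eq_iff)
  finally show ?thesis .
qed

context standard_brownian_motion
begin

text \<open>Strict inequality between continuous functions persists nearby, so a strict crossing is
  seen on every fine enough grid. This is the lower semicontinuity behind
  \<open>hit_open\<close>.\<close>

lemma path_grid_eventually:
  assumes \<omega>: "\<omega> \<in> space M" and g: "continuous_on UNIV g" and c: "0 < c"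
    and u: "0 \<le> u" "g u < B u \<omega>"
  shows "\<forall>\<^sub>F m in sequentially. g (real (grid_below c m u) * (c / 2 ^ m)) < B (real (grid_below c m u) * (c / 2 ^ m)) \<omega>"
proof -
  let ?u = "\<lambda>m. real (grid_below c m u) * (c / 2 ^ m)"
  have lim: "?u \<longlonglongrightarrow> u" using grid_below_tendsto[OF c u(1)] .
  have "(\<lambda>m. B (?u m) \<omega>) \<longlonglongrightarrow> B u \<omega>"
    using c u by (intro path_tendsto[OF \<omega> _ lim]) auto
  moreover have "(\<lambda>m. g (?u m)) \<longlonglongrightarrow> g u"
    using continuous_on_tendsto_compose[OF g lim] by simp
  ultimately have "(\<lambda>m. B (?u m) \<omega> - g (?u m)) \<longlonglongrightarrow> B u \<omega> - g u" by (rule tendsto_diff)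
  then have "\<forall>\<^sub>F m in sequentially. 0 < B (?u m) \<omega> - g (?u m)"
    using u by (intro order_tendstoD(1)) auto
  then show ?thesis by simp
qed

lemma open_hit_iff_grid:
  assumes \<omega>: "\<omega> \<in> space M" and g: "continuous_on UNIV g" and c: "0 < c"
  shows "(\<exists>u\<ge>0. u < T \<and> g u < B u \<omega>) \<longleftrightarrow>
    (\<exists>m k. real k * (c / 2 ^ m) < T \<and> g (real k * (c / 2 ^ m)) < B (real k * (c / 2 ^ m)) \<omega>)"
proof
  assume "\<exists>u\<ge>0. u < T \<and> g u < B u \<omega>"
  then obtain u where u: "0 \<le> u" "u < T" "g u < B u \<omega>" by auto
  obtain m where "g (real (grid_below c m u) * (c / 2 ^ m)) < B (real (grid_below c m u) * (c / 2 ^ m)) \<omega>"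
    using path_grid_eventually[OF \<omega> g c u(1,3)] eventually_happens'[OF sequentially_bot] by blast
  moreover have "real (grid_below c m u) * (c / 2 ^ m) < T"
    using grid_below(1)[OF c u(1), of m] u by linarith
  ultimately show "\<exists>m k. real k * (c / 2 ^ m) < T \<and> g (real k * (c / 2 ^ m)) < B (real k * (c / 2 ^ m)) \<omega>"
    by blast
next
  assume "\<exists>m k. real k * (c / 2 ^ m) < T \<and> g (real k * (c / 2 ^ m)) < B (real k * (c / 2 ^ m)) \<omega>"
  then obtain m k where "real k * (c / 2 ^ m) < T" "g (real k * (c / 2 ^ m)) < B (real k * (c / 2 ^ m)) \<omega>" by auto
  then show "\<exists>u\<ge>0. u < T \<and> g u < B u \<omega>"
    using c by (intro exI[of _ "real k * (c / 2 ^ m)"]) auto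
qed

lemma measurable_grid_point[measurable]: "B (real k * (1 / 2 ^ m)) \<in> borel_measurable M"
  by (intro measurable) auto

lemma sets_open_hit[measurable]:
  assumes g: "continuous_on UNIV g"
  shows "{\<omega> \<in> space M. \<exists>u\<ge>0. u < T \<and> g u < B u \<omega>} \<in> sets M"
proof -
  have "{\<omega> \<in> space M. \<exists>u\<ge>0. u < T \<and> g u < B u \<omega>} =
    {\<omega> \<in> space M. \<exists>m k. real k * (1 / 2 ^ m) < T \<and> g (real k * (1 / 2 ^ m)) < B (real k * (1 / 2 ^ m)) \<omega>}"
    by (intro Collect_cong conj_cong refl open_hit_iff_grid[OF _ g]) auto
  then show ?thesis by simp
qed

text \<open>Compactness: the times \<open>u i\<close> have a convergent subsequence, and weak
  inequalities pass to its limit. The null sequences \<open>v\<close> and \<open>e\<close> admit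
  near-crossings of a slightly shifted curve. This is the upper semicontinuity behind
  \<open>hit_closed\<close>.\<close>

lemma closed_hit_limit:
  assumes \<omega>: "\<omega> \<in> space M" and g: "continuous_on UNIV g"
    and u: "\<And>i. 0 \<le> u i" "\<And>i. u i \<le> T i" "T \<longlonglongrightarrow> S" and v: "v \<longlonglongrightarrow> 0" and e: "e \<longlonglongrightarrow> 0"
    and hit: "\<And>i. g (u i + v i) - e i \<le> B (u i) \<omega>"
  shows "\<exists>u\<ge>0. u \<le> S \<and> g u \<le> B u \<omega>"
proof -
  obtain R where R: "\<And>i. T i \<le> R"
    using convergent_imp_Bseq[of T] u(3) unfolding Bseq_def convergent_def
    by (metis abs_le_D1 real_norm_def)
  have "\<forall>i. u i \<in> {0..R}" using u R by (auto intro: order_trans)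
  moreover have "compact {0..R}" by simp
  ultimately obtain l s where l: "l \<in> {0..R}" "strict_mono s" "(u \<circ> s) \<longlonglongrightarrow> l"
    unfolding compact_eq_seq_compact_metric seq_compact_def by blast
  have lim: "(\<lambda>i. u (s i)) \<longlonglongrightarrow> l" using l by (simp add: comp_def)
  have sub: "(\<lambda>i. f (s i)) \<longlonglongrightarrow> a" if "f \<longlonglongrightarrow> a" for f :: "nat \<Rightarrow> real" and a
    using LIMSEQ_subseq_LIMSEQ[OF that l(2)] by (simp add: comp_def)
  have "l \<le> S" using u(2) by (intro LIMSEQ_le[OF lim sub[OF u(3)]]) auto
  moreover have "g l - 0 \<le> B l \<omega>"
  proof (rule LIMSEQ_le)
    have *: "(\<lambda>i. u (s i) + v (s i)) \<longlonglongrightarrow> l + 0" by (intro tendsto_add lim sub v)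
    have "(\<lambda>i. g (u (s i) + v (s i))) \<longlonglongrightarrow> g l"
      using continuous_on_tendsto_compose[OF g *] by simp
    then show "(\<lambda>i. g (u (s i) + v (s i)) - e (s i)) \<longlonglongrightarrow> g l - 0"
      by (rule tendsto_diff[OF _ sub[OF e]])
    show "(\<lambda>i. B (u (s i)) \<omega>) \<longlonglongrightarrow> B l \<omega>"
      using l u by (intro path_tendsto[OF \<omega> _ lim]) auto
  qed (use hit in auto)
  ultimately show ?thesis using l(1) by auto
qed

text \<open>A weak crossing need not occur at a dyadic time. It is equivalent to dyadic
  near-crossings for every tolerance, which is a countable condition; compactness gives the
  direction back.\<close>

lemma sets_closed_hit[measurable]:
  assumes g: "continuous_on UNIV g"
  shows "{\<omega> \<in> space M. \<exists>u\<ge>0. u \<le> T \<and> g u \<le> B u \<omega>} \<in> sets M"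
proof -
  have "{\<omega> \<in> space M. \<exists>u\<ge>0. u \<le> T \<and> g u \<le> B u \<omega>} =
    {\<omega> \<in> space M. \<forall>i. \<exists>m k. real k * (1 / 2 ^ m) \<le> T \<and>
       g (real k * (1 / 2 ^ m)) - 1 / real (Suc i) < B (real k * (1 / 2 ^ m)) \<omega>}"
  proof (intro Collect_cong conj_cong refl iffI allI)
    fix \<omega> i assume \<omega>: "\<omega> \<in> space M" and "\<exists>u\<ge>0. u \<le> T \<and> g u \<le> B u \<omega>"
    then obtain u where u: "0 \<le> u" "u \<le> T" "g u \<le> B u \<omega>" by auto
    have "0 < 1 / real (Suc i)" by simp
    then have "g u - 1 / real (Suc i) < B u \<omega>" using u(3) by linarith
    then have "\<forall>\<^sub>F m in sequentially. g (real (grid_below 1 m u) * (1 / 2 ^ m)) - 1 / real (Suc i) < B (real (grid_below 1 m u) * (1 / 2 ^ m)) \<omega>"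
      using u by (intro path_grid_eventually[OF \<omega>]) (auto intro!: continuous_on_diff g)
    then obtain m where "g (real (grid_below 1 m u) * (1 / 2 ^ m)) - 1 / real (Suc i) < B (real (grid_below 1 m u) * (1 / 2 ^ m)) \<omega>"
      using eventually_happens'[OF sequentially_bot] by blast
    moreover have "real (grid_below 1 m u) * (1 / 2 ^ m) \<le> T"
      using grid_below(1)[of 1 u m] u by linarith
    ultimately show "\<exists>m k. real k * (1 / 2 ^ m) \<le> T \<and>
       g (real k * (1 / 2 ^ m)) - 1 / real (Suc i) < B (real k * (1 / 2 ^ m)) \<omega>" by blast
  next
    fix \<omega> assume \<omega>: "\<omega> \<in> space M" and "\<forall>i. \<exists>m k. real k * (1 / 2 ^ m) \<le> T \<and>
       g (real k * (1 / 2 ^ m)) - 1 / real (Suc i) < B (real k * (1 / 2 ^ m)) \<omega>"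
    then obtain m k where mk: "\<And>i. real (k i) * (1 / 2 ^ m i) \<le> T"
       "\<And>i. g (real (k i) * (1 / 2 ^ m i)) - 1 / real (Suc i) < B (real (k i) * (1 / 2 ^ m i)) \<omega>" by metis
    show "\<exists>u\<ge>0. u \<le> T \<and> g u \<le> B u \<omega>"
    proof (rule closed_hit_limit[OF \<omega> g])
      show "real (k i) * (1 / 2 ^ m i) \<le> T" for i by (rule mk)
      show "g (real (k i) * (1 / 2 ^ m i) + 0) - 1 / real (Suc i) \<le> B (real (k i) * (1 / 2 ^ m i)) \<omega>" for i
        using mk(2)[of i] by simp
      show "(\<lambda>i. 1 / real (Suc i)) \<longlonglongrightarrow> 0" by (rule LIMSEQ_Suc[OF lim_1_over_n])
    qed auto
  qed
  then show ?thesis by simp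
qed

text \<open>Uniform continuity of the path on \<open>{0..R}\<close>. It bounds the overshoot, since
  one index before the first passage the walk is still at or below the level.\<close>

lemma small_grid_increments:
  assumes \<omega>: "\<omega> \<in> space M" and c: "0 < c" and \<eta>: "0 < \<eta>"
  shows "\<forall>\<^sub>F m in sequentially. \<forall>k. real (Suc k) * (c / 2 ^ m) \<le> R \<longrightarrow>
    \<bar>B (real (Suc k) * (c / 2 ^ m)) \<omega> - B (real k * (c / 2 ^ m)) \<omega>\<bar> < \<eta>"
proof -
  have "uniformly_continuous_on {0..R} (\<lambda>t. B t \<omega>)"
    by (intro compact_uniformly_continuous continuous_on_subset[OF continuous_paths[OF \<omega>]]) auto
  then obtain d where d: "0 < d" "\<And>s t. s \<in> {0..R} \<Longrightarrow> t \<in> {0..R} \<Longrightarrow> dist t s < d \<Longrightarrow> dist (B t \<omega>) (B s \<omega>) < \<eta>"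
    unfolding uniformly_continuous_on_def using \<eta> by metis
  have "\<forall>\<^sub>F m in sequentially. c / 2 ^ m < d"
    using order_tendstoD(2)[OF mesh_tendsto_0 d(1)] .
  then show ?thesis
  proof eventually_elim
    case (elim m)
    show ?case
    proof (intro allI impI)
      fix k assume k: "real (Suc k) * (c / 2 ^ m) \<le> R"
      have step: "real (Suc k) * (c / 2 ^ m) = real k * (c / 2 ^ m) + c / 2 ^ m"
        by (simp add: algebra_simps add_divide_distrib)
      have h: "0 < c / 2 ^ m" using c by simp
      have k0: "0 \<le> real k * (c / 2 ^ m)" using h by (intro mult_nonneg_nonneg) auto
      have "dist (B (real (Suc k) * (c / 2 ^ m)) \<omega>) (B (real k * (c / 2 ^ m)) \<omega>) < \<eta>"
        using k h k0 elim unfolding step by (intro d(2)) (auto simp: dist_real_def)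
      then show "\<bar>B (real (Suc k) * (c / 2 ^ m)) \<omega> - B (real k * (c / 2 ^ m)) \<omega>\<bar> < \<eta>"
        by (simp add: dist_real_def)
    qed
  qed
qed

lemma first_passage_overshoot:
  assumes "\<omega> \<in> space M" "0 \<le> L" "first_passage L n (\<lambda>k. B (real k * h) \<omega>)"
    and "\<And>k. Suc k = n \<Longrightarrow> \<bar>B (real (Suc k) * h) \<omega> - B (real k * h) \<omega>\<bar> < \<eta>"
  shows "B (real n * h) \<omega> < L + \<eta>"
proof (cases n)
  case 0
  then show ?thesis using assms start[OF assms(1)] by (auto simp: first_passage_def)
next
  case (Suc k)
  then have "B (real k * h) \<omega> \<le> L" using assms(3) by (auto simp: first_passage_def)
  then show ?thesis using assms(4)[OF Suc[symmetric]] unfolding Suc by linarith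
qed

lemma emeasure_increment_pos:
  "0 < t \<Longrightarrow> emeasure M {\<omega> \<in> space M. 0 < B t \<omega>} = 1/2"
  using emeasure_B_greater[of t 0] by (simp add: emeasure_std_gauss_pos)

text \<open>No path is reflected: given the passage at \<open>j < n\<close>, the increment from
  \<open>j\<close> to \<open>n\<close> is independent of it and positive with probability one
  half.\<close>

lemma grid_reflection:
  assumes h: "0 < h"
  shows "emeasure M {\<omega>\<in>space M. \<exists>j<n. first_passage L j (\<lambda>k. B (real k * h) \<omega>)} * (1/2)
    = emeasure M {\<omega>\<in>space M. \<exists>j<n. first_passage L j (\<lambda>k. B (real k * h) \<omega>)
        \<and> B (real j * h) \<omega> < B (real n * h) \<omega>}"
proof -
  let ?A = "\<lambda>j. emeasure M {\<omega>\<in>space M. first_passage L j (\<lambda>k. B (real k * h) \<omega>)}"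
  have "(\<Sum>j<n. ?A j * emeasure M {\<omega>\<in>space M. True})
    = emeasure M {\<omega>\<in>space M. \<exists>j<n. first_passage L j (\<lambda>k. B (real k * h) \<omega>) \<and> True}"
    using sum_first_passage[OF h, of "\<lambda>_ _. True"] by simp
  then have "emeasure M {\<omega>\<in>space M. \<exists>j<n. first_passage L j (\<lambda>k. B (real k * h) \<omega>)} = (\<Sum>j<n. ?A j)"
    using emeasure_space_1 by simp
  then have "emeasure M {\<omega>\<in>space M. \<exists>j<n. first_passage L j (\<lambda>k. B (real k * h) \<omega>)} * (1/2) = (\<Sum>j<n. ?A j * (1/2))"
    by (simp only: sum_distrib_right)
  also have "\<dots> = (\<Sum>j<n. ?A j * emeasure M {\<omega>\<in>space M. 0 < B (real (n - j) * h) \<omega>})"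
    using h by (intro sum.cong refl arg_cong2[where f = "(*)"] emeasure_increment_pos[symmetric] mult_pos_pos) auto
  also have "\<dots> = emeasure M {\<omega>\<in>space M. \<exists>j<n. first_passage L j (\<lambda>k. B (real k * h) \<omega>)
        \<and> 0 < B (real (j + (n - j)) * h) \<omega> - B (real j * h) \<omega>}"
    by (rule sum_first_passage[OF h, of "\<lambda>j w. 0 < w (n - j)"]) measurable
  also have "{\<omega>\<in>space M. \<exists>j<n. first_passage L j (\<lambda>k. B (real k * h) \<omega>)
        \<and> 0 < B (real (j + (n - j)) * h) \<omega> - B (real j * h) \<omega>} =
      {\<omega>\<in>space M. \<exists>j<n. first_passage L j (\<lambda>k. B (real k * h) \<omega>)
        \<and> B (real j * h) \<omega> < B (real n * h) \<omega>}"
    by (intro Collect_cong conj_cong refl ex_cong1) (auto simp del: of_nat_add)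
  finally show ?thesis .
qed

text \<open>The mesh tends to 0 in \<open>grid_reflection\<close>. For the upper bound it is enough
  that the walk is above \<open>L\<close> at its passage. For the lower bound the end value is first
  required to exceed \<open>L + \<eta>\<close>, hence any value reached with an overshoot below
  \<eta>; then \<eta> tends to 0.\<close>

lemma reflection_principle:
  assumes L: "0 < L" and r: "0 < r"
  shows "emeasure M {\<omega>\<in>space M. \<exists>u\<ge>0. u < r \<and> L < B u \<omega>} = emeasure std_gauss {x. L\<^sup>2 / x\<^sup>2 < r}"
proof -
  let ?H = "{\<omega>\<in>space M. \<exists>u\<ge>0. u < r \<and> L < B u \<omega>}"
  let ?h = "\<lambda>m. r / 2 ^ m :: real"
  let ?W = "\<lambda>m \<omega> k. B (real k * ?h m) \<omega>"
  let ?F = "\<lambda>m. {\<omega>\<in>space M. \<exists>j<2^m. first_passage L j (?W m \<omega>)}"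
  let ?G = "\<lambda>m. {\<omega>\<in>space M. \<exists>j<2^m. first_passage L j (?W m \<omega>) \<and> ?W m \<omega> j < ?W m \<omega> (2^m)}"
  have h: "0 < ?h m" "0 \<le> ?h m" for m using r by auto
  have end_time: "real (2^m) * ?h m = r" for m by simp
  have lt: "real k * ?h m < r \<longleftrightarrow> k < 2^m" for k m
  proof -
    have "real k * ?h m < r \<longleftrightarrow> real k < 2^m" using r by (simp add: field_simps)
    also have "\<dots> \<longleftrightarrow> k < 2^m" by (metis of_nat_less_iff of_nat_numeral of_nat_power)
    finally show ?thesis .
  qed
  have [measurable]: "(\<lambda>\<omega>. ?W m \<omega> k) \<in> borel_measurable M" for m k using r by (intro measurable) auto
  note [measurable] = measurable_grid(1)[OF h(2)]
  have F[measurable]: "?F m \<in> sets M" for m by measurable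
  have G[measurable]: "?G m \<in> sets M" for m by measurable
  have [measurable]: "?H \<in> sets M" by measurable
  have refl: "emeasure M (?F m) * (1/2) = emeasure M (?G m)" for m
    by (rule grid_reflection[OF h(1)])
  have [measurable]: "B r \<in> borel_measurable M" using r by simp
  let ?p = "emeasure M {\<omega>\<in>space M. L < B r \<omega>}"
  have to_real: "x * (1/2) \<le> y \<Longrightarrow> x \<le> 2 * y" for x y :: ennreal
  proof -
    assume "x * (1/2) \<le> y"
    then have "2 * (x * (1/2)) \<le> 2 * y" by (intro mult_left_mono) auto
    moreover have "2 * (x * (1/2)) = x * (2 * (1/2))" by (simp only: ac_simps)
    ultimately show "x \<le> 2 * y" by (simp only: two_times_half_ennreal mult_1_right)
  qed
  have "emeasure M ?H \<le> 2 * ?p"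
  proof (rule emeasure_le_if_eventually[OF F])
    fix \<omega> assume "\<omega> \<in> ?H"
    then obtain u where u: "\<omega> \<in> space M" "0 \<le> u" "u < r" "L < B u \<omega>" by auto
    show "\<forall>\<^sub>F m in sequentially. \<omega> \<in> ?F m"
      using path_grid_eventually[OF u(1) continuous_on_const[of _ L] r u(2,4)]
    proof eventually_elim
      case (elim m)
      have "real (grid_below r m u) * ?h m < r" using grid_below(1)[OF r u(2), of m] u by linarith
      then have "grid_below r m u < 2 ^ m" by (simp only: lt)
      moreover obtain j where "j \<le> grid_below r m u" "first_passage L j (?W m \<omega>)"
        using first_passage_exists[of L "?W m \<omega>" "grid_below r m u"] elim by blast
      ultimately show ?case using u(1) le_less_trans by blast
    qed
  next
    fix m
    have "emeasure M (?G m) \<le> ?p"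
    proof (rule emeasure_mono)
      show "?G m \<subseteq> {\<omega>\<in>space M. L < B r \<omega>}"
        unfolding end_time first_passage_def by auto
    qed measurable
    then show "emeasure M (?F m) \<le> 2 * ?p" by (intro to_real) (simp only: refl)
  qed
  moreover have "2 * ?p \<le> emeasure M ?H"
  proof -
    have FH: "emeasure M (?F m) \<le> emeasure M ?H" for m
    proof (rule emeasure_mono)
      show "?F m \<subseteq> ?H"
      proof safe
        fix \<omega> j assume "first_passage L j (?W m \<omega>)" "j < 2^m"
        then show "\<exists>u\<ge>0. u < r \<and> L < B u \<omega>"
          using r lt[of j m] by (intro exI[of _ "real j * ?h m"]) (auto simp: first_passage_def)
      qed
    qed measurable
    have "emeasure M {\<omega>\<in>space M. L + \<eta> < B r \<omega>} \<le> emeasure M ?H * (1/2)" if \<eta>: "0 < \<eta>" for \<eta>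
    proof (rule emeasure_le_if_eventually[OF G])
      fix \<omega> assume "\<omega> \<in> {\<omega>\<in>space M. L + \<eta> < B r \<omega>}"
      then have \<omega>: "\<omega> \<in> space M" "L + \<eta> < B r \<omega>" by auto
      show "\<forall>\<^sub>F m in sequentially. \<omega> \<in> ?G m"
        using small_grid_increments[OF \<omega>(1) r \<eta>, of r]
      proof eventually_elim
        case (elim m)
        have top: "L + \<eta> < ?W m \<omega> (2^m)" using \<omega>(2) unfolding end_time .
        then have "L < ?W m \<omega> (2^m)" using \<eta> by linarith
        then obtain j where j: "j \<le> 2^m" "first_passage L j (?W m \<omega>)"
          using first_passage_exists[of L "?W m \<omega>"] by blast
        have "real j * ?h m \<le> real (2^m) * ?h m"
          using j(1) h(2) by (intro mult_right_mono) auto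
        then have "?W m \<omega> j < L + \<eta>"
          using elim j L unfolding end_time by (intro first_passage_overshoot[OF \<omega>(1)]) auto
        \<comment> \<open>\<open>?G\<close> admits only passages before the final index; the margin
          \<eta> excludes a first passage at the final index itself.\<close>
        moreover from this have "j \<noteq> 2^m" using top by auto
        ultimately show ?case using \<omega>(1) j top by (intro CollectI conjI exI[of _ j]) auto
      qed
    next
      fix m show "emeasure M (?G m) \<le> emeasure M ?H * (1/2)"
        unfolding refl[symmetric] by (intro mult_right_mono FH) auto
    qed
    note shifted = this
    have "?p \<le> emeasure M ?H * (1/2)"
    proof (rule emeasure_le_if_eventually[of "\<lambda>i. {\<omega>\<in>space M. L + 1 / real (Suc i) < B r \<omega>}"])
      show "{\<omega>\<in>space M. L + 1 / real (Suc i) < B r \<omega>} \<in> sets M" for i by measurable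
      show "emeasure M {\<omega>\<in>space M. L + 1 / real (Suc i) < B r \<omega>} \<le> emeasure M ?H * (1/2)" for i
        by (rule shifted) simp
      fix \<omega> assume \<omega>: "\<omega> \<in> {\<omega>\<in>space M. L < B r \<omega>}"
      have "(\<lambda>i. L + 1 / real (Suc i)) \<longlonglongrightarrow> L + 0"
        by (intro tendsto_add tendsto_const LIMSEQ_Suc[OF lim_1_over_n])
      then have "\<forall>\<^sub>F i in sequentially. L + 1 / real (Suc i) < B r \<omega>"
        using \<omega> by (intro order_tendstoD(2)) auto
      then show "\<forall>\<^sub>F i in sequentially. \<omega> \<in> {\<omega>\<in>space M. L + 1 / real (Suc i) < B r \<omega>}"
        using \<omega> by auto
    qed
    then have "2 * ?p \<le> 2 * (emeasure M ?H * (1/2))" by (intro mult_left_mono) auto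
    also have "\<dots> = emeasure M ?H * (2 * (1/2))" by (simp only: ac_simps)
    also have "\<dots> = emeasure M ?H" by (simp only: two_times_half_ennreal mult_1_right)
    finally show ?thesis .
  qed
  ultimately have "emeasure M ?H = 2 * ?p" by (rule antisym)
  then show ?thesis
    by (simp only: emeasure_B_greater[OF r] emeasure_std_gauss_scaled_inverse_square[OF L r])
qed

end

section \<open>Restarting at the first passage of a level\<close>

lemma nn_integral_sum_indicator:
  assumes A: "\<And>n. A n \<in> sets M"
  shows "(\<integral>\<^sup>+\<omega>. (\<Sum>n\<in>I. c n * indicator (A n) \<omega>) \<partial>M) = (\<Sum>n\<in>I. emeasure M (A n) * c n)"
proof -
  have "(\<integral>\<^sup>+\<omega>. (\<Sum>n\<in>I. c n * indicator (A n) \<omega>) \<partial>M) = (\<Sum>n\<in>I. \<integral>\<^sup>+\<omega>. c n * indicator (A n) \<omega> \<partial>M)"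
    using A by (intro nn_integral_sum) auto
  also have "\<dots> = (\<Sum>n\<in>I. emeasure M (A n) * c n)"
    using A by (intro sum.cong refl) (simp add: nn_integral_cmult_indicator mult.commute)
  finally show ?thesis .
qed

context standard_brownian_motion
begin

text \<open>For a horizon \<open>T \<le> 0\<close> this is 0, and \<open>hit_closed\<close> is 0 for
  \<open>T < 0\<close>. So a restart after the horizon is covered by the same formula.\<close>

definition hit_open :: "(real \<Rightarrow> real) \<Rightarrow> real \<Rightarrow> ennreal" where
  "hit_open g T = emeasure M {\<omega> \<in> space M. \<exists>u\<ge>0. u < T \<and> g u < B u \<omega>}"

definition hit_closed :: "(real \<Rightarrow> real) \<Rightarrow> real \<Rightarrow> ennreal" where
  "hit_closed g T = emeasure M {\<omega> \<in> space M. \<exists>u\<ge>0. u \<le> T \<and> g u \<le> B u \<omega>}"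

definition grid :: "nat \<Rightarrow> real set" where
  "grid m = range (\<lambda>k. real k * (1 / 2 ^ m))"

text \<open>Capping at \<open>R\<close> keeps the entry time finite.\<close>

definition entry :: "real \<Rightarrow> real set \<Rightarrow> real \<Rightarrow> 'a \<Rightarrow> real" where
  "entry R D L \<omega> = Inf (insert R {u \<in> D. L < B u \<omega>})"

lemma grid_nonneg: "grid m \<subseteq> {0..}"
  by (auto simp: grid_def)

lemma grid_Suc: "grid m \<subseteq> grid (Suc m)"
proof
  fix x assume "x \<in> grid m"
  then obtain k where "x = real k * (1 / 2 ^ m)" by (auto simp: grid_def)
  then have "x = real (2 * k) * (1 / 2 ^ Suc m)" by simp
  then show "x \<in> grid (Suc m)" unfolding grid_def by blast
qed

lemma entry_less_iff:
  assumes "D \<subseteq> {0..}" "0 \<le> R"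
  shows "entry R D L \<omega> < r \<longleftrightarrow> R < r \<or> (\<exists>u\<in>D. u < r \<and> L < B u \<omega>)"
proof -
  have "bdd_below (insert R {u \<in> D. L < B u \<omega>})"
    using assms by (intro bdd_belowI[of _ 0]) auto
  then show ?thesis unfolding entry_def by (subst cInf_less_iff) auto
qed

lemma entry_bounds:
  assumes "D \<subseteq> {0..}" "0 \<le> R"
  shows "0 \<le> entry R D L \<omega>" "entry R D L \<omega> \<le> R"
proof -
  have "bdd_below (insert R {u \<in> D. L < B u \<omega>})"
    using assms by (intro bdd_belowI[of _ 0]) auto
  then show "entry R D L \<omega> \<le> R" unfolding entry_def by (intro cInf_lower) auto
  show "0 \<le> entry R D L \<omega>" unfolding entry_def using assms by (intro cInf_greatest) auto
qed

lemma entry_antimono: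
  assumes "D \<subseteq> E" "E \<subseteq> {0..}" "0 \<le> R"
  shows "entry R E L \<omega> \<le> entry R D L \<omega>"
  unfolding entry_def using assms
  by (intro cInf_superset_mono bdd_belowI[of _ 0]) auto

lemma measurable_entry_grid[measurable]:
  assumes "0 \<le> R"
  shows "entry R (grid m) L \<in> borel_measurable M"
proof (subst borel_measurable_iff_less, intro allI)
  fix a
  have "{\<omega> \<in> space M. entry R (grid m) L \<omega> < a} =
    {\<omega> \<in> space M. R < a \<or> (\<exists>k. real k * (1 / 2 ^ m) < a \<and> L < B (real k * (1 / 2 ^ m)) \<omega>)}"
    unfolding entry_less_iff[OF grid_nonneg assms] by (auto simp: grid_def)
  then show "{\<omega> \<in> space M. entry R (grid m) L \<omega> < a} \<in> sets M" by simp
qed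

lemma entry_less_sets:
  assumes "0 \<le> R"
  shows "{\<omega> \<in> space M. entry R {0..} L \<omega> < a} \<in> sets M"
proof -
  have "{\<omega> \<in> space M. entry R {0..} L \<omega> < a} =
    {\<omega> \<in> space M. R < a} \<union> {\<omega> \<in> space M. \<exists>u\<ge>0. u < a \<and> L < B u \<omega>}"
    using assms by (auto simp: entry_less_iff)
  also have "\<dots> \<in> sets M" by measurable
  finally show ?thesis .
qed

lemma measurable_entry[measurable]: "0 \<le> R \<Longrightarrow> entry R {0..} L \<in> borel_measurable M"
  using entry_less_sets by (subst borel_measurable_iff_less) auto

text \<open>The condition \<open>L < B u\<close> is open in \<open>u\<close>: a time at which it
  holds, rounded down, satisfies it on all fine grids. For a weak inequality the grids could miss
  the entry.\<close>

lemma entry_grid_tendsto: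
  assumes \<omega>: "\<omega> \<in> space M" and R: "0 \<le> R"
  shows "(\<lambda>m. entry R (grid m) L \<omega>) \<longlonglongrightarrow> entry R {0..} L \<omega>"
proof (rule order_tendstoI)
  fix a assume "a < entry R {0..} L \<omega>"
  then show "\<forall>\<^sub>F m in sequentially. a < entry R (grid m) L \<omega>"
    using entry_antimono[OF grid_nonneg order_refl R] by (intro always_eventually allI) (rule less_le_trans)
next
  fix a assume "entry R {0..} L \<omega> < a"
  then consider "R < a" | u where "0 \<le> u" "u < a" "L < B u \<omega>"
    using R by (auto simp: entry_less_iff)
  then show "\<forall>\<^sub>F m in sequentially. entry R (grid m) L \<omega> < a"
  proof cases
    case 1
    then show ?thesis using R by (simp add: entry_less_iff[OF grid_nonneg])
  next
    case 2
    show ?thesis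
      using path_grid_eventually[OF \<omega> continuous_on_const[of _ L] zero_less_one 2(1,3)]
    proof eventually_elim
      case (elim m)
      have "real (grid_below 1 m u) * (1 / 2 ^ m) < a"
        using grid_below(1)[of 1 u m] 2 by linarith
      moreover have "real (grid_below 1 m u) * (1 / 2 ^ m) \<in> grid m" unfolding grid_def by blast
      ultimately show ?case using elim unfolding entry_less_iff[OF grid_nonneg R] by blast
    qed
  qed
qed

text \<open>This is the link to the algorithm: by the reflection principle the waiting time of a
  step is the passage time of a Brownian motion to the level \<open>L\<close>.\<close>

lemma distr_entry:
  assumes L: "0 < L" and R: "0 < R" and [measurable]: "f \<in> borel_measurable borel"
  shows "(\<integral>\<^sup>+\<omega>. f (entry R {0..} L \<omega>) \<partial>M) = (\<integral>\<^sup>+x. f (min R (L\<^sup>2 / x\<^sup>2)) \<partial>std_gauss)"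
proof -
  have [measurable]: "entry R {0..} L \<in> borel_measurable M" using R by simp
  \<comment> \<open>\<open>measure_eqI_lessThan\<close> tests measures on upper rays, the reflection
    principle describes lower ones; hence the sign.\<close>
  let ?D = "distr M borel (\<lambda>\<omega>. - entry R {0..} L \<omega>)"
  let ?E = "distr std_gauss borel (\<lambda>x. - min R (L\<^sup>2 / x\<^sup>2))"
  have "?D = ?E"
  proof (rule measure_eqI_lessThan)
    fix a :: real
    define r where "r = - a"
    have D: "emeasure ?D {a<..} = emeasure M {\<omega> \<in> space M. entry R {0..} L \<omega> < r}"
      by (subst emeasure_distr) (auto simp: r_def intro!: arg_cong[where f = "emeasure M"])
    have E: "emeasure ?E {a<..} = emeasure std_gauss {x. min R (L\<^sup>2 / x\<^sup>2) < r}"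
      by (subst emeasure_distr) (auto simp: r_def intro!: arg_cong[where f = "emeasure std_gauss"])
    show "emeasure ?D {a<..} < \<infinity>"
      unfolding D by (simp add: emeasure_eq_measure)
    consider "r \<le> 0" | "0 < r" "r \<le> R" | "R < r" by linarith
    then show "emeasure ?D {a<..} = emeasure ?E {a<..}"
    proof cases
      case 1
      have "{\<omega> \<in> space M. entry R {0..} L \<omega> < r} = {}"
        using 1 R entry_bounds(1)[of "{0..}" R L] by (auto simp: not_less intro: order_trans)
      moreover have "{x. min R (L\<^sup>2 / x\<^sup>2) < r} = {}"
        using 1 R by (auto simp: not_less intro: order_trans)
      ultimately show ?thesis unfolding D E by (simp only: emeasure_empty)
    next
      case 2
      have "{\<omega> \<in> space M. entry R {0..} L \<omega> < r} = {\<omega> \<in> space M. \<exists>u\<ge>0. u < r \<and> L < B u \<omega>}"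
        using 2 R by (auto simp: entry_less_iff)
      moreover have "{x. min R (L\<^sup>2 / x\<^sup>2) < r} = {x. L\<^sup>2 / x\<^sup>2 < r}" using 2 by auto
      ultimately show ?thesis unfolding D E using reflection_principle[OF L 2(1)] by simp
    next
      case 3
      then have "{\<omega> \<in> space M. entry R {0..} L \<omega> < r} = space M" "{x. min R (L\<^sup>2 / x\<^sup>2) < r} = UNIV"
        using R by (auto simp: entry_less_iff)
      then show ?thesis unfolding D E using emeasure_space_1 std_gauss.emeasure_space_1 by simp
    qed
  qed auto
  then have "(\<integral>\<^sup>+y. f (- y) \<partial>?D) = (\<integral>\<^sup>+y. f (- y) \<partial>?E)" by simp
  then show ?thesis by (subst (asm) (1 2) nn_integral_distr) auto
qed

lemma entry_grid_eq:
  assumes "first_passage L n (\<lambda>k. B (real k * (1 / 2 ^ m)) \<omega>)" "real n * (1 / 2 ^ m) \<le> R"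
  shows "entry R (grid m) L \<omega> = real n * (1 / 2 ^ m)"
  unfolding entry_def
proof (rule cInf_eq_minimum)
  show "real n * (1 / 2 ^ m) \<in> insert R {u \<in> grid m. L < B u \<omega>}"
    using assms unfolding grid_def first_passage_def by auto
  fix x assume "x \<in> insert R {u \<in> grid m. L < B u \<omega>}"
  then consider "x = R" | k where "x = real k * (1 / 2 ^ m)" "L < B (real k * (1 / 2 ^ m)) \<omega>"
    by (auto simp: grid_def)
  then show "real n * (1 / 2 ^ m) \<le> x"
  proof cases
    case 2
    then have "n \<le> k" using assms(1) unfolding first_passage_def by (metis not_le)
    then show ?thesis unfolding 2 by (intro mult_right_mono) auto
  qed (use assms in auto)
qed

lemma entry_grid_cases:
  assumes "0 \<le> R"
  obtains n where "first_passage L n (\<lambda>k. B (real k * (1 / 2 ^ m)) \<omega>)" "real n * (1 / 2 ^ m) < R"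
  | "entry R (grid m) L \<omega> = R"
proof (cases "entry R (grid m) L \<omega> < R")
  case True
  then obtain k where k: "real k * (1 / 2 ^ m) < R" "L < B (real k * (1 / 2 ^ m)) \<omega>"
    unfolding entry_less_iff[OF grid_nonneg assms] by (auto simp: grid_def)
  obtain n where n: "n \<le> k" "first_passage L n (\<lambda>k. B (real k * (1 / 2 ^ m)) \<omega>)"
    using first_passage_exists[of L "\<lambda>k. B (real k * (1 / 2 ^ m)) \<omega>" k] k by blast
  have "real n * (1 / 2 ^ m) \<le> real k * (1 / 2 ^ m)" using n(1) by (intro mult_right_mono) auto
  then show ?thesis using that(1) n k by auto
next
  case False
  then show ?thesis using that(2) entry_bounds(2)[OF grid_nonneg assms, of m L \<omega>] by simp
qed

text \<open>On a grid the walk is at or above \<open>L\<close> when it first passes \<open>L\<close>, so restarting it at \<open>L\<close>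
  only lowers the probability of a crossing.\<close>

lemma hit_open_restart:
  assumes \<psi>: "continuous_on UNIV \<psi>" "mono \<psi>" and L: "0 < L"
  shows "(\<integral>\<^sup>+x. hit_open (\<lambda>u. \<psi> (L\<^sup>2 / x\<^sup>2 + u) - L) (T - L\<^sup>2 / x\<^sup>2) \<partial>std_gauss) \<le> hit_open \<psi> T"
proof -
  \<comment> \<open>An entry at or after \<open>T\<close> leaves no time for a strict crossing, so
    capping there loses nothing.\<close>
  define R where "R = max T 1"
  have R: "0 < R" "0 \<le> R" "T \<le> R" by (auto simp: R_def)
  let ?h = "\<lambda>m. 1 / 2 ^ m :: real"
  \<comment> \<open>The restarted crossing on the grid, for a restart at time \<open>r\<close>. It
    grows as \<open>r\<close> decreases and as the grid is refined.\<close>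
  define E where "E m r = {\<omega> \<in> space M. \<exists>k. real k * ?h m < T - r \<and> \<psi> (r + real k * ?h m) - L < B (real k * ?h m) \<omega>}" for m r
  define f where "f r = hit_open (\<lambda>u. \<psi> (r + u) - L) (T - r)" for r
  have E[measurable]: "E m r \<in> sets M" for m r unfolding E_def by measurable
  have \<psi>r: "continuous_on UNIV (\<lambda>u. \<psi> (r + u) - L)" for r
    by (intro continuous_intros continuous_on_compose2[OF \<psi>(1)]) auto
  have Emono: "E m r \<subseteq> E m s" if "s \<le> r" for m r s
  proof -
    have "real k * ?h m < T - s" "\<psi> (s + real k * ?h m) - L < B (real k * ?h m) \<omega>"
      if "real k * ?h m < T - r" "\<psi> (r + real k * ?h m) - L < B (real k * ?h m) \<omega>" for k \<omega>
      using that \<open>s \<le> r\<close> monoD[OF \<psi>(2), of "s + real k * ?h m" "r + real k * ?h m"] by auto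
    then show ?thesis unfolding E_def by blast
  qed
  have Esub: "E m r \<subseteq> E (Suc m) r" for m r
  proof
    fix \<omega> assume "\<omega> \<in> E m r"
    then obtain k where k: "\<omega> \<in> space M" "real k * ?h m < T - r" "\<psi> (r + real k * ?h m) - L < B (real k * ?h m) \<omega>"
      by (auto simp: E_def)
    have "real (2 * k) * ?h (Suc m) = real k * ?h m" by simp
    with k show "\<omega> \<in> E (Suc m) r" unfolding E_def by (intro CollectI conjI exI[of _ "2 * k"]) (simp_all only:)
  qed
  have Emeas: "(\<lambda>r. emeasure M (E m r)) \<in> borel_measurable borel" for m
    using Emono by (intro borel_measurable_antimono_ennreal antimonoI emeasure_mono) (auto simp: emeasure_eq_measure)
  have fmeas: "f \<in> borel_measurable borel"
  proof (intro borel_measurable_antimono_ennreal antimonoI)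
    fix r s :: real assume rs: "r \<le> s"
    show "f s \<le> f r" unfolding f_def hit_open_def
    proof (rule emeasure_mono)
      have "u < T - r" "\<psi> (r + u) - L < B u \<omega>" if "u < T - s" "\<psi> (s + u) - L < B u \<omega>" for u \<omega>
        using that rs monoD[OF \<psi>(2), of "r + u" "s + u"] by auto
      then show "{\<omega> \<in> space M. \<exists>u\<ge>0. u < T - s \<and> \<psi> (s + u) - L < B u \<omega>}
        \<subseteq> {\<omega> \<in> space M. \<exists>u\<ge>0. u < T - r \<and> \<psi> (r + u) - L < B u \<omega>}" by blast
    qed (rule sets_open_hit[OF \<psi>r])
  qed (simp add: f_def hit_open_def emeasure_eq_measure)
  let ?t = "\<lambda>m. entry R (grid m) L" and ?s = "entry R {0..} L"
  have [measurable]: "?t m \<in> borel_measurable M" for m using R by simp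
  note Emeas[measurable]
  have grid_bound: "(\<integral>\<^sup>+\<omega>. emeasure M (E m (?t m \<omega>)) \<partial>M) \<le> hit_open \<psi> T" for m
  proof -
    have h: "0 < ?h m" "0 \<le> ?h m" by auto
    note [measurable] = measurable_grid(1)[OF h(2)]
    let ?A = "\<lambda>n. {\<omega>\<in>space M. first_passage L n (\<lambda>k. B (real k * ?h m) \<omega>)}"
    have [measurable]: "?A n \<in> sets M" for n by measurable
    define K where "K = nat \<lceil>R * 2 ^ m\<rceil>"
    have K: "n < K" if "real n * ?h m < R" for n
    proof -
      have "real n < R * 2 ^ m" using that by (simp add: field_simps)
      then show ?thesis unfolding K_def by linarith
    qed
    have "emeasure M (E m (?t m \<omega>)) \<le> (\<Sum>n<K. emeasure M (E m (real n * ?h m)) * indicator (?A n) \<omega>)"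
      if \<omega>: "\<omega> \<in> space M" for \<omega>
    proof (cases rule: entry_grid_cases[OF R(2), of L m \<omega>])
      case (1 n)
      have "emeasure M (E m (?t m \<omega>)) = emeasure M (E m (real n * ?h m)) * indicator (?A n) \<omega>"
        using 1 \<omega> by (subst entry_grid_eq[OF 1(1)]) auto
      also have "\<dots> \<le> (\<Sum>n<K. emeasure M (E m (real n * ?h m)) * indicator (?A n) \<omega>)"
        using K[OF 1(2)] by (intro member_le_sum) auto
      finally show ?thesis .
    next
      case 2
      have "E m R = {}" using R(3) h by (auto simp: E_def not_less intro: order_trans[of _ 0])
      then show ?thesis unfolding 2 by simp
    qed
    then have "(\<integral>\<^sup>+\<omega>. emeasure M (E m (?t m \<omega>)) \<partial>M) \<le> (\<integral>\<^sup>+\<omega>. (\<Sum>n<K. emeasure M (E m (real n * ?h m)) * indicator (?A n) \<omega>) \<partial>M)"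
      by (rule nn_integral_mono)
    also have "\<dots> = (\<Sum>n<K. emeasure M (?A n) * emeasure M (E m (real n * ?h m)))"
      by (rule nn_integral_sum_indicator) measurable
    also have "\<dots> = emeasure M {\<omega>\<in>space M. \<exists>n<K. first_passage L n (\<lambda>k. B (real k * ?h m) \<omega>) \<and>
        (\<exists>k. real k * ?h m < T - real n * ?h m \<and>
          \<psi> (real n * ?h m + real k * ?h m) - L < B (real (n + k) * ?h m) \<omega> - B (real n * ?h m) \<omega>)}"
      unfolding E_def
      by (rule sum_first_passage[OF h(1), of "\<lambda>n w. \<exists>k. real k * ?h m < T - real n * ?h m \<and>
          \<psi> (real n * ?h m + real k * ?h m) - L < w k"]) measurable
    also have "\<dots> \<le> hit_open \<psi> T"
      unfolding hit_open_def
    proof (rule emeasure_mono)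
      show "{\<omega>\<in>space M. \<exists>n<K. first_passage L n (\<lambda>k. B (real k * ?h m) \<omega>) \<and>
        (\<exists>k. real k * ?h m < T - real n * ?h m \<and>
          \<psi> (real n * ?h m + real k * ?h m) - L < B (real (n + k) * ?h m) \<omega> - B (real n * ?h m) \<omega>)}
        \<subseteq> {\<omega> \<in> space M. \<exists>u\<ge>0. u < T \<and> \<psi> u < B u \<omega>}"
      proof safe
        fix \<omega> n k assume fp: "first_passage L n (\<lambda>k. B (real k * ?h m) \<omega>)"
          and k: "real k * ?h m < T - real n * ?h m"
            "\<psi> (real n * ?h m + real k * ?h m) - L < B (real (n + k) * ?h m) \<omega> - B (real n * ?h m) \<omega>"
        have eq: "real n * ?h m + real k * ?h m = real (n + k) * ?h m" by (simp only: of_nat_add distrib_right)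
        have "L < B (real n * ?h m) \<omega>" using fp by (simp add: first_passage_def)
        then have "\<psi> (real (n + k) * ?h m) < B (real (n + k) * ?h m) \<omega>"
          using k(2) unfolding eq by linarith
        moreover have "real (n + k) * ?h m < T" using k(1) unfolding eq[symmetric] by linarith
        ultimately show "\<exists>u\<ge>0. u < T \<and> \<psi> u < B u \<omega>"
          using h(2) by (intro exI[of _ "real (n + k) * ?h m"] conjI mult_nonneg_nonneg) auto
      qed
    qed (rule sets_open_hit[OF \<psi>(1)])
    finally show ?thesis .
  qed
  have tdec: "?t (Suc m) \<omega> \<le> ?t m \<omega>" for m \<omega>
    by (rule entry_antimono[OF grid_Suc grid_nonneg R(2)])
  \<comment> \<open>Entry times decrease under refinement, so both effects have the same sign and
    monotone convergence applies to the events and then to the integrals.\<close>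
  have inc: "incseq (\<lambda>m. E m (?t m \<omega>))" for \<omega>
    using Emono[OF tdec] Esub by (intro incseq_SucI) (blast intro: order_trans)
  have limit: "f (?s \<omega>) = (SUP m. emeasure M (E m (?t m \<omega>)))" if \<omega>: "\<omega> \<in> space M" for \<omega>
  proof -
    have t: "(\<lambda>m. ?t m \<omega>) \<longlonglongrightarrow> ?s \<omega>" by (rule entry_grid_tendsto[OF \<omega> R(2)])
    have st: "?s \<omega> \<le> ?t m \<omega>" for m by (rule entry_antimono[OF grid_nonneg order_refl R(2)])
    \<comment> \<open>Here \<omega> only fixes the entry time, and \<omega>' is the independent path
      after the restart. Strict inequalities survive replacing the limit times by nearby grid times,
      so nothing is lost in the union.\<close>
    have "{\<omega>' \<in> space M. \<exists>u\<ge>0. u < T - ?s \<omega> \<and> \<psi> (?s \<omega> + u) - L < B u \<omega>'} = (\<Union>m. E m (?t m \<omega>))"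
    proof (intro equalityI subsetI)
      fix \<omega>' assume "\<omega>' \<in> {\<omega>' \<in> space M. \<exists>u\<ge>0. u < T - ?s \<omega> \<and> \<psi> (?s \<omega> + u) - L < B u \<omega>'}"
      then obtain u where u: "\<omega>' \<in> space M" "0 \<le> u" "u < T - ?s \<omega>" "\<psi> (?s \<omega> + u) - L < B u \<omega>'" by auto
      let ?u = "\<lambda>m. real (grid_below 1 m u) * ?h m"
      have lim: "?u \<longlonglongrightarrow> u" using grid_below_tendsto[of 1 u] u by simp
      have sum: "(\<lambda>m. ?t m \<omega> + ?u m) \<longlonglongrightarrow> ?s \<omega> + u" by (intro tendsto_add t lim)
      have "(\<lambda>m. B (?u m) \<omega>' - (\<psi> (?t m \<omega> + ?u m) - L)) \<longlonglongrightarrow> B u \<omega>' - (\<psi> (?s \<omega> + u) - L)"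
        using u continuous_on_tendsto_compose[OF \<psi>(1) sum]
        by (intro tendsto_diff tendsto_const path_tendsto[OF u(1) _ lim]) auto
      then have "\<forall>\<^sub>F m in sequentially. 0 < B (?u m) \<omega>' - (\<psi> (?t m \<omega> + ?u m) - L)"
        using u by (intro order_tendstoD(1)) auto
      moreover have "\<forall>\<^sub>F m in sequentially. ?t m \<omega> + ?u m < T"
        using u by (intro order_tendstoD(2)[OF sum]) auto
      ultimately have "\<forall>\<^sub>F m in sequentially. \<omega>' \<in> E m (?t m \<omega>)"
      proof eventually_elim
        case (elim m)
        then show ?case unfolding E_def using u(1)
          by (intro CollectI conjI exI[of _ "grid_below 1 m u"]) linarith+
      qed
      then show "\<omega>' \<in> (\<Union>m. E m (?t m \<omega>))"
        using eventually_happens'[OF sequentially_bot] by blast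
    next
      fix \<omega>' assume "\<omega>' \<in> (\<Union>m. E m (?t m \<omega>))"
      then obtain m where "\<omega>' \<in> E m (?t m \<omega>)" by auto
      then have "\<omega>' \<in> E m (?s \<omega>)" using Emono[OF st] by blast
      then obtain k where "\<omega>' \<in> space M" "real k * ?h m < T - ?s \<omega>" "\<psi> (?s \<omega> + real k * ?h m) - L < B (real k * ?h m) \<omega>'"
        by (auto simp: E_def)
      then show "\<omega>' \<in> {\<omega>' \<in> space M. \<exists>u\<ge>0. u < T - ?s \<omega> \<and> \<psi> (?s \<omega> + u) - L < B u \<omega>'}"
        by (intro CollectI conjI exI[of _ "real k * ?h m"]) auto
    qed
    then show ?thesis unfolding f_def hit_open_def using inc E by (simp add: SUP_emeasure_incseq image_subset_iff)
  qed
  have "(\<integral>\<^sup>+x. f (L\<^sup>2 / x\<^sup>2) \<partial>std_gauss) = (\<integral>\<^sup>+x. f (min R (L\<^sup>2 / x\<^sup>2)) \<partial>std_gauss)"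
  proof (intro nn_integral_cong)
    have "f r = 0" if "R \<le> r" for r
    proof -
      have "{\<omega> \<in> space M. \<exists>u\<ge>0. u < T - r \<and> \<psi> (r + u) - L < B u \<omega>} = {}" using that R by auto
      then show ?thesis unfolding f_def hit_open_def by (simp only: emeasure_empty)
    qed
    then show "f (L\<^sup>2 / x\<^sup>2) = f (min R (L\<^sup>2 / x\<^sup>2))" for x
      by (cases "R \<le> L\<^sup>2 / x\<^sup>2") (auto simp: min_def)
  qed
  also have "\<dots> = (\<integral>\<^sup>+\<omega>. f (?s \<omega>) \<partial>M)" by (rule distr_entry[OF L R(1) fmeas, symmetric])
  also have "\<dots> = (\<integral>\<^sup>+\<omega>. (SUP m. emeasure M (E m (?t m \<omega>))) \<partial>M)"
    by (intro nn_integral_cong limit)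
  also have "\<dots> = (SUP m. \<integral>\<^sup>+\<omega>. emeasure M (E m (?t m \<omega>)) \<partial>M)"
  proof (rule nn_integral_monotone_convergence_SUP)
    show "incseq (\<lambda>m \<omega>. emeasure M (E m (?t m \<omega>)))"
      using inc by (auto simp: incseq_def le_fun_def intro!: emeasure_mono)
  qed measurable
  also have "\<dots> \<le> hit_open \<psi> T" by (intro SUP_least grid_bound)
  finally show ?thesis unfolding f_def .
qed

text \<open>Here the overshoot is harmful. Passing \<open>L - \<eta>\<close> instead of \<open>L\<close> absorbs it as soon as the
  increments on the grid are below \<open>\<eta>\<close>.\<close>

lemma hit_closed_restart_shifted:
  assumes \<psi>: "continuous_on UNIV \<psi>" "mono \<psi>" and L: "0 < L" "L \<le> \<psi> 0" and \<eta>: "0 < \<eta>" "\<eta> < L"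
  shows "hit_closed \<psi> T \<le> (\<integral>\<^sup>+x. hit_closed (\<lambda>u. \<psi> ((L - \<eta>)\<^sup>2 / x\<^sup>2 + u) - L - \<eta>) (T - (L - \<eta>)\<^sup>2 / x\<^sup>2) \<partial>std_gauss)"
proof -
  \<comment> \<open>The cap must lie strictly beyond \<open>T\<close>, because a weak crossing at
    \<open>T\<close> itself counts.\<close>
  define R where "R = max (T + 1) 1"
  have R: "0 < R" "0 \<le> R" "T < R" by (auto simp: R_def)
  \<comment> \<open>Lowering the level keeps the walk below \<open>L\<close> at its passage; the
    \<eta> subtracted here pays for rounding the crossing time down to the grid.\<close>
  define f where "f r = hit_closed (\<lambda>u. \<psi> (r + u) - L - \<eta>) (T - r)" for r
  have \<psi>r: "continuous_on UNIV (\<lambda>u. \<psi> (r + u) - L - \<eta>)" for r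
    by (intro continuous_intros continuous_on_compose2[OF \<psi>(1)]) auto
  have fanti: "f s \<le> f r" if rs: "r \<le> s" for r s
    unfolding f_def hit_closed_def
  proof (rule emeasure_mono)
    have "u \<le> T - r" "\<psi> (r + u) - L - \<eta> \<le> B u \<omega>" if "u \<le> T - s" "\<psi> (s + u) - L - \<eta> \<le> B u \<omega>" for u \<omega>
      using that rs monoD[OF \<psi>(2), of "r + u" "s + u"] by auto
    then show "{\<omega> \<in> space M. \<exists>u\<ge>0. u \<le> T - s \<and> \<psi> (s + u) - L - \<eta> \<le> B u \<omega>}
      \<subseteq> {\<omega> \<in> space M. \<exists>u\<ge>0. u \<le> T - r \<and> \<psi> (r + u) - L - \<eta> \<le> B u \<omega>}" by blast
  qed (rule sets_closed_hit[OF \<psi>r])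
  have fmeas: "f \<in> borel_measurable borel"
    using fanti by (intro borel_measurable_antimono_ennreal antimonoI)
      (auto simp: f_def hit_closed_def emeasure_eq_measure)
  let ?h = "\<lambda>m. 1 / 2 ^ m :: real"
  let ?W = "\<lambda>m \<omega> k. B (real k * ?h m) \<omega>"
  let ?s = "entry R {0..} (L - \<eta>)"
  define K where "K m = nat \<lceil>R * 2 ^ m\<rceil>" for m
  have K: "n < K m" if "real n * ?h m < R" for n m
  proof -
    have "real n < R * 2 ^ m" using that by (simp add: field_simps)
    then show ?thesis unfolding K_def by linarith
  qed
  let ?e = "\<lambda>m n w. \<exists>k. real n * ?h m + real k * ?h m \<le> T \<and> \<psi> (real n * ?h m + real k * ?h m) - L - \<eta> \<le> w k"
  let ?A = "\<lambda>m n. {\<omega>\<in>space M. first_passage (L - \<eta>) n (?W m \<omega>)}"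
  let ?E = "\<lambda>m. {\<omega>\<in>space M. \<exists>n<K m. first_passage (L - \<eta>) n (?W m \<omega>) \<and>
      ?e m n (\<lambda>k. B (real (n + k) * ?h m) \<omega> - B (real n * ?h m) \<omega>)}"
  have h: "0 < ?h m" "0 \<le> ?h m" for m by auto
  note [measurable] = measurable_grid(1)[OF h(2)] measurable_grid(2)[OF h(2)]
  have [measurable]: "?E m \<in> sets M" for m by measurable
  have [measurable]: "?A m n \<in> sets M" for m n by measurable
  have "hit_closed \<psi> T \<le> (\<integral>\<^sup>+\<omega>. f (?s \<omega>) \<partial>M)"
    unfolding hit_closed_def
  proof (rule emeasure_le_if_eventually[of ?E])
    fix \<omega> assume "\<omega> \<in> {\<omega> \<in> space M. \<exists>u\<ge>0. u \<le> T \<and> \<psi> u \<le> B u \<omega>}"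
    then obtain u where \<omega>: "\<omega> \<in> space M" and u: "0 \<le> u" "u \<le> T" "\<psi> u \<le> B u \<omega>" by auto
    have "\<forall>\<^sub>F m in sequentially. \<psi> (real (grid_below 1 m u) * ?h m) - \<eta> < B (real (grid_below 1 m u) * ?h m) \<omega>"
      using u \<eta> by (intro path_grid_eventually[OF \<omega>]) (auto intro!: continuous_on_diff \<psi>)
    then show "\<forall>\<^sub>F m in sequentially. \<omega> \<in> ?E m"
      using small_grid_increments[OF \<omega> zero_less_one \<eta>(1), of R]
    proof eventually_elim
      case (elim m)
      define i where "i = grid_below 1 m u"
      have iT: "real i * ?h m \<le> T" using grid_below(1)[of 1 u m] u unfolding i_def by linarith
      \<comment> \<open>A walk within \<eta> of the curve is above \<open>L - \<eta>\<close>, since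
        the curve never goes below \<open>L\<close>; so it has already passed the lowered
        level.\<close>
      have "\<psi> 0 \<le> \<psi> (real i * ?h m)" using h by (intro monoD[OF \<psi>(2)]) auto
      then have "L - \<eta> < ?W m \<omega> i" using elim(1) L unfolding i_def by linarith
      then obtain n where n: "n \<le> i" "first_passage (L - \<eta>) n (?W m \<omega>)"
        using first_passage_exists[of "L - \<eta>" "?W m \<omega>" i] by blast
      define k where "k = i - n"
      have i: "i = n + k" using n by (simp add: k_def)
      have nR: "real n * ?h m < R"
      proof -
        have "real n * ?h m \<le> real i * ?h m" using n(1) h(2) by (intro mult_right_mono) auto
        then show ?thesis using iT R by linarith
      qed
      have "?W m \<omega> n < L - \<eta> + \<eta>"
        using elim(2) nR \<eta> by (intro first_passage_overshoot[OF \<omega> _ n(2)]) auto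
      moreover have eq: "real n * ?h m + real k * ?h m = real (n + k) * ?h m" by (simp only: of_nat_add distrib_right)
      ultimately have "?e m n (\<lambda>k. B (real (n + k) * ?h m) \<omega> - B (real n * ?h m) \<omega>)"
        using iT elim(1) unfolding i_def[symmetric] i eq by (intro exI[of _ k] conjI) (unfold eq, linarith+)
      then show ?case using \<omega> n(2) K[OF nR] by blast
    qed
  next
    fix m
    have "emeasure M (?E m) = (\<Sum>n<K m. emeasure M (?A m n) * emeasure M {\<omega>\<in>space M. ?e m n (?W m \<omega>)})"
      by (rule sum_first_passage[OF h(1), of "?e m", symmetric]) measurable
    also have "\<dots> = (\<integral>\<^sup>+\<omega>. (\<Sum>n<K m. emeasure M {\<omega>\<in>space M. ?e m n (?W m \<omega>)} * indicator (?A m n) \<omega>) \<partial>M)"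
      by (rule nn_integral_sum_indicator[symmetric]) measurable
    also have "\<dots> \<le> (\<integral>\<^sup>+\<omega>. f (?s \<omega>) \<partial>M)"
    proof (intro nn_integral_mono)
      fix \<omega> assume \<omega>: "\<omega> \<in> space M"
      let ?g = "\<lambda>n. emeasure M {\<omega>\<in>space M. ?e m n (?W m \<omega>)} * indicator (?A m n) \<omega>"
      have term_le: "?g n \<le> f (?s \<omega>)" if n: "first_passage (L - \<eta>) n (?W m \<omega>)" for n
      proof (cases "real n * ?h m \<le> T")
        case True
        have "emeasure M {\<omega>\<in>space M. ?e m n (?W m \<omega>)} \<le> f (real n * ?h m)"
          unfolding f_def hit_closed_def
        proof (rule emeasure_mono)
          show "{\<omega>\<in>space M. ?e m n (?W m \<omega>)} \<subseteq>
            {\<omega> \<in> space M. \<exists>u\<ge>0. u \<le> T - real n * ?h m \<and> \<psi> (real n * ?h m + u) - L - \<eta> \<le> B u \<omega>}"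
          proof safe
            fix \<omega> k assume "real n * ?h m + real k * ?h m \<le> T" "\<psi> (real n * ?h m + real k * ?h m) - L - \<eta> \<le> ?W m \<omega> k"
            then show "\<exists>u\<ge>0. u \<le> T - real n * ?h m \<and> \<psi> (real n * ?h m + u) - L - \<eta> \<le> B u \<omega>"
              by (intro exI[of _ "real k * ?h m"]) auto
          qed
        qed (rule sets_closed_hit[OF \<psi>r])
        \<comment> \<open>Grid entries come no earlier than the entry of the whole path, and
          \<open>f\<close> decreases, so the inequality already has the right direction without a
          limit of entry times.\<close>
        also have "f (real n * ?h m) \<le> f (?s \<omega>)"
        proof (rule fanti)
          have "?s \<omega> \<le> entry R (grid m) (L - \<eta>) \<omega>"
            by (rule entry_antimono[OF grid_nonneg order_refl R(2)])
          also have "\<dots> = real n * ?h m"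
            using True R by (intro entry_grid_eq[OF n]) linarith
          finally show "?s \<omega> \<le> real n * ?h m" .
        qed
        finally have "emeasure M {\<omega>\<in>space M. ?e m n (?W m \<omega>)} \<le> f (?s \<omega>)" .
        moreover have "?g n \<le> emeasure M {\<omega>\<in>space M. ?e m n (?W m \<omega>)}"
        proof -
          have "indicator (?A m n) \<omega> \<le> (1 :: ennreal)" by (simp split: split_indicator)
          from mult_left_mono[OF this zero_le] show ?thesis by (simp only: mult_1_right)
        qed
        ultimately show ?thesis by (rule order_trans[rotated])
      next
        case False
        have "{\<omega>\<in>space M. ?e m n (?W m \<omega>)} = {}"
        proof -
          have "\<not> real n * ?h m + real k * ?h m \<le> T" for k
          proof -
            have "0 \<le> real k * ?h m" by simp
            then show ?thesis using False by linarith
          qed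
          then show ?thesis by blast
        qed
        then show ?thesis by (simp only: emeasure_empty mult_zero_left zero_le)
      qed
      show "(\<Sum>n<K m. ?g n) \<le> f (?s \<omega>)"
      proof (cases "\<exists>n<K m. first_passage (L - \<eta>) n (?W m \<omega>)")
        case True
        then obtain n where n: "n < K m" "first_passage (L - \<eta>) n (?W m \<omega>)" by blast
        have "(\<Sum>n<K m. ?g n) = ?g n + (\<Sum>n\<in>{..<K m} - {n}. ?g n)"
          using n by (intro sum.remove) auto
        also have "(\<Sum>n\<in>{..<K m} - {n}. ?g n) = 0"
          using first_passage_unique[OF n(2)] by (intro sum.neutral) (auto split: split_indicator)
        finally show ?thesis using term_le[OF n(2)] by (simp only: add_0_right)
      next
        case False
        then have "(\<Sum>n<K m. ?g n) = 0" by (intro sum.neutral) (auto split: split_indicator)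
        then show ?thesis by (simp only: zero_le)
      qed
    qed
    finally show "emeasure M (?E m) \<le> (\<integral>\<^sup>+\<omega>. f (?s \<omega>) \<partial>M)" .
  qed measurable
  also have "\<dots> = (\<integral>\<^sup>+x. f (min R ((L - \<eta>)\<^sup>2 / x\<^sup>2)) \<partial>std_gauss)"
    using \<eta> by (intro distr_entry R fmeas) auto
  also have "\<dots> = (\<integral>\<^sup>+x. f ((L - \<eta>)\<^sup>2 / x\<^sup>2) \<partial>std_gauss)"
  proof (intro nn_integral_cong)
    have "f r = 0" if "R \<le> r" for r
    proof -
      have "{\<omega> \<in> space M. \<exists>u\<ge>0. u \<le> T - r \<and> \<psi> (r + u) - L - \<eta> \<le> B u \<omega>} = {}" using that R by auto
      then show ?thesis unfolding f_def hit_closed_def by (simp only: emeasure_empty)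
    qed
    then show "f (min R ((L - \<eta>)\<^sup>2 / x\<^sup>2)) = f ((L - \<eta>)\<^sup>2 / x\<^sup>2)" for x
      by (cases "R \<le> (L - \<eta>)\<^sup>2 / x\<^sup>2") (auto simp: min_def)
  qed
  finally show ?thesis unfolding f_def .
qed

text \<open>As \<eta> decreases to 0, the restart time increases and the tolerance shrinks, so the
  events decrease. A path in all of them crosses weakly by compactness, and decreasing convergence
  moves the limit inside the Gaussian integral.\<close>

lemma hit_closed_restart:
  assumes \<psi>: "continuous_on UNIV \<psi>" "mono \<psi>" and L: "0 < L" "L \<le> \<psi> 0"
  shows "hit_closed \<psi> T \<le> (\<integral>\<^sup>+x. hit_closed (\<lambda>u. \<psi> (L\<^sup>2 / x\<^sup>2 + u) - L) (T - L\<^sup>2 / x\<^sup>2) \<partial>std_gauss)"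
proof -
  \<comment> \<open>With \<open>i + 2\<close> the value is below \<open>L\<close> already at
    \<open>i = 0\<close>.\<close>
  define \<eta> where "\<eta> i = L / real (i + 2)" for i :: nat
  have \<eta>: "0 < \<eta> i" "\<eta> i < L" for i using L by (auto simp: \<eta>_def field_simps intro!: add_pos_nonneg)
  have \<eta>_dec: "\<eta> j \<le> \<eta> i" if "i \<le> j" for i j
    unfolding \<eta>_def using that L by (intro divide_left_mono) auto
  have \<eta>0: "\<eta> \<longlonglongrightarrow> 0"
  proof -
    have "(\<lambda>i. L * (1 / real (i + 2))) \<longlonglongrightarrow> L * 0"
      by (intro tendsto_mult tendsto_const LIMSEQ_ignore_initial_segment[OF lim_1_over_n])
    then show ?thesis by (simp add: \<eta>_def[abs_def])
  qed
  define r where "r i x = (L - \<eta> i)\<^sup>2 / x\<^sup>2" for i and x :: real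
  have r_inc: "r i x \<le> r j x" if "i \<le> j" for i j x
    unfolding r_def using \<eta>_dec[OF that] \<eta>[of i] by (intro divide_right_mono power_mono) auto
  have r_lim: "(\<lambda>i. r i x) \<longlonglongrightarrow> L\<^sup>2 / x\<^sup>2" for x
  proof -
    have "(\<lambda>i. (L - \<eta> i)\<^sup>2 * inverse (x\<^sup>2)) \<longlonglongrightarrow> (L - 0)\<^sup>2 * inverse (x\<^sup>2)"
      by (intro tendsto_intros \<eta>0)
    then show ?thesis by (simp add: r_def divide_inverse)
  qed
  have \<psi>r: "continuous_on UNIV (\<lambda>u. \<psi> (s + u) - L - e)" for s e
    by (intro continuous_intros continuous_on_compose2[OF \<psi>(1)]) auto
  define H where "H e s = {\<omega> \<in> space M. \<exists>u\<ge>0. u \<le> T - s \<and> \<psi> (s + u) - L - e \<le> B u \<omega>}" for e s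
  have H[measurable]: "H e s \<in> sets M" for e s unfolding H_def by (rule sets_closed_hit[OF \<psi>r])
  have H_mono: "H e' s' \<subseteq> H e s" if "e' \<le> e" "s \<le> s'" for e e' s s'
  proof -
    have "u \<le> T - s" "\<psi> (s + u) - L - e \<le> B u \<omega>" if "u \<le> T - s'" "\<psi> (s' + u) - L - e' \<le> B u \<omega>" for u \<omega>
      using that \<open>e' \<le> e\<close> \<open>s \<le> s'\<close> monoD[OF \<psi>(2), of "s + u" "s' + u"] by auto
    then show ?thesis unfolding H_def by blast
  qed
  have H_meas: "(\<lambda>s. emeasure M (H e s)) \<in> borel_measurable borel" for e
    using H_mono by (intro borel_measurable_antimono_ennreal antimonoI emeasure_mono) (auto simp: emeasure_eq_measure)
  define G where "G i x = emeasure M (H (\<eta> i) (r i x))" for i x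
  have [measurable]: "G i \<in> borel_measurable borel" for i
    unfolding G_def r_def using H_meas[measurable] by measurable
  have dec: "decseq (\<lambda>i. H (\<eta> i) (r i x))" for x
    using H_mono \<eta>_dec r_inc by (auto simp: decseq_def)
  have limit: "(INF i. G i x) \<le> hit_closed (\<lambda>u. \<psi> (L\<^sup>2 / x\<^sup>2 + u) - L) (T - L\<^sup>2 / x\<^sup>2)" for x
  proof -
    have g: "continuous_on UNIV (\<lambda>u. \<psi> (L\<^sup>2 / x\<^sup>2 + u) - L)"
      by (intro continuous_intros continuous_on_compose2[OF \<psi>(1)]) auto
    have "(INF i. G i x) = emeasure M (\<Inter>i. H (\<eta> i) (r i x))"
      unfolding G_def using dec by (intro INF_emeasure_decseq) (auto simp: emeasure_eq_measure)
    also have "\<dots> \<le> hit_closed (\<lambda>u. \<psi> (L\<^sup>2 / x\<^sup>2 + u) - L) (T - L\<^sup>2 / x\<^sup>2)"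
      unfolding hit_closed_def
    proof (rule emeasure_mono[OF _ sets_closed_hit[OF g]], rule subsetI)
      fix \<omega> assume \<omega>: "\<omega> \<in> (\<Inter>i. H (\<eta> i) (r i x))"
      then have \<omega>M: "\<omega> \<in> space M" by (auto simp: H_def)
      have "\<exists>u\<ge>0. u \<le> T - r i x \<and> \<psi> (r i x + u) - L - \<eta> i \<le> B u \<omega>" for i
        using \<omega> by (auto simp: H_def)
      then obtain u where u: "\<And>i. 0 \<le> u i" "\<And>i. u i \<le> T - r i x" "\<And>i. \<psi> (r i x + u i) - L - \<eta> i \<le> B (u i) \<omega>"
        by metis
      have "\<exists>u\<ge>0. u \<le> T - L\<^sup>2 / x\<^sup>2 \<and> \<psi> (L\<^sup>2 / x\<^sup>2 + u) - L \<le> B u \<omega>"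
      proof (rule closed_hit_limit[OF \<omega>M g u(1) u(2)])
        show "(\<lambda>i. T - r i x) \<longlonglongrightarrow> T - L\<^sup>2 / x\<^sup>2" by (intro tendsto_diff tendsto_const r_lim)
        \<comment> \<open>\<open>closed_hit_limit\<close> deals with one fixed curve; the moving
          shift \<open>r i x\<close> enters as a vanishing perturbation of the argument.\<close>
        show "(\<lambda>i. r i x - L\<^sup>2 / x\<^sup>2) \<longlonglongrightarrow> 0" using tendsto_diff[OF r_lim[of x] tendsto_const[of "L\<^sup>2 / x\<^sup>2"]] by simp
        show "\<psi> (L\<^sup>2 / x\<^sup>2 + (u i + (r i x - L\<^sup>2 / x\<^sup>2))) - L - \<eta> i \<le> B (u i) \<omega>" for i
          using u(3)[of i] by (simp add: algebra_simps)
      qed (rule \<eta>0)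
      then show "\<omega> \<in> {\<omega> \<in> space M. \<exists>u\<ge>0. u \<le> T - L\<^sup>2 / x\<^sup>2 \<and> \<psi> (L\<^sup>2 / x\<^sup>2 + u) - L \<le> B u \<omega>}"
        using \<omega>M by simp
    qed
    finally show ?thesis .
  qed
  have "hit_closed \<psi> T \<le> (\<integral>\<^sup>+x. G i x \<partial>std_gauss)" for i
    using hit_closed_restart_shifted[OF \<psi> L \<eta>[of i], of T]
    unfolding G_def H_def r_def hit_closed_def .
  then have "hit_closed \<psi> T \<le> (INF i. \<integral>\<^sup>+x. G i x \<partial>std_gauss)" by (intro INF_greatest)
  also have "\<dots> = (\<integral>\<^sup>+x. (INF i. G i x) \<partial>std_gauss)"
  proof (rule nn_integral_monotone_convergence_INF_decseq[symmetric])
    show "decseq G"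
      unfolding G_def using decseqD[OF dec] by (intro antimonoI le_funI emeasure_mono) auto
    have "(\<integral>\<^sup>+x. G 0 x \<partial>std_gauss) \<le> (\<integral>\<^sup>+x. 1 \<partial>std_gauss)"
      unfolding G_def by (intro nn_integral_mono emeasure_le_1)
    also have "\<dots> < \<infinity>" using std_gauss.emeasure_space_1 by simp
    finally show "(\<integral>\<^sup>+x. G 0 x \<partial>std_gauss) < \<infinity>" .
  qed measurable
  also have "\<dots> \<le> (\<integral>\<^sup>+x. hit_closed (\<lambda>u. \<psi> (L\<^sup>2 / x\<^sup>2 + u) - L) (T - L\<^sup>2 / x\<^sup>2) \<partial>std_gauss)"
    by (intro nn_integral_mono limit)
  finally show ?thesis .
qed

end

section \<open>Comparison of the algorithm with the first passage\<close>

text \<open>The bound \<open>n\<close> and the free starting state serve the induction over the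
  first Gaussian. Only gaps at positive indices are tested: the starting gap \<open>\<phi> 0\<close>
  is artificial, and the algorithm always makes its first step.\<close>

definition stopped :: "(real \<Rightarrow> real) \<Rightarrow> real \<Rightarrow> real \<Rightarrow> nat \<Rightarrow> real \<times> real \<Rightarrow> (nat \<Rightarrow> real) \<Rightarrow> bool" where
  "stopped \<phi> \<epsilon> T n s g \<longleftrightarrow> (\<exists>k<n. (\<forall>j<k. \<epsilon> < fst (alg_state \<phi> s g (Suc j))) \<and>
     fst (alg_state \<phi> s g (Suc k)) \<le> \<epsilon> \<and> snd (alg_state \<phi> s g (Suc k)) \<le> T)"

definition running :: "(real \<Rightarrow> real) \<Rightarrow> real \<Rightarrow> nat \<Rightarrow> real \<times> real \<Rightarrow> (nat \<Rightarrow> real) \<Rightarrow> bool" where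
  "running \<phi> \<epsilon> n s g \<longleftrightarrow> (\<forall>k<n. \<epsilon> < fst (alg_state \<phi> s g (Suc k)))"

lemma stopped_case_nat:
  "stopped \<phi> \<epsilon> T (Suc n) s (case_nat x g) \<longleftrightarrow>
    (if fst (alg_step \<phi> s x) \<le> \<epsilon> then snd (alg_step \<phi> s x) \<le> T else stopped \<phi> \<epsilon> T n (alg_step \<phi> s x) g)"
  unfolding stopped_def Ex_less_Suc2 All_less_Suc2 alg_state_case_nat alg_state.simps(1) by (auto simp: not_le)

lemma running_case_nat:
  "running \<phi> \<epsilon> (Suc n) s (case_nat x g) \<longleftrightarrow>
    \<epsilon> < fst (alg_step \<phi> s x) \<and> running \<phi> \<epsilon> n (alg_step \<phi> s x) g"
  unfolding running_def All_less_Suc2 alg_state_case_nat alg_state.simps(1) ..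

lemma running_iff: "running \<phi> \<epsilon> n (\<phi> 0, 0) g \<longleftrightarrow> enat n < alg_iterations \<phi> \<epsilon> g"
proof -
  have "(\<forall>k\<in>{1..n}. Q k) \<longleftrightarrow> (\<forall>k<n. Q (Suc k))" for Q
    by (metis One_nat_def Suc_le_eq atLeastAtMost_iff not0_implies_Suc not_one_le_zero zero_less_Suc)
  then show ?thesis unfolding running_def less_alg_iterations_iff_state by simp
qed

lemma alg_output_le_iff: "alg_output \<phi> \<epsilon> g \<le> ereal T \<longleftrightarrow> (\<exists>n. stopped \<phi> \<epsilon> T n (\<phi> 0, 0) g)"
proof -
  have time: "snd (alg_state \<phi> (\<phi> 0, 0) g n) = alg_time \<phi> g n" for n
    by (simp only: alg_state_eq_alg_time snd_conv)
  have iter: "alg_iterations \<phi> \<epsilon> g = enat (Suc k) \<longleftrightarrow>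
      (\<forall>j<k. \<epsilon> < fst (alg_state \<phi> (\<phi> 0, 0) g (Suc j))) \<and> fst (alg_state \<phi> (\<phi> 0, 0) g (Suc k)) \<le> \<epsilon>" for k
  proof -
    have "y = enat (Suc k) \<longleftrightarrow> enat k < y \<and> \<not> enat (Suc k) < y" for y
      by (cases y) auto
    then have "alg_iterations \<phi> \<epsilon> g = enat (Suc k) \<longleftrightarrow> running \<phi> \<epsilon> k (\<phi> 0, 0) g \<and> \<not> running \<phi> \<epsilon> (Suc k) (\<phi> 0, 0) g"
      unfolding running_iff .
    then show ?thesis unfolding running_def less_Suc_eq by (auto simp del: alg_state.simps simp: not_less)
  qed
  have pos: "alg_iterations \<phi> \<epsilon> g \<noteq> enat 0"
    using less_alg_iterations_iff_state[of 0 \<phi> \<epsilon> g] by auto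
  show ?thesis
  proof
    assume out: "alg_output \<phi> \<epsilon> g \<le> ereal T"
    then obtain n where n: "alg_iterations \<phi> \<epsilon> g = enat n"
      by (cases "alg_iterations \<phi> \<epsilon> g") (auto simp: alg_output_def)
    then obtain k where k: "n = Suc k" using pos by (cases n) auto
    have "alg_time \<phi> g (Suc k) \<le> T" using out n k by (simp add: alg_output_def)
    then have "stopped \<phi> \<epsilon> T (Suc k) (\<phi> 0, 0) g"
      using iter[of k] n k unfolding stopped_def time by blast
    then show "\<exists>n. stopped \<phi> \<epsilon> T n (\<phi> 0, 0) g" ..
  next
    assume "\<exists>n. stopped \<phi> \<epsilon> T n (\<phi> 0, 0) g"
    then obtain k where "alg_iterations \<phi> \<epsilon> g = enat (Suc k)" "alg_time \<phi> g (Suc k) \<le> T"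
      unfolding stopped_def iter[symmetric] time using iter by blast
    then show "alg_output \<phi> \<epsilon> g \<le> ereal T" by (simp add: alg_output_def)
  qed
qed

section \<open>Distribution functions and the first Gaussian of a run\<close>

lemma borel_measurable_ereal_nonneg:
  fixes X :: "'a \<Rightarrow> ereal"
  assumes X: "\<And>\<omega>. \<omega> \<in> space M \<Longrightarrow> 0 \<le> X \<omega>" and sets: "\<And>a::real. {\<omega> \<in> space M. X \<omega> \<le> ereal a} \<in> sets M"
  shows "X \<in> borel_measurable M"
proof (rule borel_measurableI_le)
  fix a :: ereal
  show "{\<omega> \<in> space M. X \<omega> \<le> a} \<in> sets M"
  proof (cases a)
    case MInf
    then have "{\<omega> \<in> space M. X \<omega> \<le> a} = {}" using X by fastforce
    then show ?thesis by (simp only: sets.empty_sets)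
  qed (use sets in auto)
qed

text \<open>\<open>real_of_ereal\<close> maps infinity to 0 and would count it as a small value;
  almost sure finiteness makes that set null.\<close>

lemma cdf_law:
  fixes X :: "'a \<Rightarrow> ereal"
  assumes M: "prob_space M" and X[measurable]: "X \<in> borel_measurable M"
    and nn: "\<And>\<omega>. \<omega> \<in> space M \<Longrightarrow> 0 \<le> X \<omega>" and fin: "AE \<omega> in M. X \<omega> < \<infinity>"
  shows "cdf (law M X) t = measure M {\<omega> \<in> space M. X \<omega> \<le> ereal t}"
proof -
  interpret prob_space M by (rule M)
  have "cdf (law M X) t = measure M {\<omega> \<in> space M. real_of_ereal (X \<omega>) \<le> t}"
    unfolding cdf_def law_def by (subst measure_distr) (auto intro!: arg_cong[where f = "measure M"])
  also have "\<dots> = measure M {\<omega> \<in> space M. X \<omega> \<le> ereal t}"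
  proof (rule finite_measure_eq_AE)
    show "AE \<omega> in M. \<omega> \<in> {\<omega> \<in> space M. real_of_ereal (X \<omega>) \<le> t} \<longleftrightarrow> \<omega> \<in> {\<omega> \<in> space M. X \<omega> \<le> ereal t}"
      using fin AE_space
    proof eventually_elim
      case (elim \<omega>)
      then obtain r where "X \<omega> = ereal r" using nn[of \<omega>] by (cases "X \<omega>") auto
      then show ?case by simp
    qed
  qed measurable
  finally show ?thesis .
qed

lemma emeasure_std_gauss_central_le:
  "0 \<le> b \<Longrightarrow> emeasure std_gauss {-b..b} \<le> ennreal (2 * b / sqrt (2 * pi))"
proof -
  assume b: "0 \<le> b"
  have "emeasure std_gauss {-b..b} = (\<integral>\<^sup>+x. ennreal (std_normal_density x) * indicator {-b..b} x \<partial>lborel)"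
    by (subst emeasure_density) auto
  also have "\<dots> \<le> (\<integral>\<^sup>+x. ennreal (1 / sqrt (2 * pi)) * indicator {-b..b} x \<partial>lborel)"
    by (intro nn_integral_mono mult_right_mono ennreal_leI) (auto simp: std_normal_density_def divide_simps)
  also have "\<dots> = ennreal (1 / sqrt (2 * pi)) * ennreal (2 * b)"
    using b by (simp add: nn_integral_cmult_indicator)
  also have "\<dots> = ennreal (2 * b / sqrt (2 * pi))" using b by (simp flip: ennreal_mult')
  finally show ?thesis .
qed

lemma emeasure_gauss_seq_iter:
  assumes [measurable]: "Measurable.pred gauss_seq p"
  shows "emeasure gauss_seq {g \<in> space gauss_seq. p g} =
    (\<integral>\<^sup>+x. emeasure gauss_seq {g \<in> space gauss_seq. p (case_nat x g)} \<partial>std_gauss)"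
proof -
  let ?A = "{g \<in> space gauss_seq. p g}"
  have "emeasure gauss_seq ?A = (\<integral>\<^sup>+g. indicator ?A g \<partial>gauss_seq)" by simp
  also have "\<dots> = (\<integral>\<^sup>+x. \<integral>\<^sup>+g. indicator ?A (case_nat x g) \<partial>gauss_seq \<partial>std_gauss)"
    by (rule gauss_seq.nn_integral_iter) measurable
  also have "\<dots> = (\<integral>\<^sup>+x. emeasure gauss_seq {g \<in> space gauss_seq. p (case_nat x g)} \<partial>std_gauss)"
  proof (intro nn_integral_cong)
    fix x :: real
    have [measurable]: "(\<lambda>g. case_nat x g) \<in> gauss_seq \<rightarrow>\<^sub>M gauss_seq"
      by (rule measurable_PiM_single') (auto simp: space_PiM split: nat.split)
    have "(\<integral>\<^sup>+g. indicator ?A (case_nat x g) \<partial>gauss_seq) = (\<integral>\<^sup>+g. indicator {g \<in> space gauss_seq. p (case_nat x g)} g \<partial>gauss_seq)"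
      by (intro nn_integral_cong) (auto simp: space_PiM split: split_indicator)
    also have "\<dots> = emeasure gauss_seq {g \<in> space gauss_seq. p (case_nat x g)}"
      by (intro nn_integral_indicator) measurable
    finally show "(\<integral>\<^sup>+g. indicator ?A (case_nat x g) \<partial>gauss_seq) = emeasure gauss_seq {g \<in> space gauss_seq. p (case_nat x g)}" .
  qed
  finally show ?thesis .
qed

context slow_curve
begin

lemma measurable_stopped[measurable]: "Measurable.pred gauss_seq (stopped \<phi> \<epsilon> T n s)"
  unfolding stopped_def by measurable

lemma measurable_running[measurable]: "Measurable.pred gauss_seq (running \<phi> \<epsilon> n s)"
  unfolding running_def by measurable

lemma alg_output_nonneg: "0 \<le> alg_output \<phi> \<epsilon> g"
proof -
  have "0 \<le> alg_time \<phi> g n" for n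
    using alg_state_nonneg(2)[of "(\<phi> 0, 0)" g n] pos by (simp add: alg_state_eq_alg_time)
  then show ?thesis by (auto simp: alg_output_def split: enat.split)
qed

lemma sets_alg_output[measurable]: "{g \<in> space gauss_seq. alg_output \<phi> \<epsilon> g \<le> ereal T} \<in> sets gauss_seq"
  unfolding alg_output_le_iff by measurable

lemma measurable_alg_output[measurable]: "alg_output \<phi> \<epsilon> \<in> borel_measurable gauss_seq"
  by (rule borel_measurable_ereal_nonneg[OF alg_output_nonneg sets_alg_output])

lemma alg_output_finite: "0 < \<epsilon> \<Longrightarrow> AE g in gauss_seq. alg_output \<phi> \<epsilon> g < \<infinity>"
  using alg_iterations_finite[of \<epsilon>]
  by (auto simp: alg_output_def elim!: eventually_mono split: enat.splits)

lemma curve_growth_le: "0 \<le> t \<Longrightarrow> 0 \<le> u \<Longrightarrow> \<phi> (t + u) - \<phi> t \<le> u / 2"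
proof -
  assume tu: "0 \<le> t" "0 \<le> u"
  have "sqrt (1 + (t + u)) \<le> sqrt ((sqrt (1 + t) + u / 2)\<^sup>2)"
  proof (rule real_sqrt_le_mono)
    have "u * 1 \<le> u * sqrt (1 + t)" using tu by (intro mult_left_mono) auto
    then show "1 + (t + u) \<le> (sqrt (1 + t) + u / 2)\<^sup>2"
      using tu by (simp add: power2_sum add_increasing mult.commute)
  qed
  also have "\<dots> = sqrt (1 + t) + u / 2" using tu by simp
  finally show ?thesis using growth[of t "t + u"] tu by simp
qed

end

section \<open>Crossing probabilities along the algorithm\<close>

locale brownian_crossing = slow_curve \<phi> + standard_brownian_motion M B for \<phi> M B
begin

lemma continuous_curve_shift: "continuous_on UNIV (\<lambda>u. \<phi> (t + u) - a + d)"
  by (intro continuous_intros continuous_on_compose2[OF cont]) auto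

lemma mono_curve_shift: "mono (\<lambda>u. \<phi> (t + u) - a + d)"
  using mono by (auto simp: mono_def)

text \<open>The function \<open>Q\<close> at a state \<open>(d, t)\<close>: at time \<open>t\<close>
  the path is \<open>d\<close> below the curve. As \<open>B\<close> starts from 0, the curve is
  recentred to start at height \<open>d\<close>.\<close>

definition cross_open :: "real \<Rightarrow> real \<times> real \<Rightarrow> ennreal" where
  "cross_open T s = hit_open (\<lambda>u. \<phi> (snd s + u) - \<phi> (snd s) + fst s) (T - snd s)"

definition cross_closed :: "real \<Rightarrow> real \<times> real \<Rightarrow> ennreal" where
  "cross_closed T s = hit_closed (\<lambda>u. \<phi> (snd s + u) - \<phi> (snd s) + fst s) (T - snd s)"

text \<open>The recentred curve starts exactly at the level \<open>d\<close> of the restart. After a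
  waiting time leading to \<open>t'\<close>, subtracting \<open>d\<close> from it leaves
  \<open>\<phi> (t' + u) - \<phi> t\<close>, which is
  \<open>\<phi> (t' + u) - \<phi> t' + d'\<close>: the curve recentred at the next state.\<close>

lemma cross_open_step:
  assumes "0 < fst s"
  shows "(\<integral>\<^sup>+x. cross_open T (alg_step \<phi> s x) \<partial>std_gauss) \<le> cross_open T s"
  using hit_open_restart[OF continuous_curve_shift mono_curve_shift assms, of "snd s" "\<phi> (snd s)" "fst s" "T - snd s"]
  unfolding cross_open_def snd_alg_step fst_alg_step by (simp add: algebra_simps)

lemma cross_closed_step:
  assumes "0 < fst s"
  shows "cross_closed T s \<le> (\<integral>\<^sup>+x. cross_closed T (alg_step \<phi> s x) \<partial>std_gauss)"
  using hit_closed_restart[OF continuous_curve_shift mono_curve_shift assms, of "snd s" "\<phi> (snd s)" "fst s" "T - snd s"]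
  unfolding cross_closed_def snd_alg_step fst_alg_step by (simp add: algebra_simps)

text \<open>Within time \<epsilon> the curve rises by at most \<open>\<epsilon>/2\<close>, so from a
  gap of at most \<epsilon> it is enough to exceed \<open>3/2 * \<epsilon>\<close> before time
  \<epsilon>. By reflection this happens if the Gaussian exceeds
  \<open>3/2 * sqrt \<epsilon>\<close> in absolute value; the density bound gives the exceptional
  mass.\<close>

lemma cross_open_small_gap:
  assumes s: "0 \<le> fst s" "fst s \<le> \<epsilon>" "0 \<le> snd s" "snd s \<le> T - \<epsilon>" and \<epsilon>: "0 < \<epsilon>"
  shows "ennreal (1 - 3 * sqrt \<epsilon> / sqrt (2 * pi)) \<le> cross_open T s"
proof -
  define L where "L = 3/2 * \<epsilon>"
  have L: "0 < L" using \<epsilon> by (simp add: L_def)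
  define b where "b = 3/2 * sqrt \<epsilon>"
  have b: "0 \<le> b" using \<epsilon> by (simp add: b_def)
  have sub: "- {-b..b} \<subseteq> {x. L\<^sup>2 / x\<^sup>2 < \<epsilon>}"
  proof
    fix x assume "x \<in> - {-b..b}"
    then have "b < \<bar>x\<bar>" by auto
    then have "b\<^sup>2 < \<bar>x\<bar>\<^sup>2" using b by (intro power_strict_mono) auto
    moreover have "L\<^sup>2 = \<epsilon> * b\<^sup>2" using \<epsilon> by (simp add: L_def b_def power_mult_distrib power2_eq_square)
    ultimately have "L\<^sup>2 < \<epsilon> * x\<^sup>2" using \<epsilon> by simp
    moreover have "0 < x\<^sup>2" using \<open>b < \<bar>x\<bar>\<close> b by auto
    ultimately show "x \<in> {x. L\<^sup>2 / x\<^sup>2 < \<epsilon>}" by (simp add: divide_less_eq mult.commute)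
  qed
  have "measure std_gauss {-b..b} \<le> 2 * b / sqrt (2 * pi)"
    using emeasure_std_gauss_central_le[OF b] b by (simp add: std_gauss.emeasure_eq_measure)
  then have "1 - 3 * sqrt \<epsilon> / sqrt (2 * pi) \<le> 1 - measure std_gauss {-b..b}"
    by (simp add: b_def)
  also have "\<dots> = measure std_gauss (- {-b..b})"
    using std_gauss.prob_compl[of "{-b..b}"] by (simp add: Compl_eq_Diff_UNIV)
  also have "\<dots> \<le> measure std_gauss {x. L\<^sup>2 / x\<^sup>2 < \<epsilon>}"
    by (rule std_gauss.finite_measure_mono[OF sub]) auto
  finally have "ennreal (1 - 3 * sqrt \<epsilon> / sqrt (2 * pi)) \<le> emeasure std_gauss {x. L\<^sup>2 / x\<^sup>2 < \<epsilon>}"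
    by (simp add: std_gauss.emeasure_eq_measure ennreal_leI)
  also have "\<dots> = emeasure M {\<omega>\<in>space M. \<exists>u\<ge>0. u < \<epsilon> \<and> L < B u \<omega>}"
    by (rule reflection_principle[OF L \<epsilon>, symmetric])
  also have "\<dots> \<le> cross_open T s"
    unfolding cross_open_def hit_open_def
  proof (rule emeasure_mono[OF _ sets_open_hit[OF continuous_curve_shift]])
    have "u < T - snd s" "\<phi> (snd s + u) - \<phi> (snd s) + fst s < B u \<omega>"
      if "0 \<le> u" "u < \<epsilon>" "L < B u \<omega>" for u \<omega>
      using curve_growth_le[OF s(3) that(1)] that s unfolding L_def by linarith+
    then show "{\<omega>\<in>space M. \<exists>u\<ge>0. u < \<epsilon> \<and> L < B u \<omega>} \<subseteq>
      {\<omega> \<in> space M. \<exists>u\<ge>0. u < T - snd s \<and> \<phi> (snd s + u) - \<phi> (snd s) + fst s < B u \<omega>}" by blast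
  qed
  finally show ?thesis .
qed

text \<open>A supermartingale argument: the mean of \<open>cross_open\<close> does not increase in a
  step, and at a stop by \<open>T - \<epsilon>\<close> it is at least the prefactor. The factor is
  paid once, at the stop, and not at each step.\<close>

lemma stopped_le_cross_open:
  assumes \<epsilon>: "0 < \<epsilon>"
  shows "0 < fst s \<Longrightarrow> 0 \<le> snd s \<Longrightarrow>
    ennreal (1 - 3 * sqrt \<epsilon> / sqrt (2 * pi)) * emeasure gauss_seq {g \<in> space gauss_seq. stopped \<phi> \<epsilon> (T - \<epsilon>) n s g}
      \<le> cross_open T s"
proof (induction n arbitrary: s)
  case 0
  have "{g \<in> space gauss_seq. stopped \<phi> \<epsilon> (T - \<epsilon>) 0 s g} = {}" by (simp add: stopped_def)
  then show ?case by (simp only: emeasure_empty mult_zero_right zero_le)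
next
  case (Suc n)
  let ?c = "ennreal (1 - 3 * sqrt \<epsilon> / sqrt (2 * pi))"
  have step: "?c * emeasure gauss_seq {g \<in> space gauss_seq. stopped \<phi> \<epsilon> (T - \<epsilon>) (Suc n) s (case_nat x g)}
      \<le> cross_open T (alg_step \<phi> s x)" for x
  proof (cases "fst (alg_step \<phi> s x) \<le> \<epsilon>")
    case small: True
    have nn: "0 \<le> fst (alg_step \<phi> s x)" "0 \<le> snd (alg_step \<phi> s x)"
      using alg_step_nonneg[of s x] Suc.prems by auto
    show ?thesis
    proof (cases "snd (alg_step \<phi> s x) \<le> T - \<epsilon>")
      case True
      have "?c * emeasure gauss_seq {g \<in> space gauss_seq. stopped \<phi> \<epsilon> (T - \<epsilon>) (Suc n) s (case_nat x g)} \<le> ?c * 1"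
        by (intro mult_left_mono gauss_seq.P.emeasure_le_1) simp
      then show ?thesis using cross_open_small_gap[OF nn(1) small nn(2) True \<epsilon>] by simp
    next
      case False
      then have "{g \<in> space gauss_seq. stopped \<phi> \<epsilon> (T - \<epsilon>) (Suc n) s (case_nat x g)} = {}"
        using small by (simp add: stopped_case_nat)
      then show ?thesis by (simp only: emeasure_empty mult_zero_right zero_le)
    qed
  next
    case False
    then have "0 < fst (alg_step \<phi> s x)" "0 \<le> snd (alg_step \<phi> s x)"
      using alg_step_nonneg[of s x] Suc.prems \<epsilon> by auto
    from Suc.IH[OF this] False show ?thesis by (simp add: stopped_case_nat)
  qed
  have [measurable]: "(\<lambda>x. emeasure gauss_seq {g \<in> space gauss_seq. stopped \<phi> \<epsilon> (T - \<epsilon>) (Suc n) s (case_nat x g)}) \<in> borel_measurable std_gauss"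
  proof -
    have "(\<lambda>(x, g). stopped \<phi> \<epsilon> (T - \<epsilon>) (Suc n) s (case_nat x g)) \<in> measurable (std_gauss \<Otimes>\<^sub>M gauss_seq) (count_space UNIV)"
      by measurable
    then show ?thesis by measurable
  qed
  have "?c * emeasure gauss_seq {g \<in> space gauss_seq. stopped \<phi> \<epsilon> (T - \<epsilon>) (Suc n) s g}
    = (\<integral>\<^sup>+x. ?c * emeasure gauss_seq {g \<in> space gauss_seq. stopped \<phi> \<epsilon> (T - \<epsilon>) (Suc n) s (case_nat x g)} \<partial>std_gauss)"
    by (subst emeasure_gauss_seq_iter) (auto simp: nn_integral_cmult)
  also have "\<dots> \<le> (\<integral>\<^sup>+x. cross_open T (alg_step \<phi> s x) \<partial>std_gauss)"
    by (intro nn_integral_mono step)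
  also have "\<dots> \<le> cross_open T s" by (rule cross_open_step[OF Suc.prems(1)])
  finally show ?case .
qed

text \<open>The submartingale counterpart: at a stop after \<open>T\<close> no time is left and
  \<open>cross_closed\<close> vanishes; at a stop by \<open>T\<close>, and for runs not yet stopped,
  it is bounded by 1.\<close>

lemma cross_closed_le_stopped_or_running:
  assumes \<epsilon>: "0 < \<epsilon>"
  shows "0 < fst s \<Longrightarrow> 0 \<le> snd s \<Longrightarrow>
    cross_closed T s \<le> emeasure gauss_seq {g \<in> space gauss_seq. stopped \<phi> \<epsilon> T n s g \<or> running \<phi> \<epsilon> n s g}"
proof (induction n arbitrary: s)
  case 0
  have "{g \<in> space gauss_seq. stopped \<phi> \<epsilon> T 0 s g \<or> running \<phi> \<epsilon> 0 s g} = space gauss_seq" by (simp add: running_def)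
  then show ?case
    using emeasure_le_1 by (simp only: gauss_seq.P.emeasure_space_1 cross_closed_def hit_closed_def)
next
  case (Suc n)
  have step: "cross_closed T (alg_step \<phi> s x)
      \<le> emeasure gauss_seq {g \<in> space gauss_seq. stopped \<phi> \<epsilon> T (Suc n) s (case_nat x g) \<or> running \<phi> \<epsilon> (Suc n) s (case_nat x g)}" for x
  proof (cases "fst (alg_step \<phi> s x) \<le> \<epsilon>")
    case small: True
    show ?thesis
    proof (cases "snd (alg_step \<phi> s x) \<le> T")
      case True
      then have "{g \<in> space gauss_seq. stopped \<phi> \<epsilon> T (Suc n) s (case_nat x g) \<or> running \<phi> \<epsilon> (Suc n) s (case_nat x g)} = space gauss_seq"
        using small by (simp add: stopped_case_nat)
      then show ?thesis
        using emeasure_le_1 by (simp only: gauss_seq.P.emeasure_space_1 cross_closed_def hit_closed_def)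
    next
      case False
      then have "{\<omega> \<in> space M. \<exists>u\<ge>0. u \<le> T - snd (alg_step \<phi> s x) \<and>
          \<phi> (snd (alg_step \<phi> s x) + u) - \<phi> (snd (alg_step \<phi> s x)) + fst (alg_step \<phi> s x) \<le> B u \<omega>} = {}"
        by auto
      then show ?thesis unfolding cross_closed_def hit_closed_def by (simp only: emeasure_empty zero_le)
    qed
  next
    case False
    then have "0 < fst (alg_step \<phi> s x)" "0 \<le> snd (alg_step \<phi> s x)"
      using alg_step_nonneg[of s x] Suc.prems \<epsilon> by auto
    from Suc.IH[OF this] False show ?thesis by (simp add: stopped_case_nat running_case_nat not_le)
  qed
  have "cross_closed T s \<le> (\<integral>\<^sup>+x. cross_closed T (alg_step \<phi> s x) \<partial>std_gauss)"
    by (rule cross_closed_step[OF Suc.prems(1)])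
  also have "\<dots> \<le> (\<integral>\<^sup>+x. emeasure gauss_seq {g \<in> space gauss_seq. stopped \<phi> \<epsilon> T (Suc n) s (case_nat x g) \<or> running \<phi> \<epsilon> (Suc n) s (case_nat x g)} \<partial>std_gauss)"
    by (intro nn_integral_mono step)
  also have "\<dots> = emeasure gauss_seq {g \<in> space gauss_seq. stopped \<phi> \<epsilon> T (Suc n) s g \<or> running \<phi> \<epsilon> (Suc n) s g}"
    by (rule emeasure_gauss_seq_iter[symmetric]) measurable
  finally show ?case .
qed

text \<open>The infimum is not attained by definition: times approaching it give a weak crossing by
  compactness. Conversely the path starts below the curve, so a weak crossing is preceded by, or is,
  an equality.\<close>

lemma first_passage_le_iff:
  assumes \<omega>: "\<omega> \<in> space M"
  shows "first_passage_time \<phi> B \<omega> \<le> ereal T \<longleftrightarrow> (\<exists>u\<ge>0. u \<le> T \<and> \<phi> u \<le> B u \<omega>)"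
proof
  assume le: "first_passage_time \<phi> B \<omega> \<le> ereal T"
  have "\<exists>u\<ge>0. u \<le> T + 1 / real (Suc i) \<and> \<phi> u \<le> B u \<omega>" for i
  proof -
    have "first_passage_time \<phi> B \<omega> < ereal (T + 1 / real (Suc i))"
      by (rule le_less_trans[OF le]) simp
    then show ?thesis
      unfolding first_passage_time_def Inf_less_iff by (auto intro: less_imp_le)
  qed
  then obtain u where u: "\<And>i. 0 \<le> u i" "\<And>i. u i \<le> T + 1 / real (Suc i)" "\<And>i. \<phi> (u i) \<le> B (u i) \<omega>"
    by metis
  show "\<exists>u\<ge>0. u \<le> T \<and> \<phi> u \<le> B u \<omega>"
  proof (rule closed_hit_limit[OF \<omega> cont u(1) u(2)])
    show "(\<lambda>i. T + 1 / real (Suc i)) \<longlonglongrightarrow> T"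
      using tendsto_add[OF tendsto_const[of T] LIMSEQ_Suc[OF lim_1_over_n]] by simp
    show "\<phi> (u i + 0) - 0 \<le> B (u i) \<omega>" for i using u(3) by simp
  qed auto
next
  assume "\<exists>u\<ge>0. u \<le> T \<and> \<phi> u \<le> B u \<omega>"
  then obtain u where u: "0 \<le> u" "u \<le> T" "\<phi> u \<le> B u \<omega>" by auto
  have "continuous_on {0..u} (\<lambda>t. B t \<omega> - \<phi> t)"
    by (intro continuous_on_diff continuous_on_subset[OF continuous_paths[OF \<omega>]] continuous_on_subset[OF cont]) auto
  then obtain v where v: "0 \<le> v" "v \<le> u" "B v \<omega> - \<phi> v = 0"
    using IVT'[of "\<lambda>t. B t \<omega> - \<phi> t" 0 0 u] u start[OF \<omega>] pos by auto
  \<comment> \<open>The infimum ranges over positive times only.\<close>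
  have "v \<noteq> 0" using v(3) start[OF \<omega>] pos by auto
  then have "first_passage_time \<phi> B \<omega> \<le> ereal v"
    unfolding first_passage_time_def using v by (intro Inf_lower) auto
  also have "\<dots> \<le> ereal T" using v u by simp
  finally show "first_passage_time \<phi> B \<omega> \<le> ereal T" .
qed

lemma first_passage_nonneg: "0 \<le> first_passage_time \<phi> B \<omega>"
  unfolding first_passage_time_def by (intro Inf_greatest) auto

lemma emeasure_first_passage_le:
  "emeasure M {\<omega> \<in> space M. first_passage_time \<phi> B \<omega> \<le> ereal T} = hit_closed \<phi> T"
  unfolding hit_closed_def by (intro arg_cong[where f = "emeasure M"] Collect_cong conj_cong refl first_passage_le_iff)

lemma sets_first_passage_le: "{\<omega> \<in> space M. first_passage_time \<phi> B \<omega> \<le> ereal T} \<in> sets M"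
proof -
  have "{\<omega> \<in> space M. first_passage_time \<phi> B \<omega> \<le> ereal T} = {\<omega> \<in> space M. \<exists>u\<ge>0. u \<le> T \<and> \<phi> u \<le> B u \<omega>}"
    by (intro Collect_cong conj_cong refl first_passage_le_iff)
  then show ?thesis using sets_closed_hit[OF cont] by simp
qed

lemma measurable_first_passage_time: "first_passage_time \<phi> B \<in> borel_measurable M"
  by (rule borel_measurable_ereal_nonneg[OF first_passage_nonneg sets_first_passage_le])

lemma hit_open_le_hit_closed: "hit_open \<phi> T \<le> hit_closed \<phi> T"
  unfolding hit_open_def hit_closed_def
  by (rule emeasure_mono[OF _ sets_closed_hit[OF cont]]) (auto intro: less_imp_le)

lemma alg_output_le_first_passage:
  assumes \<epsilon>: "0 < \<epsilon>"
  shows "ennreal (1 - 3 * sqrt \<epsilon> / sqrt (2 * pi)) * emeasure gauss_seq {g \<in> space gauss_seq. alg_output \<phi> \<epsilon> g \<le> ereal (T - \<epsilon>)}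
    \<le> emeasure M {\<omega> \<in> space M. first_passage_time \<phi> B \<omega> \<le> ereal T}"
proof -
  let ?c = "ennreal (1 - 3 * sqrt \<epsilon> / sqrt (2 * pi))"
  let ?S = "\<lambda>n. {g \<in> space gauss_seq. stopped \<phi> \<epsilon> (T - \<epsilon>) n (\<phi> 0, 0) g}"
  have inc: "incseq ?S" unfolding incseq_def stopped_def by (auto intro: less_le_trans)
  have S: "?S n \<in> sets gauss_seq" for n by measurable
  have "{g \<in> space gauss_seq. alg_output \<phi> \<epsilon> g \<le> ereal (T - \<epsilon>)} = (\<Union>n. ?S n)"
    unfolding alg_output_le_iff by auto
  moreover have "emeasure gauss_seq (\<Union>n. ?S n) = (SUP n. emeasure gauss_seq (?S n))"
    using inc S by (intro SUP_emeasure_incseq[symmetric] image_subsetI)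
  ultimately have "?c * emeasure gauss_seq {g \<in> space gauss_seq. alg_output \<phi> \<epsilon> g \<le> ereal (T - \<epsilon>)}
      = ?c * (SUP n. emeasure gauss_seq (?S n))" by (simp only:)
  also have "\<dots> = (SUP n. ?c * emeasure gauss_seq (?S n))"
    by (rule SUP_mult_left_ennreal)
  also have "\<dots> \<le> cross_open T (\<phi> 0, 0)"
    using pos by (intro SUP_least stopped_le_cross_open[OF \<epsilon>]) auto
  also have "\<dots> = hit_open \<phi> T" by (simp add: cross_open_def)
  also have "\<dots> \<le> hit_closed \<phi> T" by (rule hit_open_le_hit_closed)
  finally show ?thesis unfolding emeasure_first_passage_le .
qed

text \<open>A run of \<open>n\<close> steps has stopped or is still running; as \<open>n\<close>
  grows the second event disappears, since the number of iterations is finite almost surely.\<close>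

lemma first_passage_le_alg_output:
  assumes \<epsilon>: "0 < \<epsilon>"
  shows "measure M {\<omega> \<in> space M. first_passage_time \<phi> B \<omega> \<le> ereal T}
    \<le> measure gauss_seq {g \<in> space gauss_seq. alg_output \<phi> \<epsilon> g \<le> ereal T}"
proof -
  let ?O = "{g \<in> space gauss_seq. alg_output \<phi> \<epsilon> g \<le> ereal T}"
  let ?R = "\<lambda>n. {g \<in> space gauss_seq. running \<phi> \<epsilon> n (\<phi> 0, 0) g}"
  have le: "measure M {\<omega> \<in> space M. first_passage_time \<phi> B \<omega> \<le> ereal T} \<le> measure gauss_seq ?O + measure gauss_seq (?R n)" for n
  proof -
    have "emeasure M {\<omega> \<in> space M. first_passage_time \<phi> B \<omega> \<le> ereal T} = cross_closed T (\<phi> 0, 0)"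
      unfolding emeasure_first_passage_le by (simp add: cross_closed_def)
    also have "\<dots> \<le> emeasure gauss_seq {g \<in> space gauss_seq. stopped \<phi> \<epsilon> T n (\<phi> 0, 0) g \<or> running \<phi> \<epsilon> n (\<phi> 0, 0) g}"
      using pos by (intro cross_closed_le_stopped_or_running[OF \<epsilon>]) auto
    also have "\<dots> \<le> emeasure gauss_seq (?O \<union> ?R n)"
      by (intro emeasure_mono) (auto simp: alg_output_le_iff)
    finally have "measure M {\<omega> \<in> space M. first_passage_time \<phi> B \<omega> \<le> ereal T} \<le> measure gauss_seq (?O \<union> ?R n)"
      by (simp add: emeasure_eq_measure gauss_seq.P.emeasure_eq_measure)
    also have "\<dots> \<le> measure gauss_seq ?O + measure gauss_seq (?R n)"
      by (intro measure_Un_le) auto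
    finally show ?thesis .
  qed
  have "(\<lambda>n. measure gauss_seq (?R n)) \<longlonglongrightarrow> measure gauss_seq (\<Inter>n. ?R n)"
    by (intro gauss_seq.P.finite_Lim_measure_decseq) (auto simp: decseq_def running_def)
  moreover have "measure gauss_seq (\<Inter>n. ?R n) = 0"
  proof -
    have "AE g in gauss_seq. g \<notin> (\<Inter>n. ?R n)"
      using alg_iterations_finite[OF \<epsilon>]
    proof eventually_elim
      case (elim g)
      then obtain n where "alg_iterations \<phi> \<epsilon> g = enat n" by (cases "alg_iterations \<phi> \<epsilon> g") auto
      then have "\<not> running \<phi> \<epsilon> n (\<phi> 0, 0) g" unfolding running_iff by simp
      then show ?case by blast
    qed
    moreover have "(\<Inter>n. ?R n) \<in> sets gauss_seq" by measurable
    ultimately show ?thesis by (subst (asm) gauss_seq.P.prob_eq_0[symmetric]) auto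
  qed
  ultimately have "(\<lambda>n. measure gauss_seq ?O + measure gauss_seq (?R n)) \<longlonglongrightarrow> measure gauss_seq ?O + 0"
    by (intro tendsto_add tendsto_const) simp
  then show ?thesis using le by (intro LIMSEQ_le_const) auto
qed

text \<open>The output is finite almost surely, so letting \<open>T\<close> grow in the comparison
  bounds the probability of a finite passage time below by the prefactor, which tends to 1 as
  \<epsilon> tends to 0.\<close>

lemma first_passage_finite: "AE \<omega> in M. first_passage_time \<phi> B \<omega> < \<infinity>"
proof -
  note measurable_first_passage_time[measurable]
  let ?X = "{\<omega> \<in> space M. first_passage_time \<phi> B \<omega> < \<infinity>}"
  have "ennreal (1 - 3 * sqrt \<epsilon> / sqrt (2 * pi)) \<le> emeasure M ?X" if \<epsilon>: "0 < \<epsilon>" for \<epsilon>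
  proof -
    let ?c = "ennreal (1 - 3 * sqrt \<epsilon> / sqrt (2 * pi))"
    let ?O = "\<lambda>n::nat. {g \<in> space gauss_seq. alg_output \<phi> \<epsilon> g \<le> ereal (real n)}"
    have "1 = emeasure gauss_seq (\<Union>n. ?O n)"
    proof (rule gauss_seq.P.emeasure_eq_1_AE[symmetric])
      show "AE g in gauss_seq. g \<in> (\<Union>n. ?O n)"
        using alg_output_finite[OF \<epsilon>] AE_space
      proof eventually_elim
        case (elim g)
        then obtain r where "alg_output \<phi> \<epsilon> g = ereal r" using alg_output_nonneg[of \<epsilon> g] by (cases "alg_output \<phi> \<epsilon> g") auto
        then show ?case using elim real_arch_simple[of r] by auto
      qed
    qed measurable
    also have "\<dots> = (SUP n. emeasure gauss_seq (?O n))"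
    proof (rule SUP_emeasure_incseq[symmetric])
      show "incseq ?O"
      proof (rule incseq_SucI, rule subsetI)
        fix n g assume "g \<in> ?O n"
        moreover have "ereal (real n) \<le> ereal (real (Suc n))" by simp
        ultimately show "g \<in> ?O (Suc n)" by (auto intro: order_trans)
      qed
    qed auto
    finally have "?c * 1 = ?c * (SUP n. emeasure gauss_seq (?O n))" by (simp only:)
    also have "\<dots> = (SUP n. ?c * emeasure gauss_seq (?O n))" by (rule SUP_mult_left_ennreal)
    also have "\<dots> \<le> emeasure M ?X"
    proof (rule SUP_least)
      fix n
      have "?c * emeasure gauss_seq (?O n) \<le> emeasure M {\<omega> \<in> space M. first_passage_time \<phi> B \<omega> \<le> ereal (real n + \<epsilon>)}"
        using alg_output_le_first_passage[OF \<epsilon>, of "real n + \<epsilon>"] by simp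
      also have "\<dots> \<le> emeasure M ?X"
        by (intro emeasure_mono) (auto intro: le_less_trans)
      finally show "?c * emeasure gauss_seq (?O n) \<le> emeasure M ?X" .
    qed
    finally show ?thesis by simp
  qed
  then have bound: "1 - 3 * sqrt \<epsilon> / sqrt (2 * pi) \<le> measure M ?X" if "0 < \<epsilon>" for \<epsilon>
    using that by (simp add: emeasure_eq_measure ennreal_le_iff)
  have "(\<lambda>n. 1 - 3 * sqrt (1 / real (Suc n)) / sqrt (2 * pi)) \<longlonglongrightarrow> 1 - 3 * sqrt 0 / sqrt (2 * pi)"
    by (intro tendsto_intros LIMSEQ_Suc[OF lim_1_over_n]) auto
  then have "1 - 3 * sqrt 0 / sqrt (2 * pi) \<le> measure M ?X"
    by (rule LIMSEQ_le_const2) (use bound in auto)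
  then have "1 \<le> measure M ?X" by simp
  then have "measure M ?X = 1" by (rule antisym[OF prob_le_1])
  then have "AE \<omega> in M. \<omega> \<in> ?X" by (rule AE_prob_1)
  then show ?thesis by eventually_elim auto
qed

end

section \<open>Transfer to the given Gaussian variables and the given curve\<close>

lemma distr_gauss_seq:
  assumes "prob_space P" and indep: "prob_space.indep_vars P (\<lambda>_. borel) G UNIV"
    and gauss: "\<And>n. distributed P lborel (G n) std_normal_density"
  shows "(\<lambda>\<omega> n. G n \<omega>) \<in> P \<rightarrow>\<^sub>M gauss_seq" "distr P gauss_seq (\<lambda>\<omega> n. G n \<omega>) = gauss_seq"
proof -
  interpret prob_space P by fact
  have G[measurable]: "G n \<in> borel_measurable P" for n
    using distributed_measurable[OF gauss[of n]] by simp
  have sets: "sets gauss_seq = sets (\<Pi>\<^sub>M i\<in>(UNIV::nat set). (borel :: real measure))"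
    by (intro sets_PiM_cong) auto
  have "(\<lambda>\<omega> n. G n \<omega>) \<in> P \<rightarrow>\<^sub>M (\<Pi>\<^sub>M i\<in>UNIV. borel)"
    by (rule measurable_PiM_single') (use G in auto)
  then show "(\<lambda>\<omega> n. G n \<omega>) \<in> P \<rightarrow>\<^sub>M gauss_seq"
    by (subst measurable_cong_sets[OF refl sets])
  have "distr P (\<Pi>\<^sub>M i\<in>UNIV. borel) (\<lambda>\<omega>. \<lambda>i\<in>UNIV. G i \<omega>) = (\<Pi>\<^sub>M i\<in>UNIV. distr P borel (G i))"
    using indep by (subst (asm) indep_vars_iff_distr_eq_PiM) (use G in auto)
  moreover have "distr P borel (G i) = std_gauss" for i
  proof -
    have "distr P borel (G i) = distr P lborel (G i)" by (rule distr_cong) auto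
    then show ?thesis using distributed_distr_eq_density[OF gauss[of i]] by simp
  qed
  moreover have "distr P gauss_seq (\<lambda>\<omega> n. G n \<omega>) = distr P (\<Pi>\<^sub>M i\<in>UNIV. borel) (\<lambda>\<omega>. \<lambda>i\<in>UNIV. G i \<omega>)"
    by (rule distr_cong[OF refl sets]) (simp add: restrict_def)
  ultimately show "distr P gauss_seq (\<lambda>\<omega> n. G n \<omega>) = gauss_seq"
    by (simp only:)
qed

lemma alg_time_nonneg: "0 \<le> alg_time \<phi> g n"
  by (induction \<phi> g n rule: alg_time.induct) auto

lemma alg_time_cong:
  assumes "\<And>t. 0 \<le> t \<Longrightarrow> \<phi> t = \<psi> t"
  shows "alg_time \<phi> g n = alg_time \<psi> g n"
  using assms
proof (induction \<phi> g n rule: alg_time.induct)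
  case (3 \<phi> g n)
  then show ?case by (simp add: alg_time_nonneg)
qed auto

lemma alg_output_cong:
  assumes eq: "\<And>t. 0 \<le> t \<Longrightarrow> \<phi> t = \<psi> t"
  shows "alg_iterations \<phi> \<epsilon> g = alg_iterations \<psi> \<epsilon> g" "alg_output \<phi> \<epsilon> g = alg_output \<psi> \<epsilon> g"
proof -
  note [simp] = alg_time_cong[of \<phi> \<psi>, OF eq] eq[OF alg_time_nonneg]
  show "alg_iterations \<phi> \<epsilon> g = alg_iterations \<psi> \<epsilon> g" by (simp add: alg_iterations_def)
  then show "alg_output \<phi> \<epsilon> g = alg_output \<psi> \<epsilon> g" by (simp add: alg_output_def split: enat.split)
qed

text \<open>The algorithm and the passage time see \<open>\<phi>\<close> at nonnegative times only; extending it by a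
  constant makes it continuous and monotone on the whole line.\<close>

lemma slow_curve_max:
  fixes \<phi> \<phi>' :: "real \<Rightarrow> real"
  assumes mono: "mono_on {0..} \<phi>"
    and deriv: "\<And>t. t \<ge> 0 \<Longrightarrow> (\<phi> has_real_derivative \<phi>' t) (at t within {0..})"
    and pos: "\<phi> 0 > 0"
    and deriv_bound: "\<And>t. t \<ge> 0 \<Longrightarrow> 2 * \<phi>' t * sqrt (1 + t) \<le> 1"
  shows "slow_curve (\<lambda>t. \<phi> (max 0 t))"
proof
  have cont: "continuous_on {0..} \<phi>"
    using deriv by (intro DERIV_continuous_on) auto
  show "continuous_on UNIV (\<lambda>t. \<phi> (max 0 t))"
    by (rule continuous_on_compose2[OF cont]) (auto intro!: continuous_intros)
  show "mono (\<lambda>t. \<phi> (max 0 t))"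
    by (intro monoI mono_onD[OF mono]) auto
  show "0 < \<phi> (max 0 0)" using pos by simp
  show "\<phi> (max 0 t) - \<phi> (max 0 s) \<le> sqrt (1 + t) - sqrt (1 + s)" if st: "0 \<le> s" "s \<le> t" for s t
  proof -
    have "sqrt (1 + s) - \<phi> s \<le> sqrt (1 + t) - \<phi> t"
    proof (rule DERIV_nonneg_imp_increasing_open[where f = "\<lambda>x. sqrt (1 + x) - \<phi> x"])
      fix x assume x: "s < x" "x < t"
      have "(\<phi> has_real_derivative \<phi>' x) (at x)"
        using deriv[of x] x st by (simp add: at_within_interior[of x "{0..}"])
      then have "((\<lambda>x. sqrt (1 + x) - \<phi> x) has_real_derivative 1 * (inverse (sqrt (1 + x)) / 2) - \<phi>' x) (at x)"
        using x st by (auto intro!: derivative_eq_intros)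
      moreover have "0 \<le> 1 * (inverse (sqrt (1 + x)) / 2) - \<phi>' x"
        using deriv_bound[of x] x st by (simp add: field_simps)
      ultimately show "\<exists>y. ((\<lambda>x. sqrt (1 + x) - \<phi> x) has_real_derivative y) (at x) \<and> 0 \<le> y" by blast
    next
      show "s \<le> t" by (rule st)
      show "continuous_on {s..t} (\<lambda>x. sqrt (1 + x) - \<phi> x)"
        using st by (intro continuous_intros continuous_on_subset[OF cont]) auto
    qed
    then show ?thesis using st by simp
  qed
qed

theorem theorem1p1:
  fixes \<phi> \<phi>' :: "real \<Rightarrow> real"
    and M :: "'a measure" and B :: "real \<Rightarrow> 'a \<Rightarrow> real"
    and P :: "'b measure" and G :: "nat \<Rightarrow> 'b \<Rightarrow> real"
  defines "\<tau> \<equiv> first_passage_time \<phi> B"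
    and "\<tau>\<^sub>a \<equiv> (\<lambda>\<epsilon> \<omega>. alg_output \<phi> \<epsilon> (\<lambda>n. G n \<omega>))"
    and "N \<equiv> (\<lambda>\<epsilon> \<omega>. alg_iterations \<phi> \<epsilon> (\<lambda>n. G n \<omega>))"
  assumes mono: "mono_on {0..} \<phi>"
    and deriv: "\<And>t. t \<ge> 0 \<Longrightarrow> (\<phi> has_real_derivative \<phi>' t) (at t within {0..})"
    and deriv_cont: "continuous_on {0..} \<phi>'"
    and pos: "\<phi> 0 > 0"
    and limsup: "Limsup at_top (\<lambda>t. ereal (\<phi> t / sqrt (2 * t * ln (ln t)))) < 1"
    and deriv_bound: "\<And>t. t \<ge> 0 \<Longrightarrow> 2 * \<phi>' t * sqrt (1 + t) \<le> 1"
    and brownian: "standard_brownian_motion M B"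
    and prob: "prob_space P"
    and indep: "prob_space.indep_vars P (\<lambda>_. borel) G UNIV"
    and gauss: "\<And>n. distributed P lborel (G n) std_normal_density"
  shows "(AE \<omega> in M. \<tau> \<omega> < \<infinity>) \<and> (\<forall>\<epsilon>>0. AE \<omega> in P. \<tau>\<^sub>a \<epsilon> \<omega> < \<infinity>)
    \<and> (\<forall>e. (\<forall>n. e n > 0) \<and> e \<longlonglongrightarrow> 0 \<longrightarrow> weak_conv_m (\<lambda>n. law P (\<tau>\<^sub>a (e n))) (law M \<tau>))
    \<and> (\<forall>\<epsilon>>0. \<forall>t\<ge>\<epsilon>.
          cdf (law P (\<tau>\<^sub>a \<epsilon>)) (t - \<epsilon>) - 3 * sqrt \<epsilon> / sqrt (2 * pi) \<le> cdf (law M \<tau>) t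
        \<and> cdf (law M \<tau>) t \<le> cdf (law P (\<tau>\<^sub>a \<epsilon>)) t)
    \<and> (\<exists>C>0. \<exists>\<epsilon>\<^sub>0\<in>{0<..<1}. \<forall>\<epsilon>\<in>{0<..<\<epsilon>\<^sub>0}.
          (\<integral>\<^sup>+\<omega>. ennreal_of_enat (N \<epsilon> \<omega>) \<partial>P) \<le> ennreal (C * sqrt \<bar>ln \<epsilon>\<bar>))"
proof -
  define \<psi> where "\<psi> = (\<lambda>t. \<phi> (max 0 t))"
  interpret slow_curve \<psi>
    unfolding \<psi>_def by (rule slow_curve_max[OF mono deriv pos deriv_bound])
  interpret BM: standard_brownian_motion M B by (rule brownian)
  interpret brownian_crossing \<psi> M B ..
  interpret P: prob_space P by (rule prob)
  note G[measurable] = distr_gauss_seq(1)[OF prob indep gauss]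
  note G_law = distr_gauss_seq(2)[OF prob indep gauss]
  have eq: "\<phi> t = \<psi> t" if "0 \<le> t" for t using that by (simp add: \<psi>_def)
  have \<tau>: "\<tau> = first_passage_time \<psi> B"
  proof
    fix \<omega>
    have "{t. t > 0 \<and> B t \<omega> = \<phi> t} = {t. t > 0 \<and> B t \<omega> = \<psi> t}" using eq by auto
    then show "\<tau> \<omega> = first_passage_time \<psi> B \<omega>" by (simp add: \<tau>_def first_passage_time_def)
  qed
  have \<tau>\<^sub>a: "\<tau>\<^sub>a = (\<lambda>\<epsilon> \<omega>. alg_output \<psi> \<epsilon> (\<lambda>n. G n \<omega>))"
    unfolding \<tau>\<^sub>a_def using alg_output_cong(2)[OF eq] by simp
  have N: "N = (\<lambda>\<epsilon> \<omega>. alg_iterations \<psi> \<epsilon> (\<lambda>n. G n \<omega>))"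
    unfolding N_def using alg_output_cong(1)[OF eq] by simp
  have \<tau>_fin: "AE \<omega> in M. \<tau> \<omega> < \<infinity>" unfolding \<tau> by (rule first_passage_finite)
  have \<tau>\<^sub>a_fin: "AE \<omega> in P. \<tau>\<^sub>a \<epsilon> \<omega> < \<infinity>" if \<epsilon>: "0 < \<epsilon>" for \<epsilon>
  proof -
    have "AE g in distr P gauss_seq (\<lambda>\<omega> n. G n \<omega>). alg_output \<psi> \<epsilon> g < \<infinity>"
      unfolding G_law by (rule alg_output_finite[OF \<epsilon>])
    then show ?thesis unfolding \<tau>\<^sub>a by (subst (asm) AE_distr_iff) auto
  qed
  have F: "cdf (law M \<tau>) t = measure M {\<omega> \<in> space M. first_passage_time \<psi> B \<omega> \<le> ereal t}" for t
    using cdf_law[OF BM.prob_space_axioms measurable_first_passage_time first_passage_nonneg first_passage_finite]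
    unfolding \<tau> .
  have F\<^sub>a: "cdf (law P (\<tau>\<^sub>a \<epsilon>)) t = measure gauss_seq {g \<in> space gauss_seq. alg_output \<psi> \<epsilon> g \<le> ereal t}"
    if \<epsilon>: "0 < \<epsilon>" for \<epsilon> t
  proof -
    have "cdf (law P (\<tau>\<^sub>a \<epsilon>)) t = measure P {\<omega> \<in> space P. \<tau>\<^sub>a \<epsilon> \<omega> \<le> ereal t}"
    proof (rule cdf_law[OF prob _ _ \<tau>\<^sub>a_fin[OF \<epsilon>]])
      show "\<tau>\<^sub>a \<epsilon> \<in> borel_measurable P"
        unfolding \<tau>\<^sub>a by (rule measurable_compose[OF G measurable_alg_output])
      show "0 \<le> \<tau>\<^sub>a \<epsilon> \<omega>" for \<omega> unfolding \<tau>\<^sub>a by (rule alg_output_nonneg)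
    qed
    also have "\<dots> = measure (distr P gauss_seq (\<lambda>\<omega> n. G n \<omega>)) {g \<in> space gauss_seq. alg_output \<psi> \<epsilon> g \<le> ereal t}"
      unfolding \<tau>\<^sub>a by (subst measure_distr[OF G sets_alg_output]) (auto simp: space_PiM intro!: arg_cong[where f = "measure P"])
    finally show ?thesis unfolding G_law .
  qed
  have lower: "cdf (law P (\<tau>\<^sub>a \<epsilon>)) (t - \<epsilon>) - 3 * sqrt \<epsilon> / sqrt (2 * pi) \<le> cdf (law M \<tau>) t"
    if \<epsilon>: "0 < \<epsilon>" for \<epsilon> t
  proof -
    define \<delta> where "\<delta> = 3 * sqrt \<epsilon> / sqrt (2 * pi)"
    have \<delta>: "0 \<le> \<delta>" using \<epsilon> by (simp add: \<delta>_def)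
    define p where "p = measure gauss_seq {g \<in> space gauss_seq. alg_output \<psi> \<epsilon> g \<le> ereal (t - \<epsilon>)}"
    define q where "q = measure M {\<omega> \<in> space M. first_passage_time \<psi> B \<omega> \<le> ereal t}"
    have p: "0 \<le> p" "p \<le> 1" and q: "0 \<le> q" by (auto simp: p_def q_def)
    have "ennreal (1 - \<delta>) * ennreal p \<le> ennreal q"
      using alg_output_le_first_passage[OF \<epsilon>, of t]
      by (simp add: gauss_seq.P.emeasure_eq_measure BM.emeasure_eq_measure p_def q_def \<delta>_def)
    \<comment> \<open>The multiplicative loss becomes the subtractive one because
      \<open>p \<le> 1\<close>. For \<delta> above 1 the factor is truncated to 0 in
      \<open>ennreal\<close>, but the claim is then trivial.\<close>
    have "p - \<delta> \<le> q"
    proof (cases "\<delta> \<le> 1")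
      case True
      then have "(1 - \<delta>) * p \<le> q"
        using \<open>ennreal (1 - \<delta>) * ennreal p \<le> ennreal q\<close> p q by (simp flip: ennreal_mult)
      moreover have "\<delta> * p \<le> \<delta> * 1" using p \<delta> by (intro mult_left_mono) auto
      ultimately show ?thesis by (simp add: algebra_simps)
    qed (use p q in linarith)
    then show ?thesis unfolding F F\<^sub>a[OF \<epsilon>] p_def q_def \<delta>_def .
  qed
  have upper: "cdf (law M \<tau>) t \<le> cdf (law P (\<tau>\<^sub>a \<epsilon>)) t" if \<epsilon>: "0 < \<epsilon>" for \<epsilon> t
    unfolding F F\<^sub>a[OF \<epsilon>] by (rule first_passage_le_alg_output[OF \<epsilon>])
  have weak: "weak_conv_m (\<lambda>n. law P (\<tau>\<^sub>a (e n))) (law M \<tau>)" if e: "\<And>n. 0 < e n" "e \<longlonglongrightarrow> 0" for e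
    unfolding weak_conv_m_def weak_conv_def
  proof (intro allI impI)
    fix t assume t: "isCont (cdf (law M \<tau>)) t"
    show "(\<lambda>n. cdf (law P (\<tau>\<^sub>a (e n))) t) \<longlonglongrightarrow> cdf (law M \<tau>) t"
    \<comment> \<open>The upper end is the lower estimate of the theorem read at
      \<open>t + e n\<close>; continuity of the limit at \<open>t\<close> closes the gap.\<close>
    proof (rule tendsto_sandwich)
      show "\<forall>\<^sub>F n in sequentially. cdf (law M \<tau>) t \<le> cdf (law P (\<tau>\<^sub>a (e n))) t"
        using upper[OF e(1)] by simp
      show "\<forall>\<^sub>F n in sequentially. cdf (law P (\<tau>\<^sub>a (e n))) t
          \<le> cdf (law M \<tau>) (t + e n) + 3 * sqrt (e n) / sqrt (2 * pi)"
      proof (intro always_eventually allI)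
        fix n show "cdf (law P (\<tau>\<^sub>a (e n))) t \<le> cdf (law M \<tau>) (t + e n) + 3 * sqrt (e n) / sqrt (2 * pi)"
          using lower[OF e(1)[of n], of "t + e n"] by simp
      qed
      have "(\<lambda>n. t + e n) \<longlonglongrightarrow> t + 0" by (intro tendsto_add tendsto_const e(2))
      then have "(\<lambda>n. cdf (law M \<tau>) (t + e n)) \<longlonglongrightarrow> cdf (law M \<tau>) t"
        using isCont_tendsto_compose[OF t] by simp
      moreover have "(\<lambda>n. 3 * sqrt (e n) / sqrt (2 * pi)) \<longlonglongrightarrow> 3 * sqrt 0 / sqrt (2 * pi)"
        by (intro tendsto_intros e(2)) auto
      ultimately have "(\<lambda>n. cdf (law M \<tau>) (t + e n) + 3 * sqrt (e n) / sqrt (2 * pi)) \<longlonglongrightarrow> cdf (law M \<tau>) t + 3 * sqrt 0 / sqrt (2 * pi)"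
        by (rule tendsto_add)
      then show "(\<lambda>n. cdf (law M \<tau>) (t + e n) + 3 * sqrt (e n) / sqrt (2 * pi)) \<longlonglongrightarrow> cdf (law M \<tau>) t"
        by simp
    qed simp
  qed
  obtain C where C: "C > 0" "\<And>\<epsilon>. 0 < \<epsilon> \<Longrightarrow> \<epsilon> < exp (-1) \<Longrightarrow>
      (\<integral>\<^sup>+g. ennreal_of_enat (alg_iterations \<psi> \<epsilon> g) \<partial>gauss_seq) \<le> ennreal (C * sqrt \<bar>ln \<epsilon>\<bar>)"
    by (rule expected_iterations) blast
  have iterations: "(\<integral>\<^sup>+\<omega>. ennreal_of_enat (N \<epsilon> \<omega>) \<partial>P) \<le> ennreal (C * sqrt \<bar>ln \<epsilon>\<bar>)"
    if \<epsilon>: "\<epsilon> \<in> {0<..<exp (-1)}" for \<epsilon>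
  proof -
    have "(\<integral>\<^sup>+\<omega>. ennreal_of_enat (N \<epsilon> \<omega>) \<partial>P)
        = (\<integral>\<^sup>+g. ennreal_of_enat (alg_iterations \<psi> \<epsilon> g) \<partial>distr P gauss_seq (\<lambda>\<omega> n. G n \<omega>))"
      unfolding N by (rule nn_integral_distr[OF G, symmetric]) measurable
    then show ?thesis using C(2) \<epsilon> unfolding G_law by simp
  qed
  have "exp (-1) \<in> {0<..<1::real}" by simp
  then show ?thesis
    using \<tau>_fin \<tau>\<^sub>a_fin weak lower upper C(1) iterations by blast
qed

end
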